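(* Let $L=L_1\cup\cdots\cup L_n$ be an $n$-component oriented link and let $D=D_1\cup\cdots\cup D_n$ be a diagram of $L$, where $D_i$ is the part of $D$ representing $L_i$. Let $X$ be a quandle, $A$ an abelian group (written multiplicatively), $\rho:Q(L)\to X$ a quandle homomorphism from the link quandle $Q(L)$ to $X$, and $\theta:X\times X\to A$ a quandle $2$-cocycle. Let $c_\rho:\mathrm{Arc}(D)\to X$ be the $X$-coloring of $D$ corresponding to $\rho$. Then $$E_0(A(Q(L),\rho;f_\theta,0))=\Bigl(\prod_{i=1}^n(\Phi_\theta(D_i,c_\rho)-1)\Bigr)\subset\mathbb{Z}[A],$$ that is, the $0$-th elementary ideal of the $f$-twisted Alexander matrix of $(Q(L),\rho)$ for the Alexander pair $(f_\theta,0)$ is the ideal of the group ring $\mathbb{Z}[A]$ generated by $\prod_{i=1}^n(\Phi_\theta(D_i,c_\rho)-1)$, where $1$ is the multiplicative identity of $\mathbb{Z}[A]$.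
   Context: **Quandles.** A quandle is a set $X$ with a binary operation $*$ such that (Q1) $x*x=x$ for all $x$; (Q2) for every $y$ the map $x\mapsto x*y$ is a bijection of $X$; (Q3) $(x*y)*z=(x*z)*(y*z)$ for all $x,y,z$. The dual operation $*^{-1}$ is defined by $(x*y)*^{-1}y=(x*^{-1}y)*y=x$. A quandle homomorphism is a map $f$ with $f(x*y)=f(x)*f(y)$. **Quandle presentations.** For a non-empty set $S$ with free group $F(S)$, the free quandle $FQ(S)$ is the quotient of $S\times F(S)$ by the relation $(a,x)\sim(b,y)$ iff $a=b$ and $x=a^ky$ for some $k\in\mathbb{Z}$, with operation $[(a,x)]*[(b,y)]=[(a,xy^{-1}by)]$; $a\in S$ is identified with $[(a,1)]$. For $R\subset FQ(S)\times FQ(S)$, let $\langle\langle R\rangle\rangle$ be the smallest subset of $FQ(S)\times FQ(S)$ containing $R$ which is an equivalence relation and such that $(x,y)\in\langle\langle R\rangle\rangle$ and $z\in FQ(S)$ imply $(x*z,y*z),(x*^{-1}z,y*^{-1}z),(z*x,z*y),(z*^{-1}x,z*^{-1}y)\in\langle\langle R\rangle\rangle$. Put $\langle S\mid R\rangle=FQ(S)/\langle\langle R\rangle\rangle$ with the induced quandle operation. A quandle $Q$ has presentation $\langle S\mid R\rangle$ if it is isomorphic to $\langle S\mid R\rangle$; elements of $S$ are generators and elements of $R$ are relators; the presentation is finite if $S$ and $R$ are finite. **Link quandle.** Let $D$ be a diagram of an oriented link $L$ and $\mathrm{Arc}(D)$ the set of its arcs (the diagram is cut at under-crossings; a component of the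 diagram with no under-crossing is one arc). At a crossing $\chi$, let $x_j$ be the over-arc, $x_i$ the under-arc lying on the right of the oriented over-arc and $x_k$ the under-arc lying on its left; thus if $\chi$ is positive, $x_i$ is the incoming and $x_k$ the outgoing under-arc, and if $\chi$ is negative, $x_k$ is the incoming and $x_i$ the outgoing under-arc. Put $r_\chi=(x_i*x_j,x_k)$. The link quandle $Q(L)$ is the quandle with presentation $\langle \mathrm{Arc}(D)\mid\{r_\chi\mid\chi\text{ a crossing of }D\}\rangle$ (Wirtinger presentation). **Colorings.** An $X$-coloring of $D$ is a map $c:\mathrm{Arc}(D)\to X$ with $c(x_i)*c(x_j)=c(x_k)$ at every crossing, where $x_j$ is the over-arc at the crossing, $x_i$ is the under-arc lying on the right of the oriented over-arc and $x_k$ is the under-arc lying on its left. The coloring corresponding to a quandle homomorphism $\rho:Q(L)\to X$ is $c_\rho(x)=\rho(x)$, where each arc $x$ is regarded as an element of $Q(L)$ via the Wirtinger presentation. **Quandle 2-cocycles and weights.** A quandle $2$-cocycle is a map $\theta:X\times X\to A$ with $\theta(x,x)=e$ (the identity of $A$) and $\theta(x*y,z)\theta(x,y)=\theta(x*z,y*z)\theta(x,z)$ for all $x,y,z\in X$. For an $X$-coloring $c$ and a crossing $\chi$ with over-arc $x_j$, under-arc $x_i$ lying on the right of the oriented over-arc and under-arc $x_k$ lying on its left, $\Phi_\theta(\chi,c)=\theta(c(x_i),c(x_j))$ if $\chi$ is positive and $\theta(c(x_i),c(x_j))^{-1}$ if $\chi$ is negative. Let $UC_i$ be the set of crossings whose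 under-arcs belong to $D_i$; then $\Phi_\theta(D_i,c)=\prod_{\chi\in UC_i}\Phi_\theta(\chi,c)\in A$. **Alexander pairs.** Let $R$ be a ring with unity. A pair of maps $f_1,f_2:X\times X\to R$ is an Alexander pair if for all $x,y,z\in X$: $f_1(x,x)+f_2(x,x)=1$; $f_1(x,y)$ is a unit; $f_1(x*y,z)f_1(x,y)=f_1(x*z,y*z)f_1(x,z)$; $f_1(x*y,z)f_2(x,y)=f_2(x*z,y*z)f_1(y,z)$; and $f_2(x*y,z)=f_1(x*z,y*z)f_2(x,z)+f_2(x*z,y*z)f_2(y,z)$. For a quandle $2$-cocycle $\theta$, $f_\theta:X\times X\to\mathbb{Z}[A]$ is the composite of $\theta$ with the natural inclusion $A\hookrightarrow\mathbb{Z}[A]$, and $0:X\times X\to\mathbb{Z}[A]$ is the constant map to $0$; $(f_\theta,0)$ is an Alexander pair. **$f$-twisted Alexander matrix.** Let $Q$ be a quandle with finite presentation $\langle x_1,\dots,x_n\mid r_1,\dots,r_m\rangle$, $S=\{x_1,\dots,x_n\}$, $\rho:Q\to X$ a quandle homomorphism, $(f_1,f_2)$ an Alexander pair of maps $X\times X\to R$, and $f_i^\rho=f_i\circ(\rho\times\rho)$ (elements of $FQ(S)$ are evaluated through the projection $FQ(S)\to Q$). The $f\circ\rho$-derivative $\partial_j=\frac{\partial_{f\circ\rho}}{\partial x_j}:FQ(S)\to R$ is the (well-defined, unique) map with $\partial_j(x*y)=f_1^\rho(x,y)\partial_j(x)+f_2^\rho(x,y)\partial_j(y)$, $\partial_j(x*^{-1}y)=f_1^\rho(x*^{-1}y,y)^{-1}\partial_j(x)-f_1^\rho(x*^{-1}y,y)^{-1}f_2^\rho(x*^{-1}y,y)\partial_j(y)$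 and $\partial_j(x_i)=\delta_{ij}$. For a relator $r=(u,v)$ put $\partial_j(r)=\partial_j(u)-\partial_j(v)$. Then $A(Q,\rho;f_1,f_2)$ is the $m\times n$ matrix with $(i,j)$ entry $\partial_j(r_i)$. **Elementary ideals.** If $R$ is commutative, $E_d(A(Q,\rho;f_1,f_2))$ is the ideal of $R$ generated by all $(n-d)$-minors of this $m\times n$ matrix if $n-m\le d<n$; it is $0$ if $d<n-m$ and $R$ if $n\le d$. It is known (Ishii–Oshiro) that $E_d(A(Q,\rho;f_1,f_2))$ does not depend on the choice of finite presentation of $Q$. *)

theory Defs
  imports
    "HOL-Algebra.Group"
    "HOL-Library.FuncSet"
    "HOL-Library.Poly_Mapping"
    "Jordan_Normal_Form.Determinant"
    "Jordan_Normal_Form.DL_Submatrix"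
begin

section \<open>Quandles\<close>

record 'a quandle = "'a partial_object" +
  qop :: "'a \<Rightarrow> 'a \<Rightarrow> 'a" (infixl "\<rhd>\<index>" 70)

locale quandle =
  fixes X (structure)
  assumes qop_closed: "\<lbrakk>x \<in> carrier X; y \<in> carrier X\<rbrakk> \<Longrightarrow> x \<rhd> y \<in> carrier X"
    and qop_idem: "x \<in> carrier X \<Longrightarrow> x \<rhd> x = x"
    and qop_bij: "y \<in> carrier X \<Longrightarrow> bij_betw (\<lambda>x. x \<rhd> y) (carrier X) (carrier X)"
    and qop_distrib: "\<lbrakk>x \<in> carrier X; y \<in> carrier X; z \<in> carrier X\<rbrakk>
          \<Longrightarrow> (x \<rhd> y) \<rhd> z = (x \<rhd> z) \<rhd> (y \<rhd> z)"

definition qop_dual :: "('a, 'm) quandle_scheme \<Rightarrow> 'a \<Rightarrow> 'a \<Rightarrow> 'a" (infixl "\<rhd>\<inverse>\<index>" 70) where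
  "x \<rhd>\<inverse>\<^bsub>X\<^esub> y = the_inv_into (carrier X) (\<lambda>z. z \<rhd>\<^bsub>X\<^esub> y) x"

definition quandle_hom :: "('a, 'm) quandle_scheme \<Rightarrow> ('b, 'n) quandle_scheme \<Rightarrow> ('a \<Rightarrow> 'b) set" where
  "quandle_hom X Y = {f \<in> carrier X \<rightarrow> carrier Y.
     \<forall>x\<in>carrier X. \<forall>y\<in>carrier X. f (x \<rhd>\<^bsub>X\<^esub> y) = f x \<rhd>\<^bsub>Y\<^esub> f y}"

definition quandle_iso :: "('a, 'm) quandle_scheme \<Rightarrow> ('b, 'n) quandle_scheme \<Rightarrow> ('a \<Rightarrow> 'b) set" where
  "quandle_iso X Y = {f \<in> quandle_hom X Y. bij_betw f (carrier X) (carrier Y)}"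

section \<open>Free groups\<close>

text \<open>A letter \<open>(a, True)\<close> stands for \<open>a\<close> and \<open>(a, False)\<close> for its inverse; the elements of
  the free group are the reduced words.\<close>

type_synonym 's word = "('s \<times> bool) list"

definition inv_letter :: "'s \<times> bool \<Rightarrow> 's \<times> bool" where
  "inv_letter l = (fst l, \<not> snd l)"

fun reduced :: "'s word \<Rightarrow> bool" where
  "reduced (l # m # w) = (m \<noteq> inv_letter l \<and> reduced (m # w))"
| "reduced w = True"

fun push :: "'s \<times> bool \<Rightarrow> 's word \<Rightarrow> 's word" where
  "push l [] = [l]"
| "push l (m # w) = (if m = inv_letter l then w else l # m # w)"

definition free_group :: "'s set \<Rightarrow> 's word monoid" where
  "free_group S = \<lparr>carrier = {w. reduced w \<and> fst ` set w \<subseteq> S},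
                   mult = (\<lambda>u v. foldr push u v), one = []\<rparr>"

lemma inv_letter_simps [simp]:
  "inv_letter (inv_letter l) = l" "fst (inv_letter l) = fst l" "inv_letter l \<noteq> l"
  by (auto simp: inv_letter_def prod_eq_iff)

lemma reduced_Cons: "reduced (l # w) \<Longrightarrow> reduced w"
  by (cases w) auto

lemma reduced_push: "reduced w \<Longrightarrow> reduced (push l w)"
  by (cases w) (auto dest: reduced_Cons)

lemma push_inv: "reduced w \<Longrightarrow> push (inv_letter l) (push l w) = w"
  by (cases w; cases "tl w") auto

lemma push_inv': "reduced w \<Longrightarrow> push l (push (inv_letter l) w) = w"
  using push_inv[of w "inv_letter l"] by simp

lemma reduced_foldr_push: "reduced v \<Longrightarrow> reduced (foldr push u v)"
  by (induction u) (auto intro: reduced_push)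

lemma letters_push: "fst ` set (push l w) \<subseteq> insert (fst l) (fst ` set w)"
  by (cases w) auto

lemma letters_foldr_push: "fst ` set (foldr push u v) \<subseteq> fst ` set u \<union> fst ` set v"
proof (induction u)
  case (Cons l u)
  have "fst ` set (push l (foldr push u v)) \<subseteq> insert (fst l) (fst ` set u \<union> fst ` set v)"
    by (rule order_trans[OF letters_push]) (rule insert_mono[OF Cons.IH])
  then show ?case by simp
qed simp

lemma foldr_push_push:
  "reduced w \<Longrightarrow> foldr push (push l u) w = push l (foldr push u w)"
proof (cases u)
  case (Cons m u')
  assume "reduced w"
  then show ?thesis
    using Cons push_inv'[of "foldr push u' w" l] by (auto simp: reduced_foldr_push)
qed simp

lemma foldr_push_assoc:
  "reduced w \<Longrightarrow> foldr push (foldr push u v) w = foldr push u (foldr push v w)"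
  by (induction u) (auto simp: foldr_push_push)

lemma foldr_push_reduced: "reduced u \<Longrightarrow> foldr push u [] = u"
proof (induction u)
  case (Cons l u)
  then show ?case by (cases u) (auto dest: reduced_Cons)
qed simp

lemma foldr_push_inverse:
  "reduced w \<Longrightarrow> foldr push (rev (map inv_letter u)) (foldr push u w) = w"
proof (induction u arbitrary: w)
  case (Cons l u)
  then show ?case
    using push_inv[OF reduced_foldr_push[OF Cons.prems, of u], of l] by auto
qed simp

lemma group_free_group: "group (free_group S)"
proof (rule groupI)
  fix x assume x: "x \<in> carrier (free_group S)"
  let ?y = "foldr push (rev (map inv_letter x)) []"
  have "?y \<otimes>\<^bsub>free_group S\<^esub> x = \<one>\<^bsub>free_group S\<^esub>"
    using x foldr_push_assoc[of x "rev (map inv_letter x)" "[]"]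
      foldr_push_inverse[of "[]" x] foldr_push_reduced[of x]
    by (auto simp: free_group_def)
  moreover have "?y \<in> carrier (free_group S)"
    using x letters_foldr_push[of "rev (map inv_letter x)" "[]"]
    by (auto simp: free_group_def reduced_foldr_push image_image)
  ultimately show "\<exists>y\<in>carrier (free_group S). y \<otimes>\<^bsub>free_group S\<^esub> x = \<one>\<^bsub>free_group S\<^esub>" by blast
next
  fix x y assume "x \<in> carrier (free_group S)" "y \<in> carrier (free_group S)"
  then have red: "reduced y" and sub: "fst ` set x \<union> fst ` set y \<subseteq> S"
    by (simp_all add: free_group_def)
  have "fst ` set (foldr push x y) \<subseteq> S"
    by (rule order_trans[OF letters_foldr_push sub])
  with red show "x \<otimes>\<^bsub>free_group S\<^esub> y \<in> carrier (free_group S)"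
    by (simp add: free_group_def reduced_foldr_push)
qed (auto simp: free_group_def foldr_push_assoc)

section \<open>Free quandles and presentations\<close>

definition fq_rel :: "'s set \<Rightarrow> (('s \<times> 's word) \<times> ('s \<times> 's word)) set" where
  "fq_rel S = {((a, x), (b, y)). a \<in> S \<and> b \<in> S \<and>
     x \<in> carrier (free_group S) \<and> y \<in> carrier (free_group S) \<and>
     a = b \<and> (\<exists>k::int. x = ([(a, True)] [^]\<^bsub>free_group S\<^esub> k) \<otimes>\<^bsub>free_group S\<^esub> y)}"

definition free_quandle :: "'s set \<Rightarrow> ('s \<times> 's word) set quandle" where
  "free_quandle S =
    \<lparr>carrier = (S \<times> carrier (free_group S)) // fq_rel S,
     qop = (\<lambda>P Q. \<Union>(a, x)\<in>P. \<Union>(b, y)\<in>Q.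
       fq_rel S `` {(a, x \<otimes>\<^bsub>free_group S\<^esub> inv\<^bsub>free_group S\<^esub> y
                           \<otimes>\<^bsub>free_group S\<^esub> [(b, True)] \<otimes>\<^bsub>free_group S\<^esub> y)})\<rparr>"

definition fq_gen :: "'s set \<Rightarrow> 's \<Rightarrow> ('s \<times> 's word) set" where
  "fq_gen S a = fq_rel S `` {(a, \<one>\<^bsub>free_group S\<^esub>)}"

inductive_set quandle_congruence :: "('a, 'm) quandle_scheme \<Rightarrow> ('a \<times> 'a) set \<Rightarrow> ('a \<times> 'a) set"
  for Q (structure) and R where
  base: "p \<in> R \<Longrightarrow> p \<in> quandle_congruence Q R"
| refl: "x \<in> carrier Q \<Longrightarrow> (x, x) \<in> quandle_congruence Q R"
| sym: "(x, y) \<in> quandle_congruence Q R \<Longrightarrow> (y, x) \<in> quandle_congruence Q R"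
| trans: "\<lbrakk>(x, y) \<in> quandle_congruence Q R; (y, z) \<in> quandle_congruence Q R\<rbrakk>
           \<Longrightarrow> (x, z) \<in> quandle_congruence Q R"
| op_left: "\<lbrakk>(x, y) \<in> quandle_congruence Q R; z \<in> carrier Q\<rbrakk>
           \<Longrightarrow> (x \<rhd> z, y \<rhd> z) \<in> quandle_congruence Q R"
| dual_left: "\<lbrakk>(x, y) \<in> quandle_congruence Q R; z \<in> carrier Q\<rbrakk>
           \<Longrightarrow> (x \<rhd>\<inverse> z, y \<rhd>\<inverse> z) \<in> quandle_congruence Q R"
| op_right: "\<lbrakk>(x, y) \<in> quandle_congruence Q R; z \<in> carrier Q\<rbrakk>
           \<Longrightarrow> (z \<rhd> x, z \<rhd> y) \<in> quandle_congruence Q R"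
| dual_right: "\<lbrakk>(x, y) \<in> quandle_congruence Q R; z \<in> carrier Q\<rbrakk>
           \<Longrightarrow> (z \<rhd>\<inverse> x, z \<rhd>\<inverse> y) \<in> quandle_congruence Q R"

definition quandle_quot :: "('a, 'm) quandle_scheme \<Rightarrow> ('a \<times> 'a) set \<Rightarrow> 'a set quandle" where
  "quandle_quot Q C =
    \<lparr>carrier = carrier Q // C,
     qop = (\<lambda>U V. \<Union>x\<in>U. \<Union>y\<in>V. C `` {x \<rhd>\<^bsub>Q\<^esub> y})\<rparr>"

type_synonym 's fq = "('s \<times> 's word) set"

definition presented_proj :: "'s set \<Rightarrow> ('s fq \<times> 's fq) set \<Rightarrow> 's fq \<Rightarrow> 's fq set" where
  "presented_proj S R u = quandle_congruence (free_quandle S) R `` {u}"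

definition presented_quandle :: "'s set \<Rightarrow> ('s fq \<times> 's fq) set \<Rightarrow> 's fq set quandle" where
  "presented_quandle S R = quandle_quot (free_quandle S) (quandle_congruence (free_quandle S) R)"

text \<open>A finite presentation of \<open>Q\<close> comes with a chosen isomorphism \<open>\<phi>\<close>; the generators and
  relators are listed because they index the columns and rows of a matrix.\<close>

definition finite_presentation ::
    "('q, 'm) quandle_scheme \<Rightarrow> 's list \<Rightarrow> ('s fq \<times> 's fq) list \<Rightarrow> ('s fq set \<Rightarrow> 'q) \<Rightarrow> bool" where
  "finite_presentation Q xs rs \<phi> \<longleftrightarrow>
     xs \<noteq> [] \<and> distinct xs \<and>
     set rs \<subseteq> carrier (free_quandle (set xs)) \<times> carrier (free_quandle (set xs)) \<and>
     \<phi> \<in> quandle_iso (presented_quandle (set xs) (set rs)) Q"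

section \<open>Oriented link diagrams\<close>

text \<open>
  A diagram is recorded by its underlying 4-valent plane graph. At a crossing \<open>c\<close> there are four
  half-edges \<open>(c, s, d)\<close>, where \<open>s\<close> tells whether the half-edge lies on the over- or on the
  under-strand and \<open>d\<close> whether it enters or leaves the crossing along the orientation;
  \<open>edge_at D c s d\<close> is the edge containing it. An edge that is not incident with any crossing
  is a component of the diagram that is a simple closed curve without crossings.
\<close>

datatype strand = Over | Under
datatype direction = In | Out

record ('e, 'c) link_diagram =
  edges :: "'e set"
  crossings :: "'c set"
  edge_at :: "'c \<Rightarrow> strand \<Rightarrow> direction \<Rightarrow> 'e"
  positive :: "'c \<Rightarrow> bool"

definition classes_generated :: "'a set \<Rightarrow> ('a \<Rightarrow> 'a \<Rightarrow> bool) \<Rightarrow> 'a set set" where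
  "classes_generated B r = B // {(x, y). x \<in> B \<and> y \<in> B \<and> equivclp r x y}"

text \<open>The next half-edge counterclockwise around a crossing: at a positive crossing the
  under-strand passes from the right to the left of the over-strand, at a negative one from the
  left to the right.\<close>

fun ccw_next :: "('e, 'c) link_diagram \<Rightarrow> 'c \<times> strand \<times> direction \<Rightarrow> 'c \<times> strand \<times> direction" where
  "ccw_next D (c, Over, Out) = (c, Under, if positive D c then Out else In)"
| "ccw_next D (c, Over, In) = (c, Under, if positive D c then In else Out)"
| "ccw_next D (c, Under, Out) = (c, Over, if positive D c then In else Out)"
| "ccw_next D (c, Under, In) = (c, Over, if positive D c then Out else In)"

definition half_edges :: "('e, 'c) link_diagram \<Rightarrow> ('c \<times> strand \<times> direction) set" where
  "half_edges D = crossings D \<times> UNIV \<times> UNIV"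

definition edge_of :: "('e, 'c) link_diagram \<Rightarrow> 'c \<times> strand \<times> direction \<Rightarrow> 'e" where
  "edge_of D = (\<lambda>(c, s, d). edge_at D c s d)"

definition face_step ::
    "('e, 'c) link_diagram \<Rightarrow> 'c \<times> strand \<times> direction \<Rightarrow> 'c \<times> strand \<times> direction \<Rightarrow> bool" where
  "face_step D h h' \<longleftrightarrow> h \<in> half_edges D \<and>
     (\<exists>g\<in>half_edges D. g \<noteq> h \<and> edge_of D g = edge_of D h \<and> h' = ccw_next D g)"

definition crossings_adjacent :: "('e, 'c) link_diagram \<Rightarrow> 'c \<Rightarrow> 'c \<Rightarrow> bool" where
  "crossings_adjacent D c c' \<longleftrightarrow> c \<in> crossings D \<and> c' \<in> crossings D \<and>
     (\<exists>s d s' d'. edge_at D c s d = edge_at D c' s' d')"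

text \<open>Euler's formula. Every connected component of the 4-valent graph with its rotation system
  has Euler characteristic at most 2, with equality iff it has genus 0, so the equation for the
  totals says that each of them can be drawn in the plane.\<close>

definition planar_diagram :: "('e, 'c) link_diagram \<Rightarrow> bool" where
  "planar_diagram D \<longleftrightarrow>
     int (card (crossings D)) - int (card (edge_of D ` half_edges D))
       + int (card (classes_generated (half_edges D) (face_step D)))
     = 2 * int (card (classes_generated (crossings D) (crossings_adjacent D)))"

definition oriented_link_diagram :: "('e, 'c) link_diagram \<Rightarrow> bool" where
  "oriented_link_diagram D \<longleftrightarrow>
     finite (edges D) \<and> edges D \<noteq> {} \<and> finite (crossings D) \<and>
     edge_of D ` half_edges D \<subseteq> edges D \<and>
     inj_on (\<lambda>(c, s). edge_at D c s In) (crossings D \<times> UNIV) \<and>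
     inj_on (\<lambda>(c, s). edge_at D c s Out) (crossings D \<times> UNIV) \<and>
     (\<lambda>(c, s). edge_at D c s In) ` (crossings D \<times> UNIV)
       = (\<lambda>(c, s). edge_at D c s Out) ` (crossings D \<times> UNIV) \<and>
     planar_diagram D"

text \<open>The diagram parts \<open>D\<^sub>i\<close> are obtained by joining edges along both strands of every
  crossing, the arcs by joining edges along over-strands only. Both are sets of edges.\<close>

definition components :: "('e, 'c) link_diagram \<Rightarrow> 'e set set" where
  "components D = classes_generated (edges D)
     (\<lambda>e e'. \<exists>c\<in>crossings D. \<exists>s. e = edge_at D c s In \<and> e' = edge_at D c s Out)"

definition arcs :: "('e, 'c) link_diagram \<Rightarrow> 'e set set" where
  "arcs D = classes_generated (edges D)
     (\<lambda>e e'. \<exists>c\<in>crossings D. e = edge_at D c Over In \<and> e' = edge_at D c Over Out)"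

definition arc_at :: "('e, 'c) link_diagram \<Rightarrow> 'c \<Rightarrow> strand \<Rightarrow> direction \<Rightarrow> 'e set" where
  "arc_at D c s d = (THE \<alpha>. \<alpha> \<in> arcs D \<and> edge_at D c s d \<in> \<alpha>)"

definition over_arc :: "('e, 'c) link_diagram \<Rightarrow> 'c \<Rightarrow> 'e set" where
  "over_arc D c = arc_at D c Over In"

text \<open>The under-arcs on the right and on the left of the oriented over-arc.\<close>

definition right_arc :: "('e, 'c) link_diagram \<Rightarrow> 'c \<Rightarrow> 'e set" where
  "right_arc D c = arc_at D c Under (if positive D c then In else Out)"

definition left_arc :: "('e, 'c) link_diagram \<Rightarrow> 'c \<Rightarrow> 'e set" where
  "left_arc D c = arc_at D c Under (if positive D c then Out else In)"

definition wirtinger_relator :: "('e, 'c) link_diagram \<Rightarrow> 'c \<Rightarrow> 'e set fq \<times> 'e set fq" where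
  "wirtinger_relator D c =
     (fq_gen (arcs D) (right_arc D c) \<rhd>\<^bsub>free_quandle (arcs D)\<^esub> fq_gen (arcs D) (over_arc D c),
      fq_gen (arcs D) (left_arc D c))"

definition link_quandle :: "('e, 'c) link_diagram \<Rightarrow> 'e set fq set quandle" where
  "link_quandle D = presented_quandle (arcs D) (wirtinger_relator D ` crossings D)"

definition arc_elem :: "('e, 'c) link_diagram \<Rightarrow> 'e set \<Rightarrow> 'e set fq set" where
  "arc_elem D \<alpha> = presented_proj (arcs D) (wirtinger_relator D ` crossings D) (fq_gen (arcs D) \<alpha>)"

definition hom_coloring ::
    "('e, 'c) link_diagram \<Rightarrow> ('e set fq set \<Rightarrow> 'x) \<Rightarrow> 'e set \<Rightarrow> 'x" where
  "hom_coloring D \<rho> \<alpha> = \<rho> (arc_elem D \<alpha>)"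

section \<open>Cocycles and weights\<close>

text \<open>The abelian group \<open>A\<close> is the additive group of a type of class \<^class>\<open>ab_group_add\<close>: its
  identity is \<open>0\<close>, inverses are negatives and products are sums.\<close>

definition quandle_2_cocycle ::
    "('x, 'm) quandle_scheme \<Rightarrow> ('x \<Rightarrow> 'x \<Rightarrow> 'a::ab_group_add) \<Rightarrow> bool" where
  "quandle_2_cocycle X \<theta> \<longleftrightarrow>
     (\<forall>x\<in>carrier X. \<theta> x x = 0) \<and>
     (\<forall>x\<in>carrier X. \<forall>y\<in>carrier X. \<forall>z\<in>carrier X.
        \<theta> (x \<rhd>\<^bsub>X\<^esub> y) z + \<theta> x y = \<theta> (x \<rhd>\<^bsub>X\<^esub> z) (y \<rhd>\<^bsub>X\<^esub> z) + \<theta> x z)"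

definition crossing_weight ::
    "('x \<Rightarrow> 'x \<Rightarrow> 'a::ab_group_add) \<Rightarrow> ('e, 'c) link_diagram \<Rightarrow> 'c \<Rightarrow> ('e set \<Rightarrow> 'x) \<Rightarrow> 'a" where
  "crossing_weight \<theta> D \<chi> \<kappa> =
     (let t = \<theta> (\<kappa> (right_arc D \<chi>)) (\<kappa> (over_arc D \<chi>)) in if positive D \<chi> then t else - t)"

definition under_crossings :: "('e, 'c) link_diagram \<Rightarrow> 'e set \<Rightarrow> 'c set" where
  "under_crossings D K = {\<chi> \<in> crossings D. right_arc D \<chi> \<subseteq> K \<and> left_arc D \<chi> \<subseteq> K}"

definition component_weight ::
    "('x \<Rightarrow> 'x \<Rightarrow> 'a::ab_group_add) \<Rightarrow> ('e, 'c) link_diagram \<Rightarrow> 'e set \<Rightarrow> ('e set \<Rightarrow> 'x) \<Rightarrow> 'a" where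
  "component_weight \<theta> D K \<kappa> = (\<Sum>\<chi>\<in>under_crossings D K. crossing_weight \<theta> D \<chi> \<kappa>)"

section \<open>Alexander pairs and the twisted Alexander matrix\<close>

definition is_inverse :: "'r::ring_1 \<Rightarrow> 'r \<Rightarrow> bool" where
  "is_inverse u v \<longleftrightarrow> u * v = 1 \<and> v * u = 1"

definition ring_inv :: "'r::ring_1 \<Rightarrow> 'r" where
  "ring_inv u = (THE v. is_inverse u v)"

definition alexander_pair ::
    "('x, 'm) quandle_scheme \<Rightarrow> ('x \<Rightarrow> 'x \<Rightarrow> 'r::ring_1) \<Rightarrow> ('x \<Rightarrow> 'x \<Rightarrow> 'r) \<Rightarrow> bool" where
  "alexander_pair X f\<^sub>1 f\<^sub>2 \<longleftrightarrow>
     (\<forall>x\<in>carrier X. \<forall>y\<in>carrier X. \<forall>z\<in>carrier X.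
        f\<^sub>1 x x + f\<^sub>2 x x = 1 \<and>
        (\<exists>v. is_inverse (f\<^sub>1 x y) v) \<and>
        f\<^sub>1 (x \<rhd>\<^bsub>X\<^esub> y) z * f\<^sub>1 x y = f\<^sub>1 (x \<rhd>\<^bsub>X\<^esub> z) (y \<rhd>\<^bsub>X\<^esub> z) * f\<^sub>1 x z \<and>
        f\<^sub>1 (x \<rhd>\<^bsub>X\<^esub> y) z * f\<^sub>2 x y = f\<^sub>2 (x \<rhd>\<^bsub>X\<^esub> z) (y \<rhd>\<^bsub>X\<^esub> z) * f\<^sub>1 y z \<and>
        f\<^sub>2 (x \<rhd>\<^bsub>X\<^esub> y) z = f\<^sub>1 (x \<rhd>\<^bsub>X\<^esub> z) (y \<rhd>\<^bsub>X\<^esub> z) * f\<^sub>2 x z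
                             + f\<^sub>2 (x \<rhd>\<^bsub>X\<^esub> z) (y \<rhd>\<^bsub>X\<^esub> z) * f\<^sub>2 y z)"

text \<open>The group ring \<open>\<int>[A]\<close> is \<^typ>\<open>'a::ab_group_add \<Rightarrow>\<^sub>0 int\<close>, whose multiplication is the
  convolution product.\<close>

definition group_ring_of :: "'a::ab_group_add \<Rightarrow> ('a \<Rightarrow>\<^sub>0 int)" where
  "group_ring_of a = Poly_Mapping.single a 1"

lemma alexander_pair_cocycle:
  fixes \<theta> :: "'x \<Rightarrow> 'x \<Rightarrow> 'a::ab_group_add"
  assumes "quandle_2_cocycle X \<theta>"
  shows "alexander_pair X (\<lambda>x y. group_ring_of (\<theta> x y)) (\<lambda>x y. 0)"
proof -
  have mult: "group_ring_of a * group_ring_of b = group_ring_of (a + b)" for a b :: 'a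
    by (simp add: group_ring_of_def mult_single)
  have one: "group_ring_of (0 :: 'a) = 1"
    by (simp add: group_ring_of_def)
  have unit: "\<exists>v. is_inverse (group_ring_of a) v" for a :: 'a
    by (rule exI[of _ "group_ring_of (- a)"]) (simp add: is_inverse_def mult one)
  show ?thesis
    unfolding alexander_pair_def
    using assms[unfolded quandle_2_cocycle_def]
    by (intro ballI conjI unit) (simp_all only: mult one mult_zero_left mult_zero_right add_0_right)
qed

text \<open>Here \<open>p\<close> maps the free quandle to \<open>X\<close>; being extensional makes the derivative a map on
  the carrier of the free quandle, hence unique.\<close>

definition is_derivative ::
    "'s set \<Rightarrow> ('s fq \<Rightarrow> 'x) \<Rightarrow> ('x \<Rightarrow> 'x \<Rightarrow> 'r::ring_1) \<Rightarrow> ('x \<Rightarrow> 'x \<Rightarrow> 'r) \<Rightarrow> 's \<Rightarrow> ('s fq \<Rightarrow> 'r) \<Rightarrow> bool" where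
  "is_derivative S p f\<^sub>1 f\<^sub>2 s \<delta> \<longleftrightarrow>
     \<delta> \<in> extensional (carrier (free_quandle S)) \<and>
     (\<forall>x\<in>carrier (free_quandle S). \<forall>y\<in>carrier (free_quandle S).
        \<delta> (x \<rhd>\<^bsub>free_quandle S\<^esub> y) = f\<^sub>1 (p x) (p y) * \<delta> x + f\<^sub>2 (p x) (p y) * \<delta> y \<and>
        (let w = x \<rhd>\<inverse>\<^bsub>free_quandle S\<^esub> y; g = ring_inv (f\<^sub>1 (p w) (p y))
         in \<delta> w = g * \<delta> x - g * f\<^sub>2 (p w) (p y) * \<delta> y)) \<and>
     (\<forall>t\<in>S. \<delta> (fq_gen S t) = (if t = s then 1 else 0))"

definition derivative ::
    "'s set \<Rightarrow> ('s fq \<Rightarrow> 'x) \<Rightarrow> ('x \<Rightarrow> 'x \<Rightarrow> 'r::ring_1) \<Rightarrow> ('x \<Rightarrow> 'x \<Rightarrow> 'r) \<Rightarrow> 's \<Rightarrow> 's fq \<Rightarrow> 'r" where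
  "derivative S p f\<^sub>1 f\<^sub>2 s = (THE \<delta>. is_derivative S p f\<^sub>1 f\<^sub>2 s \<delta>)"

definition alexander_matrix ::
    "'s list \<Rightarrow> ('s fq \<times> 's fq) list \<Rightarrow> ('s fq set \<Rightarrow> 'q) \<Rightarrow> ('q \<Rightarrow> 'x)
      \<Rightarrow> ('x \<Rightarrow> 'x \<Rightarrow> 'r::ring_1) \<Rightarrow> ('x \<Rightarrow> 'x \<Rightarrow> 'r) \<Rightarrow> 'r mat" where
  "alexander_matrix xs rs \<phi> \<rho> f\<^sub>1 f\<^sub>2 =
     (let p = (\<lambda>u. \<rho> (\<phi> (presented_proj (set xs) (set rs) u)))
      in mat (length rs) (length xs) (\<lambda>(i, j).
           derivative (set xs) p f\<^sub>1 f\<^sub>2 (xs ! j) (fst (rs ! i))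
         - derivative (set xs) p f\<^sub>1 f\<^sub>2 (xs ! j) (snd (rs ! i))))"

section \<open>Elementary ideals\<close>

definition generated_ideal :: "'r::comm_ring_1 set \<Rightarrow> 'r set" where
  "generated_ideal G = module.span (*) G"

definition minors :: "'r::comm_ring_1 mat \<Rightarrow> nat \<Rightarrow> 'r set" where
  "minors M k = {Determinant.det (submatrix M I J) | I J.
     I \<subseteq> {..<dim_row M} \<and> J \<subseteq> {..<dim_col M} \<and> card I = k \<and> card J = k}"

definition elementary_ideal :: "nat \<Rightarrow> 'r::comm_ring_1 mat \<Rightarrow> 'r set" where
  "elementary_ideal d M =
     (if dim_col M \<le> d then UNIV
      else if d + dim_row M < dim_col M then {0}
      else generated_ideal (minors M (dim_col M - d)))"

end

theory Submission
  imports Defs "HOL-Library.Function_Algebras" "HOL-Combinatorics.Orbits"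
begin

text \<open>With second map \<open>0\<close>, the derivative of an element of the free quandle is concentrated on one
  generator, the one in whose orbit it lies, and is there the group element obtained by adding up
  the cocycle along a word (\<open>derivative_potential\<close>). A row of the twisted Alexander matrix thus
  identifies, up to an element of \<open>A\<close>, two generators: the matrix is the incidence matrix of a
  graph on the generators whose edges carry elements of \<open>A\<close>. The module it presents splits over
  the connected components of that graph, and each summand is the group ring modulo all \<open>h - 1\<close>
  with \<open>h\<close> the sum of labels around a closed walk.

  Both the components and the closed walks can be read off from the quandle instead of the
  presentation: components are orbits, and the sums around closed walks are the holonomy of the
  extension of the quandle by \<open>A\<close>. The module is characterized by derivations on the quandle,
  which are the maps on the free quandle that respect the relators modulo a submodule
  (\<open>derivation_descends\<close>, \<open>derivation_of_word\<close>). If every orbit \<open>k\<close> has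
  cyclic holonomy, generated by \<open>w k\<close>, the row space of the matrix of any finite presentation
  consists of the vectors whose weighted sum over each orbit is divisible by \<open>w k - 1\<close>
  (\<open>elementary_ideal_of_cyclic_orbits\<close>). Since the maximal minors of a matrix generate an ideal
  that depends only on its row space, one change of basis of the columns shows that this ideal is generated by
  the product of the \<open>w k - 1\<close> (\<open>minors_ideal_of_monomial_row_space\<close>).

  It remains to compute the holonomy of the link quandle, for which the Wirtinger presentation is
  the right one. Its graph has the arcs as vertices and one edge per crossing, joining the two
  under-arcs, so its connected components are the circles traced by the components of the link. The
  holonomy is generated by the sum of the crossing weights around the circle
  (\<open>path_sum_step\<close> and \<open>transport_along_orbit\<close>, applied in \<open>elementary_ideal_link_quandle\<close>),
  which is the weight of that component.\<close>

section \<open>The free quandle\<close>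

abbreviation letter :: "'s \<Rightarrow> 's word" where "letter a \<equiv> [(a, True)]"

lemma letter_in_free_group: "a \<in> S \<Longrightarrow> letter a \<in> carrier (free_group S)"
  by (simp add: free_group_def)

lemma inverse_letter:
  assumes "a \<in> S"
  shows "inv\<^bsub>free_group S\<^esub> letter a = [(a, False)]"
proof -
  interpret group "free_group S" by (rule group_free_group)
  show ?thesis
    by (rule inv_equality) (use assms in \<open>auto simp: free_group_def inv_letter_def\<close>)
qed

lemma equiv_fq_rel: "equiv (S \<times> carrier (free_group S)) (fq_rel S)"
proof -
  interpret group "free_group S" by (rule group_free_group)
  show ?thesis
  proof (rule equivI)
    show "refl_on (S \<times> carrier (free_group S)) (fq_rel S)"
      by (auto simp: refl_on_def fq_rel_def letter_in_free_group intro!: exI[of _ "0::int"])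
    show "sym (fq_rel S)"
    proof (rule symI, clarsimp simp: fq_rel_def)
      fix a y k
      assume "a \<in> S" and y: "y \<in> carrier (free_group S)"
      then have "letter a \<in> carrier (free_group S)" by (simp add: letter_in_free_group)
      with y show "\<exists>l::int. y = letter a [^]\<^bsub>free_group S\<^esub> l \<otimes>\<^bsub>free_group S\<^esub>
          (letter a [^]\<^bsub>free_group S\<^esub> (k::int) \<otimes>\<^bsub>free_group S\<^esub> y)"
        by (intro exI[of _ "-k"]) (simp flip: m_assoc int_pow_mult)
    qed
    show "trans (fq_rel S)"
    proof (rule transI, clarsimp simp: fq_rel_def)
      fix a y k l
      assume "a \<in> S" and y: "y \<in> carrier (free_group S)"
      then have "letter a \<in> carrier (free_group S)" by (simp add: letter_in_free_group)
      with y show "\<exists>m::int. letter a [^]\<^bsub>free_group S\<^esub> (k::int) \<otimes>\<^bsub>free_group S\<^esub>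
          (letter a [^]\<^bsub>free_group S\<^esub> (l::int) \<otimes>\<^bsub>free_group S\<^esub> y) =
          letter a [^]\<^bsub>free_group S\<^esub> m \<otimes>\<^bsub>free_group S\<^esub> y"
        by (intro exI[of _ "k + l"]) (simp add: m_assoc int_pow_mult)
    qed
  qed (auto simp: fq_rel_def)
qed

definition fq_class :: "'s set \<Rightarrow> 's \<Rightarrow> 's word \<Rightarrow> 's fq" where
  "fq_class S a w = fq_rel S `` {(a, w)}"

lemma fq_gen_class: "fq_gen S a = fq_class S a \<one>\<^bsub>free_group S\<^esub>"
  by (simp add: fq_gen_def fq_class_def)

lemma fq_class_closed:
  "\<lbrakk>a \<in> S; w \<in> carrier (free_group S)\<rbrakk> \<Longrightarrow> fq_class S a w \<in> carrier (free_quandle S)"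
  by (auto simp: free_quandle_def fq_class_def intro: quotientI)

lemma fq_gen_closed: "a \<in> S \<Longrightarrow> fq_gen S a \<in> carrier (free_quandle S)"
  using group.is_monoid[OF group_free_group, of S]
  by (simp add: fq_gen_class fq_class_closed monoid.one_closed)

lemma fq_carrierE:
  assumes "u \<in> carrier (free_quandle S)"
  obtains a w where "a \<in> S" "w \<in> carrier (free_group S)" "u = fq_class S a w"
  using assms by (auto simp: free_quandle_def fq_class_def elim!: quotientE)

lemma fq_class_eq_iff:
  assumes "a \<in> S" "b \<in> S" "x \<in> carrier (free_group S)" "y \<in> carrier (free_group S)"
  shows "fq_class S a x = fq_class S b y \<longleftrightarrow>
    a = b \<and> (\<exists>k::int. x = letter a [^]\<^bsub>free_group S\<^esub> k \<otimes>\<^bsub>free_group S\<^esub> y)"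
proof -
  have "fq_class S a x = fq_class S b y \<longleftrightarrow> ((a, x), (b, y)) \<in> fq_rel S"
    unfolding fq_class_def using assms by (intro eq_equiv_class_iff[OF equiv_fq_rel]) auto
  then show ?thesis using assms by (simp add: fq_rel_def)
qed

text \<open>Changing the representative of the first factor multiplies the result by a power of \<open>a\<close> on
  the left, and changing that of the second one replaces \<open>b\<close> by its conjugate under a power of
  \<open>b\<close>, which is \<open>b\<close> again. So the union over all representatives in the definition of the
  operation is a single class.\<close>

lemma fq_class_op:
  assumes "a \<in> S" "b \<in> S" "x \<in> carrier (free_group S)" "y \<in> carrier (free_group S)"
  shows "fq_class S a x \<rhd>\<^bsub>free_quandle S\<^esub> fq_class S b y =
    fq_class S a (x \<otimes>\<^bsub>free_group S\<^esub> inv\<^bsub>free_group S\<^esub> y \<otimes>\<^bsub>free_group S\<^esub> letter b \<otimes>\<^bsub>free_group S\<^esub> y)"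
proof -
  interpret group "free_group S" by (rule group_free_group)
  let ?F = "free_group S"
  have lab: "letter a \<in> carrier ?F" "letter b \<in> carrier ?F"
    using assms by (simp_all add: letter_in_free_group)
  have "fq_class S c (x' \<otimes>\<^bsub>?F\<^esub> inv\<^bsub>?F\<^esub> y' \<otimes>\<^bsub>?F\<^esub> letter d \<otimes>\<^bsub>?F\<^esub> y') =
      fq_class S a (x \<otimes>\<^bsub>?F\<^esub> inv\<^bsub>?F\<^esub> y \<otimes>\<^bsub>?F\<^esub> letter b \<otimes>\<^bsub>?F\<^esub> y)"
    if "(c, x') \<in> fq_class S a x" "(d, y') \<in> fq_class S b y" for c d x' y'
  proof -
    from that have cd: "c = a" "d = b" and xy: "x' \<in> carrier ?F" "y' \<in> carrier ?F"
      and ex: "\<exists>k::int. x = letter a [^]\<^bsub>?F\<^esub> k \<otimes>\<^bsub>?F\<^esub> x'"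
      and ey: "\<exists>k::int. y = letter b [^]\<^bsub>?F\<^esub> k \<otimes>\<^bsub>?F\<^esub> y'"
      by (auto simp: fq_class_def fq_rel_def)
    from ex obtain k :: int where k: "x = letter a [^]\<^bsub>?F\<^esub> k \<otimes>\<^bsub>?F\<^esub> x'" by blast
    from ey obtain l :: int where l: "y = letter b [^]\<^bsub>?F\<^esub> l \<otimes>\<^bsub>?F\<^esub> y'" by blast
    let ?b = "letter b [^]\<^bsub>?F\<^esub> l"
    have conj: "inv\<^bsub>?F\<^esub> ?b \<otimes>\<^bsub>?F\<^esub> letter b \<otimes>\<^bsub>?F\<^esub> ?b = letter b"
    proof -
      have "letter b \<otimes>\<^bsub>?F\<^esub> ?b = ?b \<otimes>\<^bsub>?F\<^esub> letter b"
        using lab int_pow_mult[of "letter b" 1 l] int_pow_mult[of "letter b" l 1]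
        by (simp add: add.commute)
      then show ?thesis using lab by (simp add: m_assoc inv_solve_left')
    qed
    have "inv\<^bsub>?F\<^esub> y \<otimes>\<^bsub>?F\<^esub> letter b \<otimes>\<^bsub>?F\<^esub> y =
        inv\<^bsub>?F\<^esub> y' \<otimes>\<^bsub>?F\<^esub> (inv\<^bsub>?F\<^esub> ?b \<otimes>\<^bsub>?F\<^esub> letter b \<otimes>\<^bsub>?F\<^esub> ?b) \<otimes>\<^bsub>?F\<^esub> y'"
      using lab xy unfolding l by (simp add: inv_mult_group m_assoc)
    also have "\<dots> = inv\<^bsub>?F\<^esub> y' \<otimes>\<^bsub>?F\<^esub> letter b \<otimes>\<^bsub>?F\<^esub> y'"
      unfolding conj ..
    finally have "x \<otimes>\<^bsub>?F\<^esub> (inv\<^bsub>?F\<^esub> y \<otimes>\<^bsub>?F\<^esub> letter b \<otimes>\<^bsub>?F\<^esub> y) =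
        letter a [^]\<^bsub>?F\<^esub> k \<otimes>\<^bsub>?F\<^esub> (x' \<otimes>\<^bsub>?F\<^esub> (inv\<^bsub>?F\<^esub> y' \<otimes>\<^bsub>?F\<^esub> letter b \<otimes>\<^bsub>?F\<^esub> y'))"
      using lab xy k by (simp add: m_assoc)
    then have "fq_class S a (x \<otimes>\<^bsub>?F\<^esub> (inv\<^bsub>?F\<^esub> y \<otimes>\<^bsub>?F\<^esub> letter b \<otimes>\<^bsub>?F\<^esub> y)) =
        fq_class S a (x' \<otimes>\<^bsub>?F\<^esub> (inv\<^bsub>?F\<^esub> y' \<otimes>\<^bsub>?F\<^esub> letter b \<otimes>\<^bsub>?F\<^esub> y'))"
      using assms lab xy by (subst fq_class_eq_iff) auto
    then show ?thesis using assms lab xy cd by (simp add: m_assoc)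
  qed
  moreover have "(a, x) \<in> fq_class S a x" "(b, y) \<in> fq_class S b y"
    using assms equiv_class_self[OF equiv_fq_rel, of _ S] by (auto simp: fq_class_def)
  ultimately have "(\<Union>(c, x')\<in>fq_class S a x. \<Union>(d, y')\<in>fq_class S b y.
      fq_class S c (x' \<otimes>\<^bsub>?F\<^esub> inv\<^bsub>?F\<^esub> y' \<otimes>\<^bsub>?F\<^esub> letter d \<otimes>\<^bsub>?F\<^esub> y')) =
    fq_class S a (x \<otimes>\<^bsub>?F\<^esub> inv\<^bsub>?F\<^esub> y \<otimes>\<^bsub>?F\<^esub> letter b \<otimes>\<^bsub>?F\<^esub> y)"
    by (intro equalityI UN_least subsetI) (blast, blast)
  then show ?thesis
    by (simp add: free_quandle_def fq_class_def)
qed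

lemma quandle_free_quandle: "quandle (free_quandle S)"
proof -
  interpret group "free_group S" by (rule group_free_group)
  let ?F = "free_group S"
  note [simp] = letter_in_free_group fq_class_op fq_class_closed fq_class_eq_iff
  show ?thesis
  proof
    fix x y assume "x \<in> carrier (free_quandle S)" "y \<in> carrier (free_quandle S)"
    then show "x \<rhd>\<^bsub>free_quandle S\<^esub> y \<in> carrier (free_quandle S)"
      by (auto elim!: fq_carrierE)
  next
    fix x assume "x \<in> carrier (free_quandle S)"
    then obtain a w where ax: "a \<in> S" "w \<in> carrier ?F" "x = fq_class S a w"
      by (rule fq_carrierE)
    then have "x \<rhd>\<^bsub>free_quandle S\<^esub> x =
        fq_class S a (letter a [^]\<^bsub>?F\<^esub> (1::int) \<otimes>\<^bsub>?F\<^esub> w)"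
      by simp
    also have "\<dots> = x"
      using ax by (simp del: int_pow_1) blast
    finally show "x \<rhd>\<^bsub>free_quandle S\<^esub> x = x" .
  next
    fix y assume "y \<in> carrier (free_quandle S)"
    then obtain b w where b: "b \<in> S" and w: "w \<in> carrier ?F" and y: "y = fq_class S b w"
      by (rule fq_carrierE)
    let ?c = "inv\<^bsub>?F\<^esub> w \<otimes>\<^bsub>?F\<^esub> letter b \<otimes>\<^bsub>?F\<^esub> w"
    have c: "?c \<in> carrier ?F" using b w by simp
    have op: "fq_class S a x \<rhd>\<^bsub>free_quandle S\<^esub> y = fq_class S a (x \<otimes>\<^bsub>?F\<^esub> ?c)"
      if "a \<in> S" "x \<in> carrier ?F" for a x
      using that b w unfolding y by (simp add: m_assoc)
    show "bij_betw (\<lambda>x. x \<rhd>\<^bsub>free_quandle S\<^esub> y) (carrier (free_quandle S)) (carrier (free_quandle S))"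
    proof (rule bij_betw_imageI)
      show "inj_on (\<lambda>x. x \<rhd>\<^bsub>free_quandle S\<^esub> y) (carrier (free_quandle S))"
      proof (rule inj_onI)
        fix u v assume "u \<in> carrier (free_quandle S)" "v \<in> carrier (free_quandle S)"
          and eq: "u \<rhd>\<^bsub>free_quandle S\<^esub> y = v \<rhd>\<^bsub>free_quandle S\<^esub> y"
        then obtain a x a' x' where ax: "a \<in> S" "x \<in> carrier ?F" "u = fq_class S a x"
          "a' \<in> S" "x' \<in> carrier ?F" "v = fq_class S a' x'"
          by (metis fq_carrierE)
        with eq c obtain k :: int where "a = a'"
          "x \<otimes>\<^bsub>?F\<^esub> ?c = letter a [^]\<^bsub>?F\<^esub> k \<otimes>\<^bsub>?F\<^esub> (x' \<otimes>\<^bsub>?F\<^esub> ?c)"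
          by (auto simp: op)
        with ax c have "x = letter a [^]\<^bsub>?F\<^esub> k \<otimes>\<^bsub>?F\<^esub> x'"
          by (simp flip: m_assoc)
        with ax \<open>a = a'\<close> show "u = v" by auto
      qed
      show "(\<lambda>x. x \<rhd>\<^bsub>free_quandle S\<^esub> y) ` carrier (free_quandle S) = carrier (free_quandle S)"
      proof (intro equalityI subsetI)
        fix u assume "u \<in> carrier (free_quandle S)"
        then obtain a x where ax: "a \<in> S" "x \<in> carrier ?F" "u = fq_class S a x"
          by (rule fq_carrierE)
        with c have "u = fq_class S a (x \<otimes>\<^bsub>?F\<^esub> inv\<^bsub>?F\<^esub> ?c) \<rhd>\<^bsub>free_quandle S\<^esub> y"
          by (subst op) (simp_all only: m_closed inv_closed m_assoc l_inv r_one)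
        with ax c show "u \<in> (\<lambda>x. x \<rhd>\<^bsub>free_quandle S\<^esub> y) ` carrier (free_quandle S)" by auto
      qed (use op c in \<open>auto elim!: fq_carrierE\<close>)
    qed
  next
    fix x y z assume "x \<in> carrier (free_quandle S)" "y \<in> carrier (free_quandle S)"
      "z \<in> carrier (free_quandle S)"
    then obtain a b c u v w where abc: "a \<in> S" "b \<in> S" "c \<in> S"
      and uvw: "u \<in> carrier ?F" "v \<in> carrier ?F" "w \<in> carrier ?F"
      and eq: "x = fq_class S a u" "y = fq_class S b v" "z = fq_class S c w"
      by (metis fq_carrierE)
    let ?d = "inv\<^bsub>?F\<^esub> w \<otimes>\<^bsub>?F\<^esub> letter c \<otimes>\<^bsub>?F\<^esub> w"
    have d: "?d \<in> carrier ?F" using abc uvw by simp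
    have "u \<otimes>\<^bsub>?F\<^esub> ?d \<otimes>\<^bsub>?F\<^esub> inv\<^bsub>?F\<^esub> (v \<otimes>\<^bsub>?F\<^esub> ?d) \<otimes>\<^bsub>?F\<^esub> letter b \<otimes>\<^bsub>?F\<^esub> (v \<otimes>\<^bsub>?F\<^esub> ?d)
        = u \<otimes>\<^bsub>?F\<^esub> (?d \<otimes>\<^bsub>?F\<^esub> inv\<^bsub>?F\<^esub> ?d) \<otimes>\<^bsub>?F\<^esub> inv\<^bsub>?F\<^esub> v \<otimes>\<^bsub>?F\<^esub> letter b \<otimes>\<^bsub>?F\<^esub> (v \<otimes>\<^bsub>?F\<^esub> ?d)"
      using abc uvw d by (simp only: inv_mult_group m_assoc m_closed inv_closed letter_in_free_group)
    also have "\<dots> = u \<otimes>\<^bsub>?F\<^esub> inv\<^bsub>?F\<^esub> v \<otimes>\<^bsub>?F\<^esub> letter b \<otimes>\<^bsub>?F\<^esub> v \<otimes>\<^bsub>?F\<^esub> ?d"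
      using abc uvw d by (simp only: r_inv r_one m_assoc m_closed inv_closed letter_in_free_group)
    finally show "x \<rhd>\<^bsub>free_quandle S\<^esub> y \<rhd>\<^bsub>free_quandle S\<^esub> z =
        x \<rhd>\<^bsub>free_quandle S\<^esub> z \<rhd>\<^bsub>free_quandle S\<^esub> (y \<rhd>\<^bsub>free_quandle S\<^esub> z)"
      using abc uvw d unfolding eq by (simp add: m_assoc)
  qed
qed

section \<open>Quandles and homomorphisms\<close>

context quandle
begin

lemma dual_closed: "\<lbrakk>x \<in> carrier X; y \<in> carrier X\<rbrakk> \<Longrightarrow> x \<rhd>\<inverse> y \<in> carrier X"
  unfolding qop_dual_def using qop_bij[of y]
  by (metis bij_betw_def the_inv_into_into order_refl)

lemma op_dual: "\<lbrakk>x \<in> carrier X; y \<in> carrier X\<rbrakk> \<Longrightarrow> (x \<rhd>\<inverse> y) \<rhd> y = x"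
  unfolding qop_dual_def using qop_bij[of y]
  by (simp add: bij_betw_def f_the_inv_into_f[of "\<lambda>z. z \<rhd> y"])

lemma dual_op: "\<lbrakk>x \<in> carrier X; y \<in> carrier X\<rbrakk> \<Longrightarrow> (x \<rhd> y) \<rhd>\<inverse> y = x"
  unfolding qop_dual_def using qop_bij[of y]
  by (simp add: bij_betw_def the_inv_into_f_f[of "\<lambda>z. z \<rhd> y"])

lemma dual_eqI:
  "\<lbrakk>x \<in> carrier X; y \<in> carrier X; z \<in> carrier X; z \<rhd> y = x\<rbrakk> \<Longrightarrow> x \<rhd>\<inverse> y = z"
  using dual_op by blast

lemma dual_distrib:
  assumes "x \<in> carrier X" "y \<in> carrier X" "z \<in> carrier X"
  shows "(x \<rhd> y) \<rhd>\<inverse> z = (x \<rhd>\<inverse> z) \<rhd> (y \<rhd>\<inverse> z)"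
  using assms by (intro dual_eqI) (simp_all add: qop_closed dual_closed qop_distrib op_dual)

end

lemma quandle_hom_closed: "\<lbrakk>h \<in> quandle_hom X Y; x \<in> carrier X\<rbrakk> \<Longrightarrow> h x \<in> carrier Y"
  by (auto simp: quandle_hom_def)

lemma quandle_hom_op:
  "\<lbrakk>h \<in> quandle_hom X Y; x \<in> carrier X; y \<in> carrier X\<rbrakk> \<Longrightarrow> h (x \<rhd>\<^bsub>X\<^esub> y) = h x \<rhd>\<^bsub>Y\<^esub> h y"
  by (auto simp: quandle_hom_def)

lemma quandle_hom_dual:
  assumes "quandle X" "quandle Y" "h \<in> quandle_hom X Y" "x \<in> carrier X" "y \<in> carrier X"
  shows "h (x \<rhd>\<inverse>\<^bsub>X\<^esub> y) = h x \<rhd>\<inverse>\<^bsub>Y\<^esub> h y"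
  using assms
  by (intro quandle.dual_eqI[symmetric])
    (auto simp: quandle_hom_closed quandle.dual_closed quandle.op_dual simp flip: quandle_hom_op)

lemma quandle_hom_compose:
  "\<lbrakk>f \<in> quandle_hom X Y; g \<in> quandle_hom Y Z\<rbrakk> \<Longrightarrow> (\<lambda>x. g (f x)) \<in> quandle_hom X Z"
  by (auto simp: quandle_hom_def Pi_iff)

section \<open>Generators of the free quandle\<close>

lemma reduced_appendD: "reduced (u @ v) \<Longrightarrow> reduced u"
  by (induction u rule: reduced.induct) auto

lemma append_letter_free_group:
  assumes "w @ [l] \<in> carrier (free_group S)"
  shows "w \<in> carrier (free_group S)" "w \<otimes>\<^bsub>free_group S\<^esub> [l] = w @ [l]"
proof -
  show "w \<in> carrier (free_group S)"
    using assms by (auto simp: free_group_def dest: reduced_appendD)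
  show "w \<otimes>\<^bsub>free_group S\<^esub> [l] = w @ [l]"
    using assms foldr_push_reduced[of "w @ [l]"] by (simp add: free_group_def)
qed

lemma fq_class_op_gen:
  assumes "a \<in> S" "b \<in> S" "w \<in> carrier (free_group S)"
  shows "fq_class S a w \<rhd>\<^bsub>free_quandle S\<^esub> fq_gen S b =
    fq_class S a (w \<otimes>\<^bsub>free_group S\<^esub> [(b, True)])"
proof -
  interpret group "free_group S" by (rule group_free_group)
  show ?thesis using assms by (simp add: fq_gen_class fq_class_op letter_in_free_group)
qed

lemma fq_class_dual_gen:
  assumes "a \<in> S" "b \<in> S" "w \<in> carrier (free_group S)"
  shows "fq_class S a w \<rhd>\<inverse>\<^bsub>free_quandle S\<^esub> fq_gen S b =
    fq_class S a (w \<otimes>\<^bsub>free_group S\<^esub> [(b, False)])"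
proof -
  interpret group "free_group S" by (rule group_free_group)
  have "[(b, False)] \<in> carrier (free_group S)" using assms by (simp add: free_group_def)
  moreover have "[(b, False)] \<otimes>\<^bsub>free_group S\<^esub> [(b, True)] = \<one>\<^bsub>free_group S\<^esub>"
    using assms by (simp add: letter_in_free_group flip: inverse_letter)
  ultimately show ?thesis
    using assms
    by (intro quandle.dual_eqI quandle_free_quandle)
      (simp_all add: fq_class_closed fq_gen_closed fq_class_op_gen m_assoc letter_in_free_group)
qed

text \<open>A reduced word can be stripped of its last letter, and appending the letter \<open>b\<close> or its
  inverse to \<open>w\<close> is acting by the generator \<open>b\<close> through the operation or its dual. So every
  element is reached from a generator by acting with generators only.\<close>

lemma free_quandle_induct [consumes 1, case_names gen op dual]:
  assumes u: "u \<in> carrier (free_quandle S)"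
    and gen: "\<And>s. s \<in> S \<Longrightarrow> P (fq_gen S s)"
    and op: "\<And>x s. \<lbrakk>x \<in> carrier (free_quandle S); s \<in> S; P x\<rbrakk>
      \<Longrightarrow> P (x \<rhd>\<^bsub>free_quandle S\<^esub> fq_gen S s)"
    and dual: "\<And>x s. \<lbrakk>x \<in> carrier (free_quandle S); s \<in> S; P x\<rbrakk>
      \<Longrightarrow> P (x \<rhd>\<inverse>\<^bsub>free_quandle S\<^esub> fq_gen S s)"
  shows "P u"
proof -
  from u obtain a w where a: "a \<in> S" and w: "w \<in> carrier (free_group S)"
    and u_eq: "u = fq_class S a w" by (rule fq_carrierE)
  from w have "P (fq_class S a w)"
  proof (induction w rule: rev_induct)
    case Nil
    show ?case using gen[OF a] by (simp add: fq_gen_class free_group_def)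
  next
    case (snoc l w)
    obtain b e where l: "l = (b, e)" by (cases l)
    have b: "b \<in> S" using snoc.prems l by (simp add: free_group_def)
    note w = append_letter_free_group[OF snoc.prems]
    have "P (fq_class S a (w \<otimes>\<^bsub>free_group S\<^esub> [(b, e)]))"
      using op[OF fq_class_closed[OF a w(1)] b] dual[OF fq_class_closed[OF a w(1)] b]
        snoc.IH[OF w(1)] fq_class_op_gen[OF a b w(1)] fq_class_dual_gen[OF a b w(1)]
      by (cases e) simp_all
    then show ?case using w(2) l by simp
  qed
  then show ?thesis by (simp add: u_eq)
qed

lemma free_quandle_hom_unique:
  assumes "quandle Y" "g \<in> quandle_hom (free_quandle S) Y" "h \<in> quandle_hom (free_quandle S) Y"
    and "\<And>s. s \<in> S \<Longrightarrow> g (fq_gen S s) = h (fq_gen S s)"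
    and "u \<in> carrier (free_quandle S)"
  shows "g u = h u"
  using assms(5)
proof (induction rule: free_quandle_induct)
  case (op x s)
  then show ?case
    using assms(4) by (simp add: quandle_hom_op[OF assms(2)] quandle_hom_op[OF assms(3)] fq_gen_closed)
next
  case (dual x s)
  then show ?case
    using assms(4)
    by (simp add: quandle_hom_dual[OF quandle_free_quandle assms(1,2)]
        quandle_hom_dual[OF quandle_free_quandle assms(1,3)] fq_gen_closed)
qed (use assms(4) in simp)

definition letter_action :: "('y, 'm) quandle_scheme \<Rightarrow> ('s \<Rightarrow> 'y) \<Rightarrow> 'y \<Rightarrow> 's \<times> bool \<Rightarrow> 'y" where
  "letter_action Y f y l = (if snd l then y \<rhd>\<^bsub>Y\<^esub> f (fst l) else y \<rhd>\<inverse>\<^bsub>Y\<^esub> f (fst l))"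

text \<open>A word acts on the target quandle through the translations by the images of its letters, and
  \<open>[(a, w)]\<close> is sent to the result of letting \<open>w\<close> act on \<open>f a\<close>. Cancellation of letters is
  respected because translations are bijective, and the relation \<open>(a, w) \<sim> (a, a\<^sup>k w)\<close> because
  \<open>f a\<close> is fixed by its own translation. Translations being automorphisms makes the map a
  homomorphism.\<close>

lemma free_quandle_universal:
  fixes Y :: "('y, 'm) quandle_scheme"
  assumes "quandle Y" and f: "f \<in> S \<rightarrow> carrier Y"
  obtains h where "h \<in> quandle_hom (free_quandle S) Y" "\<And>s. s \<in> S \<Longrightarrow> h (fq_gen S s) = f s"
proof -
  interpret Y: quandle Y by fact
  interpret F: group "free_group S" by (rule group_free_group)
  let ?F = "free_group S"
  let ?act = "letter_action Y f"
  have closed: "foldl ?act y w \<in> carrier Y" if "y \<in> carrier Y" "fst ` set w \<subseteq> S" for y w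
    using that
  proof (induction w arbitrary: y)
    case (Cons l w)
    then show ?case
      using f by (auto simp: letter_action_def Y.qop_closed Y.dual_closed Pi_iff)
  qed simp
  have cancel: "?act (?act y l) (inv_letter l) = y" if "y \<in> carrier Y" "fst l \<in> S" for y l
    using that f by (auto simp: letter_action_def inv_letter_def Y.dual_op Y.op_dual Pi_iff)
  have push: "foldl ?act y (push l w) = foldl ?act (?act y l) w"
    if "y \<in> carrier Y" "fst l \<in> S" for y l w
    using that cancel by (cases w) auto
  have foldr_push: "foldl ?act y (foldr push u v) = foldl ?act (foldl ?act y u) v"
    if "y \<in> carrier Y" "fst ` set u \<subseteq> S" for y u v
    using that
  proof (induction u arbitrary: y)
    case (Cons l u)
    then have "?act y l \<in> carrier Y" using closed[of y "[l]"] by simp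
    with Cons show ?case by (simp add: push)
  qed simp
  have act_mult: "foldl ?act y (u \<otimes>\<^bsub>?F\<^esub> v) = foldl ?act (foldl ?act y u) v"
    if "y \<in> carrier Y" "u \<in> carrier ?F" for y u v
    using that foldr_push[of y u v] by (simp add: free_group_def)
  have act_closed: "foldl ?act y u \<in> carrier Y" if "y \<in> carrier Y" "u \<in> carrier ?F" for y u
    using that closed[of y u] by (simp add: free_group_def)
  have act_one: "foldl ?act y \<one>\<^bsub>?F\<^esub> = y" for y by (simp add: free_group_def)
  have act_inv: "foldl ?act (foldl ?act y (inv\<^bsub>?F\<^esub> u)) u = y"
    if "y \<in> carrier Y" "u \<in> carrier ?F" for y u
    using that by (simp add: act_one flip: act_mult)
  have act_op: "foldl ?act (y \<rhd>\<^bsub>Y\<^esub> z) u = foldl ?act y u \<rhd>\<^bsub>Y\<^esub> foldl ?act z u"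
    if "y \<in> carrier Y" "z \<in> carrier Y" "fst ` set u \<subseteq> S" for y z u
    using that
  proof (induction u arbitrary: y z)
    case (Cons l u)
    then have "?act y l \<in> carrier Y" "?act z l \<in> carrier Y"
      using closed[of y "[l]"] closed[of z "[l]"] by simp_all
    moreover have "?act (y \<rhd>\<^bsub>Y\<^esub> z) l = ?act y l \<rhd>\<^bsub>Y\<^esub> ?act z l"
      using Cons.prems f by (auto simp: letter_action_def Y.qop_distrib Y.dual_distrib Pi_iff)
    ultimately show ?case using Cons by simp
  qed simp
  have fS: "f s \<in> carrier Y" if "s \<in> S" for s using f that by auto
  have act_pow: "foldl ?act (f a) (letter a [^]\<^bsub>?F\<^esub> (k::int)) = f a" if a: "a \<in> S" for a k
  proof -
    let ?H = "{x \<in> carrier ?F. foldl ?act (f a) x = f a}"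
    have "subgroup ?H ?F"
    proof (rule F.subgroupI)
      show "inv\<^bsub>?F\<^esub> x \<in> ?H" if "x \<in> ?H" for x
        using that act_mult[of "f a" x "inv\<^bsub>?F\<^esub> x"] fS[OF a] by (auto simp: act_one)
    qed (use fS[OF a] in \<open>auto simp: act_one act_mult intro!: exI[of _ "\<one>\<^bsub>?F\<^esub>"]\<close>)
    moreover have "letter a \<in> ?H"
      using a fS[OF a] by (simp add: letter_in_free_group letter_action_def Y.qop_idem)
    ultimately have "letter a [^]\<^bsub>?F\<^esub> k \<in> ?H"
      using group.int_pow_closed[OF F.subgroup_imp_group, of ?H "letter a" k]
        F.int_pow_consistent[of ?H "letter a" k] by simp
    then show ?thesis by simp
  qed
  define h where "h u = (SOME y. \<exists>a\<in>S. \<exists>w\<in>carrier ?F. u = fq_class S a w \<and> y = foldl ?act (f a) w)" for u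
  have h_class: "h (fq_class S a w) = foldl ?act (f a) w" if a: "a \<in> S" and w: "w \<in> carrier ?F" for a w
    unfolding h_def
  proof (rule some_equality)
    show "\<exists>a'\<in>S. \<exists>w'\<in>carrier ?F. fq_class S a w = fq_class S a' w' \<and>
        foldl ?act (f a) w = foldl ?act (f a') w'"
      using a w by blast
  next
    fix y assume "\<exists>a'\<in>S. \<exists>w'\<in>carrier ?F. fq_class S a w = fq_class S a' w' \<and> y = foldl ?act (f a') w'"
    then obtain w' where w': "w' \<in> carrier ?F" "fq_class S a w = fq_class S a w'"
      "y = foldl ?act (f a) w'"
      using a w fq_class_eq_iff[of a S] by metis
    then obtain k :: int where "w = letter a [^]\<^bsub>?F\<^esub> k \<otimes>\<^bsub>?F\<^esub> w'"
      using a w by (auto simp: fq_class_eq_iff)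
    then have "foldl ?act (f a) w = foldl ?act (foldl ?act (f a) (letter a [^]\<^bsub>?F\<^esub> k)) w'"
      using a fS[OF a] by (simp add: act_mult letter_in_free_group)
    then show "y = foldl ?act (f a) w" using w' a by (simp add: act_pow)
  qed
  show ?thesis
  proof
    show "h (fq_gen S s) = f s" if "s \<in> S" for s
      using that by (simp add: fq_gen_class h_class act_one)
    show "h \<in> quandle_hom (free_quandle S) Y"
      unfolding quandle_hom_def
    proof (intro CollectI conjI ballI funcsetI)
      fix u assume "u \<in> carrier (free_quandle S)"
      then show "h u \<in> carrier Y"
        by (auto elim!: fq_carrierE simp: h_class act_closed fS)
    next
      fix u v assume "u \<in> carrier (free_quandle S)" "v \<in> carrier (free_quandle S)"
      then obtain a x b y where ab: "a \<in> S" "b \<in> S" and xy: "x \<in> carrier ?F" "y \<in> carrier ?F"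
        and eq: "u = fq_class S a x" "v = fq_class S b y"
        by (metis fq_carrierE)
      let ?q = "foldl ?act (foldl ?act (f a) x) (inv\<^bsub>?F\<^esub> y)"
      have q: "?q \<in> carrier Y" using ab xy by (simp add: act_closed fS)
      have "h (u \<rhd>\<^bsub>free_quandle S\<^esub> v) = foldl ?act (?act ?q (b, True)) y"
        using ab xy fS by (simp add: eq fq_class_op h_class act_mult act_closed letter_in_free_group)
      also have "?act ?q (b, True) = ?q \<rhd>\<^bsub>Y\<^esub> f b" by (simp add: letter_action_def)
      also have "foldl ?act (?q \<rhd>\<^bsub>Y\<^esub> f b) y = foldl ?act ?q y \<rhd>\<^bsub>Y\<^esub> foldl ?act (f b) y"
        using xy q fS[OF ab(2)] by (intro act_op) (auto simp: free_group_def)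
      also have "\<dots> = h u \<rhd>\<^bsub>Y\<^esub> h v"
        using ab xy fS by (simp add: eq h_class act_inv act_closed)
      finally show "h (u \<rhd>\<^bsub>free_quandle S\<^esub> v) = h u \<rhd>\<^bsub>Y\<^esub> h v" .
    qed
  qed
qed

section \<open>Presented quandles\<close>

lemma congruence_closed:
  assumes "quandle Q" "R \<subseteq> carrier Q \<times> carrier Q" "(u, v) \<in> quandle_congruence Q R"
  shows "u \<in> carrier Q" "v \<in> carrier Q"
proof -
  have "p \<in> carrier Q \<times> carrier Q" if "p \<in> quandle_congruence Q R" for p
    using that
    by (induction rule: quandle_congruence.induct)
      (use assms(1,2) in \<open>auto simp: quandle.qop_closed quandle.dual_closed\<close>)
  from this[OF assms(3)] show "u \<in> carrier Q" "v \<in> carrier Q" by auto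
qed

lemma equiv_congruence:
  assumes "quandle Q" "R \<subseteq> carrier Q \<times> carrier Q"
  shows "equiv (carrier Q) (quandle_congruence Q R)"
  by (intro equivI refl_onI symI transI)
    (auto intro: quandle_congruence.intros dest: congruence_closed[OF assms])

lemma congruence_op:
  assumes "quandle Q" "R \<subseteq> carrier Q \<times> carrier Q"
    and "(u, u') \<in> quandle_congruence Q R" "(v, v') \<in> quandle_congruence Q R"
  shows "(u \<rhd>\<^bsub>Q\<^esub> v, u' \<rhd>\<^bsub>Q\<^esub> v') \<in> quandle_congruence Q R"
  using assms congruence_closed[OF assms(1,2)]
  by (blast intro: quandle_congruence.trans quandle_congruence.op_left quandle_congruence.op_right)

text \<open>A presentation is handled through the evaluation map \<open>\<psi>\<close> from the free quandle to the
  presented one, which is the form common to the Wirtinger presentation, where \<open>\<psi>\<close> is the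
  projection, and to an arbitrary presentation of the same quandle, where it is the projection
  followed by an isomorphism.\<close>

definition presents ::
    "'s set \<Rightarrow> ('s fq \<times> 's fq) set \<Rightarrow> ('q, 'm) quandle_scheme \<Rightarrow> ('s fq \<Rightarrow> 'q) \<Rightarrow> bool" where
  "presents S R Q \<psi> \<longleftrightarrow>
     R \<subseteq> carrier (free_quandle S) \<times> carrier (free_quandle S) \<and>
     \<psi> \<in> quandle_hom (free_quandle S) Q \<and>
     \<psi> ` carrier (free_quandle S) = carrier Q \<and>
     (\<forall>u\<in>carrier (free_quandle S). \<forall>v\<in>carrier (free_quandle S).
        \<psi> u = \<psi> v \<longleftrightarrow> (u, v) \<in> quandle_congruence (free_quandle S) R)"

lemma presentsD:
  assumes "presents S R Q \<psi>"
  shows "R \<subseteq> carrier (free_quandle S) \<times> carrier (free_quandle S)"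
    and "\<psi> \<in> quandle_hom (free_quandle S) Q"
    and "\<psi> ` carrier (free_quandle S) = carrier Q"
    and "\<lbrakk>u \<in> carrier (free_quandle S); v \<in> carrier (free_quandle S)\<rbrakk> \<Longrightarrow>
      \<psi> u = \<psi> v \<longleftrightarrow> (u, v) \<in> quandle_congruence (free_quandle S) R"
  using assms unfolding presents_def by blast+

lemma presents_presented_quandle:
  assumes R: "R \<subseteq> carrier (free_quandle S) \<times> carrier (free_quandle S)"
  shows "presents S R (presented_quandle S R) (presented_proj S R)"
proof -
  let ?Q = "free_quandle S" and ?C = "quandle_congruence (free_quandle S) R"
  note eqv = equiv_congruence[OF quandle_free_quandle R]
  have op: "presented_proj S R u \<rhd>\<^bsub>presented_quandle S R\<^esub> presented_proj S R v =
      presented_proj S R (u \<rhd>\<^bsub>?Q\<^esub> v)" if uv: "u \<in> carrier ?Q" "v \<in> carrier ?Q" for u v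
  proof -
    have "?C `` {x \<rhd>\<^bsub>?Q\<^esub> y} = ?C `` {u \<rhd>\<^bsub>?Q\<^esub> v}"
      if "x \<in> ?C `` {u}" "y \<in> ?C `` {v}" for x y
      using that by (intro equiv_class_eq[OF eqv, symmetric] congruence_op quandle_free_quandle R) auto
    moreover have "u \<in> ?C `` {u}" "v \<in> ?C `` {v}"
      using uv by (auto intro: quandle_congruence.refl)
    ultimately have "(\<Union>x\<in>?C `` {u}. \<Union>y\<in>?C `` {v}. ?C `` {x \<rhd>\<^bsub>?Q\<^esub> y}) = ?C `` {u \<rhd>\<^bsub>?Q\<^esub> v}"
      by (intro equalityI UN_least subsetI) (blast, blast)
    then show ?thesis
      by (simp add: presented_proj_def presented_quandle_def quandle_quot_def)
  qed
  have carrier: "carrier (presented_quandle S R) = presented_proj S R ` carrier ?Q"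
    by (auto simp: presented_quandle_def quandle_quot_def presented_proj_def quotient_def)
  show ?thesis
    unfolding presents_def
  proof (intro conjI ballI)
    show "presented_proj S R \<in> quandle_hom ?Q (presented_quandle S R)"
      by (auto simp: quandle_hom_def op carrier)
    show "presented_proj S R u = presented_proj S R v \<longleftrightarrow> (u, v) \<in> ?C"
      if "u \<in> carrier ?Q" "v \<in> carrier ?Q" for u v
      unfolding presented_proj_def using that by (intro eq_equiv_class_iff[OF eqv])
  qed (use R carrier in auto)
qed

lemma finite_presentation_presents:
  assumes "finite_presentation Q xs rs \<phi>"
  shows "presents (set xs) (set rs) Q (\<lambda>u. \<phi> (presented_proj (set xs) (set rs) u))"
proof -
  have R: "set rs \<subseteq> carrier (free_quandle (set xs)) \<times> carrier (free_quandle (set xs))"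
    and \<phi>: "\<phi> \<in> quandle_hom (presented_quandle (set xs) (set rs)) Q"
    "inj_on \<phi> (carrier (presented_quandle (set xs) (set rs)))"
    "\<phi> ` carrier (presented_quandle (set xs) (set rs)) = carrier Q"
    using assms by (auto simp: finite_presentation_def quandle_iso_def bij_betw_def)
  let ?\<pi> = "presented_proj (set xs) (set rs)"
  have \<pi>: "?\<pi> \<in> quandle_hom (free_quandle (set xs)) (presented_quandle (set xs) (set rs))"
    and \<pi>_onto: "?\<pi> ` carrier (free_quandle (set xs)) = carrier (presented_quandle (set xs) (set rs))"
    and \<pi>_eq: "\<And>u v. \<lbrakk>u \<in> carrier (free_quandle (set xs)); v \<in> carrier (free_quandle (set xs))\<rbrakk> \<Longrightarrow>
      ?\<pi> u = ?\<pi> v \<longleftrightarrow> (u, v) \<in> quandle_congruence (free_quandle (set xs)) (set rs)"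
    using presents_presented_quandle[OF R] unfolding presents_def by blast+
  show ?thesis
    unfolding presents_def
  proof (intro conjI ballI R)
    show "(\<lambda>u. \<phi> (?\<pi> u)) \<in> quandle_hom (free_quandle (set xs)) Q"
      by (rule quandle_hom_compose[OF \<pi> \<phi>(1)])
    show "(\<lambda>u. \<phi> (?\<pi> u)) ` carrier (free_quandle (set xs)) = carrier Q"
      unfolding \<phi>(3)[symmetric] \<pi>_onto[symmetric] image_image ..
    show "\<phi> (?\<pi> u) = \<phi> (?\<pi> v) \<longleftrightarrow>
        (u, v) \<in> quandle_congruence (free_quandle (set xs)) (set rs)"
      if "u \<in> carrier (free_quandle (set xs))" "v \<in> carrier (free_quandle (set xs))" for u v
      using inj_on_eq_iff[OF \<phi>(2) quandle_hom_closed[OF \<pi> that(1)] quandle_hom_closed[OF \<pi> that(2)]] \<pi>_eq[OF that]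
      by simp
  qed
qed

lemma orbit_invariant_congruence:
  assumes R: "R \<subseteq> carrier (free_quandle S) \<times> carrier (free_quandle S)"
    and inv: "\<And>u v. \<lbrakk>u \<in> carrier (free_quandle S); v \<in> carrier (free_quandle S)\<rbrakk>
      \<Longrightarrow> f (u \<rhd>\<^bsub>free_quandle S\<^esub> v) = f u"
    and rel: "\<And>u v. (u, v) \<in> R \<Longrightarrow> f u = f v"
    and uv: "(u, v) \<in> quandle_congruence (free_quandle S) R"
  shows "f u = f v"
proof -
  have dual: "f (u \<rhd>\<inverse>\<^bsub>free_quandle S\<^esub> v) = f u"
    if "u \<in> carrier (free_quandle S)" "v \<in> carrier (free_quandle S)" for u v
    using that inv[of "u \<rhd>\<inverse>\<^bsub>free_quandle S\<^esub> v" v]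
    by (simp add: quandle.dual_closed quandle.op_dual quandle_free_quandle)
  have "p \<in> carrier (free_quandle S) \<times> carrier (free_quandle S) \<and> f (fst p) = f (snd p)"
    if "p \<in> quandle_congruence (free_quandle S) R" for p
    using that
  proof (induction rule: quandle_congruence.induct)
    case (base p)
    then show ?case using R rel by (cases p) auto
  qed (auto simp: inv dual quandle.qop_closed quandle.dual_closed quandle_free_quandle)
  from this[OF uv] show ?thesis by simp
qed

section \<open>Potentials on the free quandle\<close>

text \<open>All representatives of an element of the free quandle have the same first component: it names
  the generator in whose orbit the element lies.\<close>

definition fq_base :: "'s fq \<Rightarrow> 's" where
  "fq_base u = fst (SOME z. z \<in> u)"

lemma fq_base_class:
  assumes "a \<in> S" "w \<in> carrier (free_group S)"
  shows "fq_base (fq_class S a w) = a"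
proof -
  have "(a, w) \<in> fq_class S a w"
    using assms equiv_class_self[OF equiv_fq_rel, of _ S] by (auto simp: fq_class_def)
  then have "(SOME z. z \<in> fq_class S a w) \<in> fq_class S a w" by (rule someI)
  then show ?thesis by (auto simp: fq_base_def fq_class_def fq_rel_def)
qed

lemma fq_base_in: "u \<in> carrier (free_quandle S) \<Longrightarrow> fq_base u \<in> S"
  by (auto elim!: fq_carrierE simp: fq_base_class)

lemma fq_base_gen: "s \<in> S \<Longrightarrow> fq_base (fq_gen S s) = s"
  by (simp add: fq_gen_class fq_base_class group.is_monoid[OF group_free_group] monoid.one_closed)

lemma fq_base_op:
  assumes "u \<in> carrier (free_quandle S)" "v \<in> carrier (free_quandle S)"
  shows "fq_base (u \<rhd>\<^bsub>free_quandle S\<^esub> v) = fq_base u"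
proof -
  interpret group "free_group S" by (rule group_free_group)
  show ?thesis
    using assms by (auto elim!: fq_carrierE simp: fq_class_op fq_base_class letter_in_free_group)
qed

lemma fq_base_dual:
  assumes "u \<in> carrier (free_quandle S)" "v \<in> carrier (free_quandle S)"
  shows "fq_base (u \<rhd>\<inverse>\<^bsub>free_quandle S\<^esub> v) = fq_base u"
  using assms fq_base_op[of "u \<rhd>\<inverse>\<^bsub>free_quandle S\<^esub> v" S v]
  by (simp add: quandle.dual_closed quandle.op_dual quandle_free_quandle)

text \<open>The extension of \<open>X\<close> by the abelian group of values of the cocycle; the cocycle condition is
  self-distributivity, and \<open>\<theta> x x = 0\<close> is idempotency.\<close>

definition cocycle_extension ::
    "('x, 'm) quandle_scheme \<Rightarrow> ('x \<Rightarrow> 'x \<Rightarrow> 'a::ab_group_add) \<Rightarrow> ('x \<times> 'a) quandle" where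
  "cocycle_extension X \<theta> = \<lparr>carrier = carrier X \<times> UNIV,
     qop = (\<lambda>(x, a) (y, b). (x \<rhd>\<^bsub>X\<^esub> y, a + \<theta> x y))\<rparr>"

lemma quandle_cocycle_extension:
  assumes "quandle X" and \<theta>: "quandle_2_cocycle X \<theta>"
  shows "quandle (cocycle_extension X \<theta>)"
proof -
  interpret quandle X by fact
  show ?thesis
  proof
    fix y assume "y \<in> carrier (cocycle_extension X \<theta>)"
    then obtain x b where y: "y = (x, b)" and x: "x \<in> carrier X"
      by (auto simp: cocycle_extension_def)
    have "bij_betw (\<lambda>(z, a). (z \<rhd>\<^bsub>X\<^esub> x, a + \<theta> z x)) (carrier X \<times> UNIV) (carrier X \<times> UNIV)"
    proof (rule bij_betw_byWitness[where f' = "\<lambda>(z, a). (z \<rhd>\<inverse>\<^bsub>X\<^esub> x, a - \<theta> (z \<rhd>\<inverse>\<^bsub>X\<^esub> x) x)"])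
    qed (use x in \<open>auto simp: op_dual dual_op dual_closed qop_closed\<close>)
    then show "bij_betw (\<lambda>x. x \<rhd>\<^bsub>cocycle_extension X \<theta>\<^esub> y) (carrier (cocycle_extension X \<theta>))
        (carrier (cocycle_extension X \<theta>))"
      by (simp add: cocycle_extension_def y case_prod_unfold)
  next
    fix x y z assume "x \<in> carrier (cocycle_extension X \<theta>)" "y \<in> carrier (cocycle_extension X \<theta>)"
      "z \<in> carrier (cocycle_extension X \<theta>)"
    then show "x \<rhd>\<^bsub>cocycle_extension X \<theta>\<^esub> y \<rhd>\<^bsub>cocycle_extension X \<theta>\<^esub> z =
        x \<rhd>\<^bsub>cocycle_extension X \<theta>\<^esub> z \<rhd>\<^bsub>cocycle_extension X \<theta>\<^esub> (y \<rhd>\<^bsub>cocycle_extension X \<theta>\<^esub> z)"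
      using \<theta> by (auto simp: cocycle_extension_def quandle_2_cocycle_def qop_distrib algebra_simps)
  qed (use \<theta> in \<open>auto simp: cocycle_extension_def quandle_2_cocycle_def qop_closed qop_idem\<close>)
qed

text \<open>The second component of the lift of \<open>p\<close> to the extension: it adds up the values of the
  cocycle met on the way from a generator to an element of its orbit.\<close>

definition cocycle_potential ::
    "'s set \<Rightarrow> ('s fq \<Rightarrow> 'x) \<Rightarrow> ('x \<Rightarrow> 'x \<Rightarrow> 'a::ab_group_add) \<Rightarrow> ('s fq \<Rightarrow> 'a) \<Rightarrow> bool" where
  "cocycle_potential S p \<theta> W \<longleftrightarrow> (\<forall>s\<in>S. W (fq_gen S s) = 0) \<and>
     (\<forall>u\<in>carrier (free_quandle S). \<forall>v\<in>carrier (free_quandle S).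
        W (u \<rhd>\<^bsub>free_quandle S\<^esub> v) = W u + \<theta> (p u) (p v))"

text \<open>Lift \<open>p\<close> to the extension by the universal property; the first component of the lift is \<open>p\<close>
  again because the two homomorphisms agree on generators.\<close>

lemma cocycle_potential_exists:
  assumes X: "quandle X" and \<theta>: "quandle_2_cocycle X \<theta>"
    and p: "p \<in> quandle_hom (free_quandle S) X"
  obtains W where "cocycle_potential S p \<theta> W"
proof -
  let ?E = "cocycle_extension X \<theta>"
  have "(\<lambda>s. (p (fq_gen S s), 0)) \<in> S \<rightarrow> carrier ?E"
    using p by (auto simp: cocycle_extension_def quandle_hom_closed fq_gen_closed)
  then obtain h where h: "h \<in> quandle_hom (free_quandle S) ?E"
    and h_gen: "\<And>s. s \<in> S \<Longrightarrow> h (fq_gen S s) = (p (fq_gen S s), 0)"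
    using free_quandle_universal[OF quandle_cocycle_extension[OF X \<theta>]] by metis
  have "fst \<in> quandle_hom ?E X"
    by (auto simp: quandle_hom_def cocycle_extension_def)
  then have fst_h: "fst (h u) = p u" if "u \<in> carrier (free_quandle S)" for u
    by (rule free_quandle_hom_unique[OF X quandle_hom_compose[OF h] p _ that]) (simp add: h_gen)
  have "snd (h (u \<rhd>\<^bsub>free_quandle S\<^esub> v)) = snd (h u) + \<theta> (p u) (p v)"
    if "u \<in> carrier (free_quandle S)" "v \<in> carrier (free_quandle S)" for u v
    using that quandle_hom_op[OF h, of u v]
    by (simp add: cocycle_extension_def case_prod_unfold fst_h)
  then have "cocycle_potential S p \<theta> (\<lambda>u. snd (h u))"
    by (simp add: cocycle_potential_def h_gen)
  then show ?thesis by (rule that)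
qed

lemma potential_dual:
  assumes "cocycle_potential S p \<theta> W" "u \<in> carrier (free_quandle S)" "v \<in> carrier (free_quandle S)"
  shows "W (u \<rhd>\<inverse>\<^bsub>free_quandle S\<^esub> v) = W u - \<theta> (p (u \<rhd>\<inverse>\<^bsub>free_quandle S\<^esub> v)) (p v)"
proof -
  let ?w = "u \<rhd>\<inverse>\<^bsub>free_quandle S\<^esub> v"
  have "?w \<in> carrier (free_quandle S)" "?w \<rhd>\<^bsub>free_quandle S\<^esub> v = u"
    using assms by (simp_all add: quandle.dual_closed quandle.op_dual quandle_free_quandle)
  then have "W u = W ?w + \<theta> (p ?w) (p v)"
    using assms unfolding cocycle_potential_def by metis
  then show ?thesis by simp
qed

section \<open>The twisted derivative\<close>

lemma group_ring_of_add: "group_ring_of (a + b) = group_ring_of a * group_ring_of b"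
  by (simp add: group_ring_of_def mult_single)

lemma group_ring_of_0 [simp]: "group_ring_of 0 = 1"
  by (simp add: group_ring_of_def)

lemma group_ring_of_minus [simp]:
  "group_ring_of (- a) * group_ring_of a = 1" "group_ring_of a * group_ring_of (- a) = 1"
  by (simp_all flip: group_ring_of_add)

lemma ring_inv_group_ring_of: "ring_inv (group_ring_of a) = group_ring_of (- a)"
  unfolding ring_inv_def is_inverse_def
proof (rule the_equality)
  fix v assume v: "group_ring_of a * v = 1 \<and> v * group_ring_of a = 1"
  then have "v = v * (group_ring_of a * group_ring_of (- a))" by simp
  also have "\<dots> = (v * group_ring_of a) * group_ring_of (- a)" by (simp only: mult.assoc)
  also have "\<dots> = group_ring_of (- a)" using v by simp
  finally show "v = group_ring_of (- a)" .
qed simp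

text \<open>With \<open>f\<^sub>2 = 0\<close> a derivative only ever sees the first argument of the operation, so it is
  nonzero on a single orbit of the free quandle and is multiplied there by the unit
  \<open>\<theta> (p x) (p y)\<close> at each step. Thus a relator contributes two group elements with opposite signs
  to its row, each in the column of the generator in whose orbit that side of the relator lies.\<close>

lemma derivative_potential:
  fixes \<theta> :: "'x \<Rightarrow> 'x \<Rightarrow> 'a::ab_group_add"
  assumes W: "cocycle_potential S p \<theta> W" and u: "u \<in> carrier (free_quandle S)"
  shows "derivative S p (\<lambda>x y. group_ring_of (\<theta> x y)) (\<lambda>x y. 0) s u =
    (if fq_base u = s then group_ring_of (W u) else 0)"
proof -
  let ?Q = "free_quandle S"
  let ?\<delta> = "\<lambda>u\<in>carrier ?Q. if fq_base u = s then group_ring_of (W u) else 0"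
  have "derivative S p (\<lambda>x y. group_ring_of (\<theta> x y)) (\<lambda>x y. 0) s = ?\<delta>"
    unfolding derivative_def
  proof (rule the_equality)
    have W_op: "W (x \<rhd>\<^bsub>?Q\<^esub> y) = W x + \<theta> (p x) (p y)" if "x \<in> carrier ?Q" "y \<in> carrier ?Q" for x y
      using W that by (simp add: cocycle_potential_def)
    show "is_derivative S p (\<lambda>x y. group_ring_of (\<theta> x y)) (\<lambda>x y. 0) s ?\<delta>"
      unfolding is_derivative_def Let_def ring_inv_group_ring_of
    proof (intro conjI ballI)
      fix x y assume xy: "x \<in> carrier ?Q" "y \<in> carrier ?Q"
      then show "?\<delta> (x \<rhd>\<^bsub>?Q\<^esub> y) = group_ring_of (\<theta> (p x) (p y)) * ?\<delta> x + 0 * ?\<delta> y"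
        by (simp add: quandle.qop_closed quandle_free_quandle fq_base_op W_op
            group_ring_of_add mult.commute)
      show "?\<delta> (x \<rhd>\<inverse>\<^bsub>?Q\<^esub> y) = group_ring_of (- \<theta> (p (x \<rhd>\<inverse>\<^bsub>?Q\<^esub> y)) (p y)) * ?\<delta> x -
          group_ring_of (- \<theta> (p (x \<rhd>\<inverse>\<^bsub>?Q\<^esub> y)) (p y)) * 0 * ?\<delta> y"
        using xy potential_dual[OF W xy]
        by (simp add: quandle.dual_closed quandle_free_quandle fq_base_dual
            mult.commute flip: group_ring_of_add)
    next
      fix t assume "t \<in> S"
      then show "?\<delta> (fq_gen S t) = (if t = s then 1 else 0)"
        using W by (auto simp: fq_gen_closed fq_base_gen cocycle_potential_def)
    qed simp
    then have \<delta>_dual: "is_derivative S p (\<lambda>x y. group_ring_of (\<theta> x y)) (\<lambda>x y. 0) s ?\<delta>" .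
    have rules: "\<delta> (x \<rhd>\<^bsub>?Q\<^esub> fq_gen S t) = group_ring_of (\<theta> (p x) (p (fq_gen S t))) * \<delta> x"
        "\<delta> (x \<rhd>\<inverse>\<^bsub>?Q\<^esub> fq_gen S t) =
          group_ring_of (- \<theta> (p (x \<rhd>\<inverse>\<^bsub>?Q\<^esub> fq_gen S t)) (p (fq_gen S t))) * \<delta> x"
      if "is_derivative S p (\<lambda>x y. group_ring_of (\<theta> x y)) (\<lambda>x y. 0) s \<delta>" "x \<in> carrier ?Q" "t \<in> S"
      for \<delta> x t
      using that fq_gen_closed[of t S] unfolding is_derivative_def Let_def ring_inv_group_ring_of
      by simp_all
    fix \<delta> assume \<delta>: "is_derivative S p (\<lambda>x y. group_ring_of (\<theta> x y)) (\<lambda>x y. 0) s \<delta>"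
    show "\<delta> = ?\<delta>"
    proof (rule extensionalityI)
      fix v assume "v \<in> carrier ?Q"
      then show "\<delta> v = ?\<delta> v"
      proof (induction rule: free_quandle_induct)
        case (gen t)
        then show ?case using \<delta> \<delta>_dual by (simp only: is_derivative_def)
      next
        case (op x t)
        then show ?case by (simp only: rules(1)[OF \<delta>] rules(1)[OF \<delta>_dual])
      next
        case (dual x t)
        then show ?case by (simp only: rules(2)[OF \<delta>] rules(2)[OF \<delta>_dual])
      qed
    qed (use \<delta> in \<open>auto simp: is_derivative_def\<close>)
  qed
  then show ?thesis using u by simp
qed

section \<open>Maximal minors and the row space\<close>

lemma module_mult: "Modules.module ((*) :: 'r::comm_ring_1 \<Rightarrow> 'r \<Rightarrow> 'r)"
  by unfold_locales (simp_all add: algebra_simps)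

lemma generated_ideal_principal: "generated_ideal {p} = range (\<lambda>r. r * p)"
  by (simp add: generated_ideal_def Modules.module.span_singleton[OF module_mult])

lemma generated_ideal_le_principal:
  assumes "\<And>g. g \<in> G \<Longrightarrow> p dvd g"
  shows "generated_ideal G \<subseteq> generated_ideal {p}"
proof -
  have "G \<subseteq> generated_ideal {p}"
    using assms by (auto simp: generated_ideal_principal dvd_def mult.commute)
  then show ?thesis
    unfolding generated_ideal_def
    by (rule Modules.module.span_minimal[OF module_mult _ Modules.module.subspace_span[OF module_mult]])
qed

lemma principal_le_generated_ideal:
  assumes "p \<in> generated_ideal G"
  shows "generated_ideal {p} \<subseteq> generated_ideal G"
  using assms unfolding generated_ideal_def
  by (intro Modules.module.span_minimal[OF module_mult _ Modules.module.subspace_span[OF module_mult]]) simp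

lemma elementary_ideal_0:
  assumes "dim_col M > 0"
  shows "elementary_ideal 0 M = generated_ideal (minors M (dim_col M))"
proof -
  have "minors M (dim_col M) = {}" if "dim_row M < dim_col M"
  proof -
    have "card I \<noteq> dim_col M" if "I \<subseteq> {..<dim_row M}" for I
      using card_mono[OF _ that] \<open>dim_row M < dim_col M\<close> by simp
    then show ?thesis by (auto simp: minors_def)
  qed
  then show ?thesis
    using assms Modules.module.span_empty[OF module_mult, where 'a='a]
    by (auto simp: elementary_ideal_def generated_ideal_def)
qed

lemma maximal_submatrix:
  assumes M: "M \<in> carrier_mat m n" and I: "I \<subseteq> {..<m}" "card I = n"
  shows "submatrix M I {..<n} \<in> carrier_mat n n"
    and "\<And>i j. \<lbrakk>i < n; j < n\<rbrakk> \<Longrightarrow> submatrix M I {..<n} $$ (i, j) = M $$ (pick I i, j)"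
proof -
  have rows: "{i. i < dim_row M \<and> i \<in> I} = I" and cols: "{j. j < dim_col M \<and> j \<in> {..<n}} = {..<n}"
    using I M by auto
  show "submatrix M I {..<n} \<in> carrier_mat n n"
    unfolding carrier_mat_def dim_submatrix mem_Collect_eq rows cols by (simp add: I)
  fix i j assume ij: "i < n" "j < n"
  have "{a \<in> {..<n}. a < j} = {..<j}" using ij by auto
  then have "pick {..<n} j = j" using pick_card_in_set[of j "{..<n}"] ij by simp
  then show "submatrix M I {..<n} $$ (i, j) = M $$ (pick I i, j)"
    using ij I submatrix_index[of i M I j "{..<n}"] unfolding rows cols by simp
qed

lemma det_rows_in_minors_ideal:
  fixes M :: "'r::comm_ring_1 mat"
  assumes M: "M \<in> carrier_mat m n" and f: "f \<in> {0..<n} \<rightarrow> {0..<m}"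
  shows "det (mat n n (\<lambda>(i, j). M $$ (f i, j))) \<in> generated_ideal (minors M n)"
proof (cases "inj_on f {0..<n}")
  case False
  then obtain a b where ab: "a < n" "b < n" "a \<noteq> b" "f a = f b" by (auto simp: inj_on_def)
  have "det (mat n n (\<lambda>(i, j). M $$ (f i, j))) = 0"
    by (rule det_identical_rows[OF _ ab(3,1,2)]) (use ab in \<open>auto intro!: eq_vecI\<close>)
  then show ?thesis
    by (simp add: generated_ideal_def Modules.module.span_zero[OF module_mult])
next
  case inj: True
  define I where "I = f ` {0..<n}"
  have I: "I \<subseteq> {..<m}" "card I = n" "finite I"
    using f by (auto simp: I_def card_image[OF inj])
  let ?N = "submatrix M I {..<n}"
  have N: "?N \<in> carrier_mat n n"
    and N_index: "\<And>i j. \<lbrakk>i < n; j < n\<rbrakk> \<Longrightarrow> ?N $$ (i, j) = M $$ (pick I i, j)"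
    by (rule maximal_submatrix[OF M I(1,2)], rule maximal_submatrix[OF M I(1,2)])
  \<comment> \<open>The rank function of \<open>I\<close> turns the selection \<open>f\<close> of rows into a permutation of the
    increasing selection.\<close>
  define p where "p i = (if i < n then card {a \<in> I. a < f i} else i)" for i
  have p_lt: "p i < n" if "i < n" for i
  proof -
    have "{a \<in> I. a < f i} \<subset> I" using that by (auto simp: I_def)
    then show ?thesis using that I psubset_card_mono[of I] by (auto simp: p_def)
  qed
  have pick_p: "pick I (p i) = f i" if "i < n" for i
    using that by (simp add: p_def I_def pick_card_in_set)
  have "inj_on p {0..<n}"
    using inj pick_p by (intro inj_onI) (metis atLeastLessThan_iff inj_onD)
  moreover have "p ` {0..<n} \<subseteq> {0..<n}" using p_lt by auto
  ultimately have "bij_betw p {0..<n} {0..<n}"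
    using endo_inj_surj[of "{0..<n}" p] by (simp add: bij_betw_def)
  then have "p permutes {0..<n}"
    by (rule bij_imp_permutes) (simp add: p_def)
  then have "det (mat n n (\<lambda>(i, j). ?N $$ (p i, j))) = signof p * det ?N"
    by (rule det_permute_rows[OF N])
  moreover have "mat n n (\<lambda>(i, j). ?N $$ (p i, j)) = mat n n (\<lambda>(i, j). M $$ (f i, j))"
    by (rule eq_matI) (auto simp: N_index p_lt pick_p)
  moreover have "det ?N \<in> minors M n"
    unfolding minors_def using I M by (intro CollectI exI[of _ I] exI[of _ "{..<n}"]) auto
  ultimately show ?thesis
    using Modules.module.span_scale[OF module_mult Modules.module.span_base[OF module_mult]]
    unfolding generated_ideal_def by metis
qed

text \<open>The part of the Cauchy-Binet formula that is needed here: the determinant is multilinear in the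
  rows, and a determinant made of chosen rows of \<open>M\<close> vanishes when a row repeats and is a maximal
  minor up to sign otherwise.\<close>

lemma det_mult_in_minors_ideal:
  fixes M :: "'r::comm_ring_1 mat"
  assumes C: "C \<in> carrier_mat n m" and M: "M \<in> carrier_mat m n"
  shows "det (C * M) \<in> generated_ideal (minors M n)"
proof -
  have "det (C * M) = (\<Sum>f | (\<forall>i\<in>{0..<n}. f i \<in> {0..<m}) \<and> (\<forall>i. i \<notin> {0..<n} \<longrightarrow> f i = i).
      det (mat\<^sub>r n n (\<lambda>i. C $$ (i, f i) \<cdot>\<^sub>v row M (f i))))"
    unfolding mat_mul_finsum_alt[OF C M] by (rule det_linear_rows_sum) (use M in auto)
  also have "\<dots> = (\<Sum>f | (\<forall>i\<in>{0..<n}. f i \<in> {0..<m}) \<and> (\<forall>i. i \<notin> {0..<n} \<longrightarrow> f i = i).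
      (\<Prod>i = 0..<n. C $$ (i, f i)) * det (mat n n (\<lambda>(i, j). M $$ (f i, j))))"
  proof (rule sum.cong[OF HOL.refl])
    fix f assume f: "f \<in> {f. (\<forall>i\<in>{0..<n}. f i \<in> {0..<m}) \<and> (\<forall>i. i \<notin> {0..<n} \<longrightarrow> f i = i)}"
    have "det (mat\<^sub>r n n (\<lambda>i. C $$ (i, f i) \<cdot>\<^sub>v row M (f i))) =
        (\<Prod>i = 0..<n. C $$ (i, f i)) * det (mat\<^sub>r n n (\<lambda>i. row M (f i)))"
      by (rule det_rows_mul) (use M in auto)
    also have "mat\<^sub>r n n (\<lambda>i. row M (f i)) = mat n n (\<lambda>(i, j). M $$ (f i, j))"
      using f M by (intro eq_matI) auto
    finally show "det (mat\<^sub>r n n (\<lambda>i. C $$ (i, f i) \<cdot>\<^sub>v row M (f i))) =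
        (\<Prod>i = 0..<n. C $$ (i, f i)) * det (mat n n (\<lambda>(i, j). M $$ (f i, j)))" .
  qed
  also have "\<dots> \<in> generated_ideal (minors M n)"
    unfolding generated_ideal_def
    using det_rows_in_minors_ideal[OF M]
    by (intro Modules.module.span_sum[OF module_mult] Modules.module.span_scale[OF module_mult])
      (auto simp: generated_ideal_def)
  finally show ?thesis .
qed

text \<open>Row vectors are functions on all natural numbers, constrained at the indices of columns only,
  so that matrices with any number of columns share one type of vectors.\<close>

definition row_space :: "'r::comm_ring_1 mat \<Rightarrow> (nat \<Rightarrow> 'r) set" where
  "row_space M = {x. \<exists>c. \<forall>j<dim_col M. x j = (\<Sum>i<dim_row M. c i * M $$ (i, j))}"

lemma row_in_row_space:
  assumes "i < dim_row M" "\<And>j. j < dim_col M \<Longrightarrow> x j = M $$ (i, j)"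
  shows "x \<in> row_space M"
proof -
  have "(\<Sum>k<dim_row M. (if k = i then 1 else 0) * M $$ (k, j)) = M $$ (i, j)" for j
    using assms(1) by (simp add: if_distrib[of "\<lambda>c. c * _"] cong: if_cong)
  then show ?thesis
    using assms unfolding row_space_def by (intro CollectI exI[of _ "\<lambda>k. if k = i then 1 else 0"]) simp
qed

text \<open>This makes the ideal of maximal minors depend on the row space alone.\<close>

lemma det_in_minors_ideal:
  assumes M: "M \<in> carrier_mat m n" and B: "B \<in> carrier_mat n n"
    and rows: "\<And>i. i < n \<Longrightarrow> (\<lambda>j. B $$ (i, j)) \<in> row_space M"
  shows "det B \<in> generated_ideal (minors M n)"
proof -
  have "\<forall>i<n. \<exists>c. \<forall>j<n. B $$ (i, j) = (\<Sum>k<m. c k * M $$ (k, j))"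
    using rows M by (auto simp: row_space_def)
  then obtain c where c: "\<And>i j. i < n \<Longrightarrow> j < n \<Longrightarrow> B $$ (i, j) = (\<Sum>k<m. c i k * M $$ (k, j))"
    by metis
  let ?C = "mat n m (\<lambda>(i, k). c i k)"
  have "?C * M = B"
    using M B by (intro eq_matI) (auto simp: c scalar_prod_def lessThan_atLeast0)
  then show ?thesis using det_mult_in_minors_ideal[OF _ M, of ?C] by simp
qed

text \<open>If the row space is cut out by one divisibility condition per class of columns, then the
  invertible column operation \<open>T\<close>, which replaces one column per class by the weighted sum of its
  class, turns it into the row space of a diagonal matrix with entries \<open>1\<close> and \<open>c k\<close>. After
  this operation every maximal minor is divisible by the product of the \<open>c k\<close>, and the diagonal
  matrix attains it.\<close>

lemma minors_ideal_of_monomial_row_space: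
  fixes M :: "'r::comm_ring_1 mat" and c :: "'k \<Rightarrow> 'r"
  assumes M: "M \<in> carrier_mat m n"
    and \<kappa>: "\<kappa> ` {..<n} = I"
    and t: "\<And>j. j < n \<Longrightarrow> t j * t' j = 1"
    and rows: "\<And>x. x \<in> row_space M \<longleftrightarrow> (\<forall>k\<in>I. c k dvd (\<Sum>j | j < n \<and> \<kappa> j = k. x j * t j))"
  shows "generated_ideal (minors M n) = generated_ideal {\<Prod>k\<in>I. c k}"
proof
  define r where "r k = (SOME j. j < n \<and> \<kappa> j = k)" for k
  have r: "r k < n" "\<kappa> (r k) = k" if "k \<in> I" for k
    using someI_ex[of "\<lambda>j. j < n \<and> \<kappa> j = k"] that \<kappa> unfolding r_def by auto
  have \<kappa>I: "\<kappa> j \<in> I" if "j < n" for j using \<kappa> that by auto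
  let ?root = "\<lambda>j. r (\<kappa> j) = j"
  \<comment> \<open>The column operations that collect the whole class of a column in its root.\<close>
  define T where "T = mat n n (\<lambda>(i, j). if ?root j then (if \<kappa> i = \<kappa> j then t i else 0)
    else if i = j then 1 else 0)"
  define T' where "T' = mat n n (\<lambda>(i, j). if ?root j then
      (if i = j then t' j else if \<kappa> i = \<kappa> j then - t i * t' j else 0)
    else if i = j then 1 else 0)"
  define d where "d j = (if ?root j then c (\<kappa> j) else 1)" for j
  have T: "T \<in> carrier_mat n n" and T': "T' \<in> carrier_mat n n" by (simp_all add: T_def T'_def)
  have mult_index: "(A * B) $$ (i, j) = (\<Sum>k<n. A $$ (i, k) * B $$ (k, j))"
    if "A \<in> carrier_mat n n" "B \<in> carrier_mat n n" "i < n" "j < n" for A B :: "'r mat" and i j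
    using that by (auto simp: scalar_prod_def lessThan_atLeast0)
  have "T * T' = 1\<^sub>m n"
  proof (rule eq_matI)
    fix i j assume "i < dim_row (1\<^sub>m n :: 'r mat)" "j < dim_col (1\<^sub>m n :: 'r mat)"
    then have ij: "i < n" "j < n" by auto
    show "(T * T') $$ (i, j) = 1\<^sub>m n $$ (i, j)"
    proof (cases "?root j")
      case False
      then have "(T * T') $$ (i, j) = (\<Sum>k<n. if k = j then T $$ (i, j) else 0)"
        unfolding mult_index[OF T T' ij] using ij by (intro sum.cong) (auto simp: T'_def)
      also have "\<dots> = 1\<^sub>m n $$ (i, j)" using ij False by (simp add: T_def)
      finally show ?thesis .
    next
      case root: True
      have eq: "T $$ (i, k) * T' $$ (k, j) =
          (if k = j then (if \<kappa> i = \<kappa> j then t i * t' j else 0) else 0) +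
          (if k = i then (if \<kappa> i = \<kappa> j \<and> i \<noteq> j then - (t i * t' j) else 0) else 0)"
        if k: "k < n" for k
      proof (cases "k = j")
        case True
        then show ?thesis using ij root by (simp add: T_def T'_def)
      next
        case False
        then have T'_kj: "T' $$ (k, j) = (if \<kappa> k = \<kappa> j then - t k * t' j else 0)"
          using k ij root by (simp add: T'_def)
        show ?thesis
        proof (cases "\<kappa> k = \<kappa> j")
          case True
          then have "r (\<kappa> k) \<noteq> k" using root False by simp
          then have "T $$ (i, k) = (if i = k then 1 else 0)" using k ij by (simp add: T_def)
          then show ?thesis using True False by (auto simp: T'_kj)
        qed (use False in \<open>auto simp: T'_kj\<close>)
      qed
      have "(T * T') $$ (i, j) = (if \<kappa> i = \<kappa> j then t i * t' j else 0) +
          (if \<kappa> i = \<kappa> j \<and> i \<noteq> j then - (t i * t' j) else 0)"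
      proof -
        have "(T * T') $$ (i, j) = (\<Sum>k<n.
            (if k = j then (if \<kappa> i = \<kappa> j then t i * t' j else 0) else 0) +
            (if k = i then (if \<kappa> i = \<kappa> j \<and> i \<noteq> j then - (t i * t' j) else 0) else 0))"
          unfolding mult_index[OF T T' ij] by (rule sum.cong[OF HOL.refl]) (simp add: eq)
        then show ?thesis using ij by (simp add: sum.distrib)
      qed
      also have "\<dots> = 1\<^sub>m n $$ (i, j)" using ij t by auto
      finally show ?thesis .
    qed
  qed (auto simp: T_def T'_def)
  then have det_T: "det T * det T' = 1"
    using det_mult[OF T T'] by simp
  have prod_d: "(\<Prod>j = 0..<n. d j) = (\<Prod>k\<in>I. c k)"
  proof -
    have "(\<Prod>j = 0..<n. d j) = (\<Prod>j | j \<in> {0..<n} \<and> ?root j. c (\<kappa> j))"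
      unfolding d_def by (rule prod.inter_filter[symmetric]) simp
    also have "\<dots> = (\<Prod>k\<in>I. c k)"
    proof (rule prod.reindex_bij_witness[of _ r \<kappa>])
      fix k assume "k \<in> I"
      from r[OF this] show "\<kappa> (r k) = k" "r k \<in> {j. j \<in> {0..<n} \<and> r (\<kappa> j) = j}"
        by simp_all
    qed (use \<kappa>I in simp_all)
    finally show ?thesis .
  qed
  show "generated_ideal (minors M n) \<subseteq> generated_ideal {\<Prod>k\<in>I. c k}"
  proof (rule generated_ideal_le_principal)
    fix \<mu> assume "\<mu> \<in> minors M n"
    then obtain J L where J: "J \<subseteq> {..<m}" "card J = n" and L: "L \<subseteq> {..<n}" "card L = n"
      and \<mu>: "\<mu> = det (submatrix M J L)"
      using M by (auto simp: minors_def)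
    have L_eq: "L = {..<n}" using L by (intro card_subset_eq) auto
    let ?B = "submatrix M J L"
    have B: "?B \<in> carrier_mat n n"
      and B_index: "\<And>i j. \<lbrakk>i < n; j < n\<rbrakk> \<Longrightarrow> ?B $$ (i, j) = M $$ (pick J i, j)"
      unfolding L_eq by (rule maximal_submatrix[OF M J], rule maximal_submatrix[OF M J])
    have B_rows: "(\<lambda>j. ?B $$ (i, j)) \<in> row_space M" if "i < n" for i
    proof (rule row_in_row_space)
      show "pick J i < dim_row M" using pick_in_set_le[of i J] that J M by auto
      show "?B $$ (i, j) = M $$ (pick J i, j)" if "j < dim_col M" for j
        using that \<open>i < n\<close> M by (simp add: B_index)
    qed
    have "\<forall>i<n. \<forall>j<n. \<exists>q. (?B * T) $$ (i, j) = q * d j"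
    proof (intro allI impI)
      fix i j assume ij: "i < n" "j < n"
      show "\<exists>q. (?B * T) $$ (i, j) = q * d j"
      proof (cases "?root j")
        case True
        have "(?B * T) $$ (i, j) = (\<Sum>k<n. if \<kappa> k = \<kappa> j then ?B $$ (i, k) * t k else 0)"
          unfolding mult_index[OF B T ij] using ij True
          by (intro sum.cong) (auto simp: T_def)
        also have "\<dots> = (\<Sum>k | k < n \<and> \<kappa> k = \<kappa> j. ?B $$ (i, k) * t k)"
          by (simp add: sum.inter_filter[symmetric])
        finally have "c (\<kappa> j) dvd (?B * T) $$ (i, j)"
          using rows[of "\<lambda>j. ?B $$ (i, j)"] B_rows[OF ij(1)] \<kappa>I[OF ij(2)] by auto
        then show ?thesis using True by (auto simp: d_def dvd_def mult.commute)
      qed (auto simp: d_def)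
    qed
    then obtain q where q: "\<And>i j. i < n \<Longrightarrow> j < n \<Longrightarrow> (?B * T) $$ (i, j) = q i j * d j"
      by metis
    let ?Q = "mat n n (\<lambda>(i, j). q j i)"
    have "transpose_mat (?B * T) = mat\<^sub>r n n (\<lambda>i. d i \<cdot>\<^sub>v row ?Q i)"
      using B T by (intro eq_matI) (auto simp: q mult.commute simp del: index_mult_mat(1))
    then have "det (?B * T) = (\<Prod>j = 0..<n. d j) * det (mat\<^sub>r n n (row ?Q))"
      using det_transpose[OF mult_carrier_mat[OF B T]] det_rows_mul[of "row ?Q" n d] by simp
    then have "(\<Prod>k\<in>I. c k) dvd det (?B * T) * det T'"
      by (simp add: prod_d)
    also have "det (?B * T) * det T' = \<mu>"
      using det_T by (simp add: det_mult[OF B T] \<mu> mult.assoc)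
    finally show "(\<Prod>k\<in>I. c k) dvd \<mu>" .
  qed
  show "generated_ideal {\<Prod>k\<in>I. c k} \<subseteq> generated_ideal (minors M n)"
  proof (rule principal_le_generated_ideal)
    let ?B = "mat\<^sub>r n n (\<lambda>i. d i \<cdot>\<^sub>v row T' i)"
    have B_index: "?B $$ (i, j) = d i * T' $$ (i, j)" if "i < n" "j < n" for i j
      using that T' by (simp)
    have "det ?B \<in> generated_ideal (minors M n)"
    proof (rule det_in_minors_ideal[OF M])
      fix i assume i: "i < n"
      show "(\<lambda>j. ?B $$ (i, j)) \<in> row_space M"
        unfolding rows
      proof
        fix k assume k: "k \<in> I"
        have rk: "r k < n" "\<kappa> (r k) = k" using r[OF k] by auto
        have "(\<Sum>j | j < n \<and> \<kappa> j = k. ?B $$ (i, j) * t j) = (\<Sum>j | j < n \<and> \<kappa> j = k.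
            (if j = r k then d i * (if i = j then t' j else if \<kappa> i = k then - t i * t' j else 0) * t j else 0) +
            (if j = i then (if i = r k then 0 else d i * t i) else 0))"
        proof (rule sum.cong[OF HOL.refl])
          fix j assume "j \<in> {j. j < n \<and> \<kappa> j = k}"
          then have j: "j < n" "\<kappa> j = k" by auto
          show "?B $$ (i, j) * t j =
            (if j = r k then d i * (if i = j then t' j else if \<kappa> i = k then - t i * t' j else 0) * t j else 0) +
            (if j = i then (if i = r k then 0 else d i * t i) else 0)"
            using j i by (auto simp: B_index T'_def)
        qed
        also have "\<dots> = d i * (if i = r k then t' (r k) else if \<kappa> i = k then - t i * t' (r k) else 0) * t (r k) +
            (if \<kappa> i = k \<and> i \<noteq> r k then d i * t i else 0)"
        proof -
          have fin: "finite {j. j < n \<and> \<kappa> j = k}" and mem: "r k \<in> {j. j < n \<and> \<kappa> j = k}"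
            "i \<in> {j. j < n \<and> \<kappa> j = k} \<longleftrightarrow> \<kappa> i = k"
            using rk i by auto
          have nested: "(if P then (if Q then 0 else x) else 0) = (if P \<and> \<not> Q then x else 0)"
            for P Q and x :: 'r by auto
          show ?thesis
            unfolding sum.distrib sum.delta[OF fin] mem(2) unfolding nested by (simp only: mem(1) if_True)
        qed
        also have "\<dots> = (if i = r k then c k else 0)"
        proof (cases "i = r k")
          case True
          have "d (r k) = c k" by (simp add: d_def rk)
          moreover have "c k * t' (r k) * t (r k) = c k"
            using t[OF rk(1)] by (simp add: mult.assoc mult.commute[of "t' (r k)"])
          ultimately show ?thesis by (simp add: True)
        next
          case False
          have "- t i * t' (r k) * t (r k) = - t i"
            using t[OF rk(1)] by (simp add: mult.assoc mult.commute[of "t' (r k)"])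
          then show ?thesis using False by (simp add: mult.assoc)
        qed
        finally show "c k dvd (\<Sum>j | j < n \<and> \<kappa> j = k. ?B $$ (i, j) * t j)" by simp
      qed
    qed auto
    moreover have "det ?B = (\<Prod>k\<in>I. c k) * det T'"
    proof -
      have "mat\<^sub>r n n (row T') = T'" using T' by (intro eq_matI) auto
      then show ?thesis using det_rows_mul[of "row T'" n d] T' by (simp add: prod_d)
    qed
    ultimately have "det T * ((\<Prod>k\<in>I. c k) * det T') \<in> generated_ideal (minors M n)"
      by (simp add: generated_ideal_def Modules.module.span_scale[OF module_mult])
    also have "det T * ((\<Prod>k\<in>I. c k) * det T') = (\<Prod>k\<in>I. c k)"
      using det_T by (metis mult.left_commute mult.right_neutral)
    finally show "(\<Prod>k\<in>I. c k) \<in> generated_ideal (minors M n)" .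
  qed
qed

section \<open>Derivations modulo a submodule\<close>

definition fscale :: "'r::comm_ring_1 \<Rightarrow> ('i \<Rightarrow> 'r) \<Rightarrow> 'i \<Rightarrow> 'r" where
  "fscale r f = (\<lambda>i. r * f i)"

lemma fscale_apply [simp]: "fscale r f i = r * f i"
  by (simp add: fscale_def)

interpretation fmod: Modules.module "fscale :: 'r::comm_ring_1 \<Rightarrow> ('i \<Rightarrow> 'r) \<Rightarrow> _"
  by unfold_locales (simp_all add: fun_eq_iff algebra_simps)

lemma subspace_trans:
  assumes "fmod.subspace N" "a - b \<in> N" "b - c \<in> N"
  shows "a - c \<in> N"
  using fmod.subspace_add[OF assms] by simp

lemma subspace_sym:
  assumes "fmod.subspace N" "a - b \<in> N"
  shows "b - a \<in> N"
  using fmod.subspace_neg[OF assms] by simp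

lemma subspace_scale_diff:
  assumes "fmod.subspace N" "a - b \<in> N"
  shows "fscale r a - fscale r b \<in> N"
  using fmod.subspace_scale[OF assms, of r] by (simp only: fmod.scale_right_diff_distrib)

lemma subspace_unscale:
  assumes "fmod.subspace N" "a - fscale (group_ring_of x) b \<in> N"
  shows "b - fscale (group_ring_of (- x)) a \<in> N"
proof -
  have "fscale (group_ring_of (- x)) a - b \<in> N"
    using subspace_scale_diff[OF assms, of "group_ring_of (- x)"] by simp
  then show ?thesis by (rule subspace_sym[OF assms(1)])
qed

text \<open>A submodule \<open>N\<close> stands for the quotient by it: a derivation modulo \<open>N\<close> is a map to the
  quotient module that is multiplied by the group element \<open>\<theta> x y\<close> when \<open>y\<close> acts on \<open>x\<close>,
  given by representatives.\<close>

definition derivation_mod ::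
    "('q, 'm) quandle_scheme \<Rightarrow> ('q \<Rightarrow> 'q \<Rightarrow> 'a::ab_group_add) \<Rightarrow> ('i \<Rightarrow> 'a \<Rightarrow>\<^sub>0 int) set
      \<Rightarrow> ('q \<Rightarrow> 'i \<Rightarrow> 'a \<Rightarrow>\<^sub>0 int) \<Rightarrow> bool" where
  "derivation_mod Q \<theta> N d \<longleftrightarrow> (\<forall>x\<in>carrier Q. \<forall>y\<in>carrier Q.
     d (x \<rhd>\<^bsub>Q\<^esub> y) - fscale (group_ring_of (\<theta> x y)) (d x) \<in> N)"

lemma derivation_dual:
  assumes Q: "quandle Q" and N: "fmod.subspace N" and d: "derivation_mod Q \<theta> N d"
    and xy: "x \<in> carrier Q" "y \<in> carrier Q"
  shows "d (x \<rhd>\<inverse>\<^bsub>Q\<^esub> y) - fscale (group_ring_of (- \<theta> (x \<rhd>\<inverse>\<^bsub>Q\<^esub> y) y)) (d x) \<in> N"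
proof -
  have "d (x \<rhd>\<inverse>\<^bsub>Q\<^esub> y \<rhd>\<^bsub>Q\<^esub> y) - fscale (group_ring_of (\<theta> (x \<rhd>\<inverse>\<^bsub>Q\<^esub> y) y)) (d (x \<rhd>\<inverse>\<^bsub>Q\<^esub> y)) \<in> N"
    using d xy quandle.dual_closed[OF Q xy] by (simp add: derivation_mod_def)
  then show ?thesis
    using subspace_unscale[OF N] quandle.op_dual[OF Q xy] by metis
qed

text \<open>The value at \<open>u\<close> acted on by \<open>v\<close> is a unit times the value at \<open>u\<close>, and that unit
  depends only on the images of \<open>u\<close> and \<open>v\<close> in the presented quandle. Replacing either of
  them by a congruent element therefore keeps the unit, and the relation between values is
  inherited by the results of the operation.\<close>

lemma derivation_congruence:
  assumes N: "fmod.subspace N"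
    and R: "R \<subseteq> carrier (free_quandle S) \<times> carrier (free_quandle S)"
    and \<psi>: "\<And>u v. (u, v) \<in> quandle_congruence (free_quandle S) R \<Longrightarrow> \<psi> u = \<psi> v"
    and d: "derivation_mod (free_quandle S) (\<lambda>x y. \<theta> (\<psi> x) (\<psi> y)) N d"
    and rel: "\<And>u v. (u, v) \<in> R \<Longrightarrow> d u - d v \<in> N"
    and uv: "(u, v) \<in> quandle_congruence (free_quandle S) R"
  shows "d u - d v \<in> N"
proof -
  let ?Q = "free_quandle S" and ?C = "quandle_congruence (free_quandle S) R"
  note cl = congruence_closed[OF quandle_free_quandle R]
  have d_op: "d (x \<rhd>\<^bsub>?Q\<^esub> z) - fscale (group_ring_of (\<theta> (\<psi> x) (\<psi> z))) (d x) \<in> N"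
    if "x \<in> carrier ?Q" "z \<in> carrier ?Q" for x z
    using d that by (simp add: derivation_mod_def)
  have op: "d (x \<rhd>\<^bsub>?Q\<^esub> z) - d (x' \<rhd>\<^bsub>?Q\<^esub> z') \<in> N"
    if C: "(x, x') \<in> ?C" "(z, z') \<in> ?C" and dx: "d x - d x' \<in> N" for x x' z z'
  proof -
    let ?g = "group_ring_of (\<theta> (\<psi> x) (\<psi> z))"
    have "d (x \<rhd>\<^bsub>?Q\<^esub> z) - fscale ?g (d x) \<in> N" "d (x' \<rhd>\<^bsub>?Q\<^esub> z') - fscale ?g (d x') \<in> N"
      using d_op[of x z] d_op[of x' z'] \<psi>[OF C(1)] \<psi>[OF C(2)] cl[OF C(1)] cl[OF C(2)] by simp_all
    with subspace_scale_diff[OF N dx, of ?g] show ?thesis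
      by (meson subspace_trans[OF N] subspace_sym[OF N])
  qed
  have dual: "d (x \<rhd>\<inverse>\<^bsub>?Q\<^esub> z) - d (x' \<rhd>\<inverse>\<^bsub>?Q\<^esub> z') \<in> N"
    if C: "(x, x') \<in> ?C" "(z, z') \<in> ?C" "(x \<rhd>\<inverse>\<^bsub>?Q\<^esub> z, x' \<rhd>\<inverse>\<^bsub>?Q\<^esub> z') \<in> ?C" and dx: "d x - d x' \<in> N"
    for x x' z z'
  proof -
    let ?g = "group_ring_of (- \<theta> (\<psi> (x \<rhd>\<inverse>\<^bsub>?Q\<^esub> z)) (\<psi> z))"
    have "d (x \<rhd>\<inverse>\<^bsub>?Q\<^esub> z) - fscale ?g (d x) \<in> N" "d (x' \<rhd>\<inverse>\<^bsub>?Q\<^esub> z') - fscale ?g (d x') \<in> N"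
      using derivation_dual[OF quandle_free_quandle N d, of x z]
        derivation_dual[OF quandle_free_quandle N d, of x' z']
        \<psi>[OF C(2)] \<psi>[OF C(3)] cl[OF C(1)] cl[OF C(2)] by auto
    with subspace_scale_diff[OF N dx, of ?g] show ?thesis
      by (meson subspace_trans[OF N] subspace_sym[OF N])
  qed
  have refl: "d x - d x \<in> N" for x using fmod.subspace_0[OF N] by simp
  define C where "C x y \<longleftrightarrow> d x - d y \<in> N" for x y
  have "C (fst p) (snd p)" if "p \<in> ?C" for p
    using that
  proof (induction rule: quandle_congruence.induct)
    case (base p)
    then show ?case using rel[of "fst p" "snd p"] by (simp add: C_def)
  next
    case (sym x y)
    then show ?case using subspace_sym[OF N, of "d x" "d y"] by (simp add: C_def)
  next
    case (trans x y z)
    then show ?case using subspace_trans[OF N, of "d x" "d y" "d z"] by (simp add: C_def)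
  next
    case (dual_left x y z)
    then show ?case using dual[of x y z z]
      by (auto simp: C_def intro: quandle_congruence.intros)
  next
    case (dual_right x y z)
    then show ?case using dual[of z z x y] refl
      by (auto simp: C_def intro: quandle_congruence.intros)
  qed (auto simp: C_def fmod.subspace_0[OF N] intro: op quandle_congruence.intros)
  from this[OF uv] show ?thesis by (simp add: C_def)
qed

text \<open>The derivation induced on the presented quandle: the value at \<open>q\<close> is taken at some element
  that \<open>\<psi>\<close> maps to \<open>q\<close>, and the choice does not matter modulo \<open>N\<close>.\<close>

lemma derivation_descends:
  assumes N: "fmod.subspace N" and P: "presents S R Q \<psi>"
    and d: "derivation_mod (free_quandle S) (\<lambda>x y. \<theta> (\<psi> x) (\<psi> y)) N d"
    and rel: "\<And>u v. (u, v) \<in> R \<Longrightarrow> d u - d v \<in> N"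
  defines "\<delta> \<equiv> \<lambda>q. d (inv_into (carrier (free_quandle S)) \<psi> q)"
  shows "\<And>u. u \<in> carrier (free_quandle S) \<Longrightarrow> \<delta> (\<psi> u) - d u \<in> N"
    and "derivation_mod Q \<theta> N \<delta>"
proof -
  let ?F = "free_quandle S"
  note R = presentsD(1)[OF P] and \<psi> = presentsD(2)[OF P] and onto = presentsD(3)[OF P]
    and eq = presentsD(4)[OF P]
  note cl = congruence_closed[OF quandle_free_quandle R]
  show descend: "\<delta> (\<psi> u) - d u \<in> N" if u: "u \<in> carrier ?F" for u
    unfolding \<delta>_def
  proof (rule derivation_congruence[where \<psi> = \<psi> and \<theta> = \<theta> and R = R and S = S, OF N R])
    show "(inv_into (carrier ?F) \<psi> (\<psi> u), u) \<in> quandle_congruence ?F R"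
      using u by (intro eq[THEN iffD1]) (auto simp: inv_into_into f_inv_into_f)
  qed (use eq cl d rel in blast)+
  show "derivation_mod Q \<theta> N \<delta>"
    unfolding derivation_mod_def onto[symmetric]
  proof (intro ballI)
    fix x y assume "x \<in> \<psi> ` carrier ?F" "y \<in> \<psi> ` carrier ?F"
    then obtain u v where u: "u \<in> carrier ?F" "x = \<psi> u" and v: "v \<in> carrier ?F" "y = \<psi> v" by blast
    have "\<delta> (x \<rhd>\<^bsub>Q\<^esub> y) - d (u \<rhd>\<^bsub>?F\<^esub> v) \<in> N"
      using descend[of "u \<rhd>\<^bsub>?F\<^esub> v"] u v
      by (simp add: quandle_hom_op[OF \<psi>] quandle.qop_closed quandle_free_quandle)
    moreover have "d (u \<rhd>\<^bsub>?F\<^esub> v) - fscale (group_ring_of (\<theta> x y)) (d u) \<in> N"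
      using d u v by (simp add: derivation_mod_def)
    moreover have "fscale (group_ring_of (\<theta> x y)) (d u) - fscale (group_ring_of (\<theta> x y)) (\<delta> x) \<in> N"
      using subspace_scale_diff[OF N subspace_sym[OF N descend[OF u(1)]]] u by simp
    ultimately show "\<delta> (x \<rhd>\<^bsub>Q\<^esub> y) - fscale (group_ring_of (\<theta> x y)) (\<delta> x) \<in> N"
      by (meson subspace_trans[OF N])
  qed
qed

lemma derivation_mod_compose:
  assumes "\<psi> \<in> quandle_hom P Q" "derivation_mod Q \<theta> N d"
  shows "derivation_mod P (\<lambda>x y. \<theta> (\<psi> x) (\<psi> y)) N (\<lambda>u. d (\<psi> u))"
  using assms by (auto simp: derivation_mod_def quandle_hom_op quandle_hom_closed)

text \<open>A derivation on the free quandle is determined by its values on generators: along a word the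
  units multiply up to the group element of the potential.\<close>

lemma derivation_of_word:
  assumes N: "fmod.subspace N"
    and d: "derivation_mod (free_quandle S) (\<lambda>x y. \<theta> (p x) (p y)) N d"
    and W: "cocycle_potential S p \<theta> W" and u: "u \<in> carrier (free_quandle S)"
  shows "d u - fscale (group_ring_of (W u)) (d (fq_gen S (fq_base u))) \<in> N"
proof -
  define C where "C u a \<longleftrightarrow> d u - fscale (group_ring_of a) (d (fq_gen S (fq_base u))) \<in> N" for u a
  \<comment> \<open>Acting on \<open>x\<close> multiplies both \<open>d x\<close> and the group ring element of the potential by
    the same unit.\<close>
  have step: "C y (a + W x)"
    if "d y - fscale (group_ring_of a) (d x) \<in> N" "C x (W x)" "fq_base y = fq_base x" for x y a
  proof -
    have "fscale (group_ring_of a) (d x) -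
        fscale (group_ring_of a) (fscale (group_ring_of (W x)) (d (fq_gen S (fq_base x)))) \<in> N"
      by (rule subspace_scale_diff[OF N that(2)[unfolded C_def]])
    from subspace_trans[OF N that(1) this] show ?thesis
      unfolding C_def fmod.scale_scale group_ring_of_add[symmetric] that(3) .
  qed
  from u have "C u (W u)"
  proof (induction rule: free_quandle_induct)
    case (gen s)
    then show ?case
      using W fmod.subspace_0[OF N] by (simp add: C_def cocycle_potential_def fq_base_gen)
  next
    case (op x s)
    have "W (x \<rhd>\<^bsub>free_quandle S\<^esub> fq_gen S s) = \<theta> (p x) (p (fq_gen S s)) + W x"
      using W op by (simp add: cocycle_potential_def fq_gen_closed add.commute)
    then show ?case
      using d op by (auto simp: derivation_mod_def fq_base_op fq_gen_closed intro!: step)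
  next
    case (dual x s)
    let ?y = "x \<rhd>\<inverse>\<^bsub>free_quandle S\<^esub> fq_gen S s"
    have "W ?y = - \<theta> (p ?y) (p (fq_gen S s)) + W x"
      using potential_dual[OF W dual(1) fq_gen_closed[OF dual(2)]] by simp
    moreover have "C ?y (- \<theta> (p ?y) (p (fq_gen S s)) + W x)"
      using dual by (intro step derivation_dual[OF quandle_free_quandle N d])
        (simp_all add: fq_gen_closed fq_base_dual)
    ultimately show ?case by (simp only:)
  qed
  then show ?thesis by (simp only: C_def)
qed

lemma orbit_invariant_of_word:
  assumes inv: "\<And>u v. \<lbrakk>u \<in> carrier (free_quandle S); v \<in> carrier (free_quandle S)\<rbrakk>
      \<Longrightarrow> f (u \<rhd>\<^bsub>free_quandle S\<^esub> v) = f u"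
    and u: "u \<in> carrier (free_quandle S)"
  shows "f u = f (fq_gen S (fq_base u))"
  using u
proof (induction rule: free_quandle_induct)
  case (dual x s)
  have s: "fq_gen S s \<in> carrier (free_quandle S)" using dual by (simp add: fq_gen_closed)
  have "f (x \<rhd>\<inverse>\<^bsub>free_quandle S\<^esub> fq_gen S s) = f x"
    using inv[OF quandle.dual_closed[OF quandle_free_quandle dual(1) s] s]
      quandle.op_dual[OF quandle_free_quandle dual(1) s] by simp
  then show ?case using dual s by (simp add: fq_base_dual)
qed (simp_all add: inv fq_base_gen fq_base_op fq_gen_closed)

section \<open>Quandles whose orbits have cyclic holonomy\<close>

text \<open>The quotient by the row space is the module presented by the matrix.\<close>

lemma subspace_row_space: "fmod.subspace (row_space M)"
proof (rule fmod.subspaceI)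
  show "0 \<in> row_space M"
    unfolding row_space_def by (intro CollectI exI[of _ "\<lambda>_. 0"]) simp
  fix x y assume "x \<in> row_space M" "y \<in> row_space M"
  then obtain c d where "\<forall>j<dim_col M. x j = (\<Sum>i<dim_row M. c i * M $$ (i, j))"
    "\<forall>j<dim_col M. y j = (\<Sum>i<dim_row M. d i * M $$ (i, j))"
    unfolding row_space_def by blast
  then show "x + y \<in> row_space M"
    unfolding row_space_def
    by (intro CollectI exI[of _ "\<lambda>i. c i + d i"]) (simp add: sum.distrib algebra_simps)
next
  fix r x assume "x \<in> row_space M"
  then obtain c where "\<forall>j<dim_col M. x j = (\<Sum>i<dim_row M. c i * M $$ (i, j))"
    unfolding row_space_def by blast
  then show "fscale r x \<in> row_space M"
    unfolding row_space_def
    by (intro CollectI exI[of _ "\<lambda>i. r * c i"]) (simp add: sum_distrib_left algebra_simps)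
qed

text \<open>This is where the choice of the presentation disappears. The module presented by the Alexander
  matrix carries the universal derivation on \<open>Q\<close>. The hypotheses say that this module is the
  direct sum, over the orbits \<open>k\<close> of \<open>Q\<close>, of the group ring modulo \<open>w k - 1\<close>: by the
  conditions on \<open>\<kappa>\<close> and \<open>T\<close>, sending \<open>q\<close> to the group element \<open>T q\<close> in the
  summand \<open>\<kappa> q\<close> is a derivation,
  and by the last condition every derivation factors through it. Applied to the derivation of a
  given presentation, the two halves are the two inclusions between its row space and the vectors
  whose \<open>T\<close>-weighted sum over each orbit is divisible by \<open>w k - 1\<close>.\<close>

theorem elementary_ideal_of_cyclic_orbits:
  fixes \<theta> :: "'x \<Rightarrow> 'x \<Rightarrow> 'a::ab_group_add"
    and \<kappa> :: "'q \<Rightarrow> 'k" and T :: "'q \<Rightarrow> 'a" and w :: "'k \<Rightarrow> 'a"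
  assumes X: "quandle X" and \<theta>: "quandle_2_cocycle X \<theta>" and \<rho>: "\<rho> \<in> quandle_hom Q X"
    and fp: "finite_presentation Q xs rs \<phi>"
    and \<kappa>: "\<kappa> ` carrier Q = I" "\<And>x y. \<lbrakk>x \<in> carrier Q; y \<in> carrier Q\<rbrakk> \<Longrightarrow> \<kappa> (x \<rhd>\<^bsub>Q\<^esub> y) = \<kappa> x"
    and T: "\<And>x y. \<lbrakk>x \<in> carrier Q; y \<in> carrier Q\<rbrakk> \<Longrightarrow>
      group_ring_of (w (\<kappa> x)) - 1 dvd
        group_ring_of (T (x \<rhd>\<^bsub>Q\<^esub> y)) - group_ring_of (\<theta> (\<rho> x) (\<rho> y) + T x)"
    and E: "\<And>N (d :: 'q \<Rightarrow> nat \<Rightarrow> 'a \<Rightarrow>\<^sub>0 int).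
      \<lbrakk>fmod.subspace N; derivation_mod Q (\<lambda>x y. \<theta> (\<rho> x) (\<rho> y)) N d\<rbrakk> \<Longrightarrow>
      \<exists>e. (\<forall>q\<in>carrier Q. d q - fscale (group_ring_of (T q)) (e (\<kappa> q)) \<in> N) \<and>
          (\<forall>k\<in>I. fscale (group_ring_of (w k) - 1) (e k) \<in> N)"
  shows "elementary_ideal 0
      (alexander_matrix xs rs \<phi> \<rho> (\<lambda>x y. group_ring_of (\<theta> x y)) (\<lambda>x y. 0)) =
    generated_ideal {\<Prod>k\<in>I. group_ring_of (w k) - 1}"
proof -
  define S where "S = set xs"
  define \<psi> where "\<psi> = (\<lambda>u. \<phi> (presented_proj S (set rs) u))"
  define n where "n = length xs"
  define M where "M = alexander_matrix xs rs \<phi> \<rho> (\<lambda>x y. group_ring_of (\<theta> x y)) (\<lambda>x y. 0)"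
  let ?F = "free_quandle S"
  have xs: "n > 0" "distinct xs" using fp by (auto simp: finite_presentation_def n_def)
  have P: "presents S (set rs) Q \<psi>"
    using finite_presentation_presents[OF fp] by (simp add: S_def \<psi>_def)
  note R = presentsD(1)[OF P] and \<psi> = presentsD(2)[OF P] and onto = presentsD(3)[OF P]
    and \<psi>_eq = presentsD(4)[OF P]
  have p: "(\<lambda>u. \<rho> (\<psi> u)) \<in> quandle_hom ?F X" by (rule quandle_hom_compose[OF \<psi> \<rho>])
  obtain W where W: "cocycle_potential S (\<lambda>u. \<rho> (\<psi> u)) \<theta> W"
    using cocycle_potential_exists[OF X \<theta> p] .
  have dim: "dim_row M = length rs" "dim_col M = n"
    by (simp_all add: M_def alexander_matrix_def Let_def n_def)
  then have M: "M \<in> carrier_mat (length rs) n" by auto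
  define D where "D u j = (if fq_base u = xs ! j then group_ring_of (W u) else 0)" for u and j :: nat
  have M_index: "M $$ (i, j) = D (fst (rs ! i)) j - D (snd (rs ! i)) j" if "i < length rs" "j < n" for i j
  proof -
    have "fst (rs ! i) \<in> carrier ?F" "snd (rs ! i) \<in> carrier ?F"
      using R nth_mem[OF that(1)] by (auto simp: mem_Times_iff)
    then show ?thesis
      using that derivative_potential[OF W]
      by (simp add: M_def alexander_matrix_def Let_def n_def D_def \<psi>_def S_def)
  qed
  note N = subspace_row_space[of M]
  have D_op: "D (u \<rhd>\<^bsub>?F\<^esub> v) = fscale (group_ring_of (\<theta> (\<rho> (\<psi> u)) (\<rho> (\<psi> v)))) (D u)"
    if "u \<in> carrier ?F" "v \<in> carrier ?F" for u v
    using that W by (simp add: fun_eq_iff D_def fq_base_op cocycle_potential_def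
        group_ring_of_add mult.commute)
  have D: "derivation_mod ?F (\<lambda>u v. \<theta> (\<rho> (\<psi> u)) (\<rho> (\<psi> v))) (row_space M) D"
    unfolding derivation_mod_def using fmod.subspace_0[OF N] by (auto simp: D_op)
  have D_rel: "D u - D v \<in> row_space M" if "(u, v) \<in> set rs" for u v
  proof -
    obtain i where "i < length rs" "rs ! i = (u, v)" using \<open>(u, v) \<in> set rs\<close> by (auto simp: in_set_conv_nth)
    then show ?thesis using M_index dim by (intro row_in_row_space[of i]) auto
  qed
  define gen where "gen j = fq_gen S (xs ! j)" for j
  have gen: "gen j \<in> carrier ?F" if "j < n" for j
    using that by (simp add: gen_def fq_gen_closed S_def n_def)
  have \<psi>_gen: "\<psi> (gen j) \<in> carrier Q" if "j < n" for j using gen[OF that] \<psi> by (simp add: quandle_hom_closed)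
  have fq_base_index: "\<exists>j<n. fq_base u = xs ! j" if "u \<in> carrier ?F" for u
    using fq_base_in[OF that] by (auto simp: S_def n_def in_set_conv_nth)
  have \<kappa>_word: "\<kappa> (\<psi> u) = \<kappa> (\<psi> (fq_gen S (fq_base u)))" if "u \<in> carrier ?F" for u
    using that by (intro orbit_invariant_of_word) (auto simp: quandle_hom_op[OF \<psi>] quandle_hom_closed[OF \<psi>] \<kappa>(2))
  \<comment> \<open>Orbit by orbit, \<open>T\<close> is a derivation modulo the holonomy of the orbit.\<close>
  define N' where "N' = {x. \<forall>k\<in>I. group_ring_of (w k) - 1 dvd x k}"
  define d' where "d' q k = (if k = \<kappa> q then group_ring_of (T q) else 0)" for q k
  have N': "fmod.subspace N'"
    by (rule fmod.subspaceI) (auto simp: N'_def)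
  have d': "derivation_mod Q (\<lambda>x y. \<theta> (\<rho> x) (\<rho> y)) N' d'"
    unfolding derivation_mod_def
  proof (intro ballI)
    fix x y assume xy: "x \<in> carrier Q" "y \<in> carrier Q"
    show "d' (x \<rhd>\<^bsub>Q\<^esub> y) - fscale (group_ring_of (\<theta> (\<rho> x) (\<rho> y))) (d' x) \<in> N'"
      using T[OF xy] by (auto simp: N'_def d'_def \<kappa>(2)[OF xy] group_ring_of_add)
  qed
  define t where "t j = group_ring_of (T (\<psi> (gen j)))" for j
  define \<kappa>' where "\<kappa>' j = \<kappa> (\<psi> (gen j))" for j
  have proj_D: "(\<Sum>j | j < n \<and> \<kappa>' j = k. D u j * t j) =
      fscale (group_ring_of (W u)) (d' (\<psi> (fq_gen S (fq_base u)))) k"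
    if u: "u \<in> carrier ?F" for u k
  proof -
    obtain i where i: "i < n" "fq_base u = xs ! i" using fq_base_index[OF u] by blast
    have "D u j * t j = (if j = i then group_ring_of (W u) * t i else 0)" if "j < n" for j
      using that i xs by (auto simp: D_def nth_eq_iff_index_eq n_def)
    then have "(\<Sum>j | j < n \<and> \<kappa>' j = k. D u j * t j) =
        (\<Sum>j | j < n \<and> \<kappa>' j = k. if j = i then group_ring_of (W u) * t i else 0)"
      by (intro sum.cong) auto
    also have "\<dots> = (if \<kappa>' i = k then group_ring_of (W u) * t i else 0)"
      using i by simp
    finally show ?thesis using i by (auto simp: d'_def \<kappa>'_def t_def gen_def)
  qed
  have rows: "x \<in> row_space M \<longleftrightarrow>
      (\<forall>k\<in>I. group_ring_of (w k) - 1 dvd (\<Sum>j | j < n \<and> \<kappa>' j = k. x j * t j))" for x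
  proof
    assume "x \<in> row_space M"
    then obtain c where c: "\<And>j. j < n \<Longrightarrow> x j = (\<Sum>i<length rs. c i * M $$ (i, j))"
      using dim by (auto simp: row_space_def)
    show "\<forall>k\<in>I. group_ring_of (w k) - 1 dvd (\<Sum>j | j < n \<and> \<kappa>' j = k. x j * t j)"
    proof
      fix k assume k: "k \<in> I"
      have "(\<Sum>j | j < n \<and> \<kappa>' j = k. x j * t j) =
          (\<Sum>j | j < n \<and> \<kappa>' j = k. \<Sum>i<length rs. c i * (M $$ (i, j) * t j))"
        by (intro sum.cong) (auto simp: c sum_distrib_right mult.assoc)
      also have "\<dots> = (\<Sum>i<length rs. c i * (\<Sum>j | j < n \<and> \<kappa>' j = k. M $$ (i, j) * t j))"
        by (subst sum.swap) (simp add: sum_distrib_left)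
      also have "group_ring_of (w k) - 1 dvd \<dots>"
      proof (rule dvd_sum, rule dvd_mult)
        fix i assume "i \<in> {..<length rs}"
        then have i: "i < length rs" by simp
        obtain u v where uv: "rs ! i = (u, v)" by (cases "rs ! i")
        have "(u, v) \<in> set rs" using nth_mem[OF i] uv by simp
        then have car: "u \<in> carrier ?F" "v \<in> carrier ?F" and \<psi>uv: "\<psi> u = \<psi> v"
          using R \<psi>_eq by (auto intro: quandle_congruence.base)
        have "(\<Sum>j | j < n \<and> \<kappa>' j = k. M $$ (i, j) * t j) =
            (\<Sum>j | j < n \<and> \<kappa>' j = k. D u j * t j) - (\<Sum>j | j < n \<and> \<kappa>' j = k. D v j * t j)"
          unfolding sum_subtractf[symmetric]
          by (intro sum.cong) (auto simp: M_index[OF i] uv left_diff_distrib)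
        also have "\<dots> = (fscale (group_ring_of (W u)) (d' (\<psi> (fq_gen S (fq_base u)))) -
            fscale (group_ring_of (W v)) (d' (\<psi> (fq_gen S (fq_base v))))) k"
          by (simp only: proj_D[OF car(1)] proj_D[OF car(2)] minus_apply)
        finally have eq: "(\<Sum>j | j < n \<and> \<kappa>' j = k. M $$ (i, j) * t j) = \<dots>" .
        have "d' (\<psi> u) - fscale (group_ring_of (W u)) (d' (\<psi> (fq_gen S (fq_base u)))) \<in> N'"
          "d' (\<psi> v) - fscale (group_ring_of (W v)) (d' (\<psi> (fq_gen S (fq_base v)))) \<in> N'"
          using derivation_of_word[OF N' derivation_mod_compose[OF \<psi> d'] W] car by blast+
        then have "fscale (group_ring_of (W u)) (d' (\<psi> (fq_gen S (fq_base u)))) -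
            fscale (group_ring_of (W v)) (d' (\<psi> (fq_gen S (fq_base v)))) \<in> N'"
          unfolding \<psi>uv by (meson subspace_trans[OF N'] subspace_sym[OF N'])
        with k show "group_ring_of (w k) - 1 dvd (\<Sum>j | j < n \<and> \<kappa>' j = k. M $$ (i, j) * t j)"
          unfolding eq N'_def by blast
      qed
      finally show "group_ring_of (w k) - 1 dvd (\<Sum>j | j < n \<and> \<kappa>' j = k. x j * t j)" .
    qed
  next
    assume dvd: "\<forall>k\<in>I. group_ring_of (w k) - 1 dvd (\<Sum>j | j < n \<and> \<kappa>' j = k. x j * t j)"
    define \<delta> where "\<delta> q = D (inv_into (carrier ?F) \<psi> q)" for q
    have \<delta>_D: "\<delta> (\<psi> u) - D u \<in> row_space M" if "u \<in> carrier ?F" for u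
      unfolding \<delta>_def using derivation_descends(1)[OF N P D D_rel that] .
    have "derivation_mod Q (\<lambda>x y. \<theta> (\<rho> x) (\<rho> y)) (row_space M) \<delta>"
      unfolding \<delta>_def using derivation_descends(2)[OF N P D D_rel] .
    from E[OF N this] obtain e where
      e: "\<And>q. q \<in> carrier Q \<Longrightarrow> \<delta> q - fscale (group_ring_of (T q)) (e (\<kappa> q)) \<in> row_space M"
      and e_w: "\<And>k. k \<in> I \<Longrightarrow> fscale (group_ring_of (w k) - 1) (e k) \<in> row_space M"
      by blast
    have gen_e: "D (gen j) - fscale (t j) (e (\<kappa>' j)) \<in> row_space M" if "j < n" for j
      using subspace_trans[OF N subspace_sym[OF N \<delta>_D[OF gen[OF that]]] e[OF \<psi>_gen[OF that]]]
      by (simp add: t_def \<kappa>'_def)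
    let ?y = "\<Sum>j<n. fscale (x j) (D (gen j))" and ?z = "\<Sum>j<n. fscale (x j) (fscale (t j) (e (\<kappa>' j)))"
    have sum_apply: "(\<Sum>j\<in>A. f j) i = (\<Sum>j\<in>A. f j i)" for A and f :: "nat \<Rightarrow> nat \<Rightarrow> 'a \<Rightarrow>\<^sub>0 int" and i
      by (induction A rule: infinite_finite_induct) auto
    have D_gen: "D (gen j) i = (if j = i then 1 else 0)" if "j < n" "i < n" for i j
      using that W xs by (auto simp: D_def gen_def fq_base_gen S_def n_def cocycle_potential_def
          nth_eq_iff_index_eq)
    have "?y i = x i" if i: "i < n" for i
    proof -
      have "?y i = (\<Sum>j<n. if j = i then x i else 0)"
        unfolding sum_apply by (intro sum.cong) (auto simp: D_gen i)
      then show ?thesis using i by simp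
    qed
    then have "x - ?y \<in> row_space M"
      unfolding row_space_def dim by (intro CollectI exI[of _ "\<lambda>_. 0"]) simp
    moreover have "?y - ?z \<in> row_space M"
      unfolding sum_subtractf[symmetric]
      by (intro fmod.subspace_sum[OF N] subspace_scale_diff[OF N] gen_e) simp
    moreover have "?z \<in> row_space M"
    proof -
      have "\<kappa>' ` {..<n} \<subseteq> I" using \<kappa>(1) \<psi>_gen by (auto simp: \<kappa>'_def)
      then have "?z = (\<Sum>k\<in>\<kappa>' ` {..<n}. \<Sum>j | j \<in> {..<n} \<and> \<kappa>' j = k. fscale (x j) (fscale (t j) (e (\<kappa>' j))))"
        by (intro sum.group[symmetric]) auto
      also have "\<dots> = (\<Sum>k\<in>\<kappa>' ` {..<n}. fscale (\<Sum>j | j < n \<and> \<kappa>' j = k. x j * t j) (e k))"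
        by (intro sum.cong) (auto simp: fmod.scale_sum_left)
      also have "\<dots> \<in> row_space M"
      proof (rule fmod.subspace_sum[OF N])
        fix k assume "k \<in> \<kappa>' ` {..<n}"
        then have k: "k \<in> I" using \<open>\<kappa>' ` {..<n} \<subseteq> I\<close> by blast
        then obtain r where "(\<Sum>j | j < n \<and> \<kappa>' j = k. x j * t j) = (group_ring_of (w k) - 1) * r"
          using dvd by (auto simp: dvd_def)
        then show "fscale (\<Sum>j | j < n \<and> \<kappa>' j = k. x j * t j) (e k) \<in> row_space M"
          using fmod.subspace_scale[OF N e_w[OF k], of r] by (simp add: mult.commute)
      qed
      finally show ?thesis .
    qed
    ultimately show "x \<in> row_space M"
      using fmod.subspace_add[OF N subspace_trans[OF N, of x ?y ?z]] by fastforce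
  qed
  have \<kappa>'_onto: "\<kappa>' ` {..<n} = I"
  proof
    show "\<kappa>' ` {..<n} \<subseteq> I" using \<kappa>(1) \<psi>_gen by (auto simp: \<kappa>'_def)
    show "I \<subseteq> \<kappa>' ` {..<n}"
    proof
      fix k assume "k \<in> I"
      then have "k \<in> \<kappa> ` \<psi> ` carrier ?F" by (simp add: \<kappa>(1) onto)
      then obtain u where u: "u \<in> carrier ?F" "k = \<kappa> (\<psi> u)" by auto
      obtain j where "j < n" "fq_base u = xs ! j" using fq_base_index[OF u(1)] by auto
      then have "k = \<kappa>' j" using \<kappa>_word[OF u(1)] u by (simp add: \<kappa>'_def gen_def)
      then show "k \<in> \<kappa>' ` {..<n}" using \<open>j < n\<close> by blast
    qed
  qed
  have "elementary_ideal 0 M = generated_ideal (minors M n)"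
    using elementary_ideal_0[of M] xs dim by simp
  also have "\<dots> = generated_ideal {\<Prod>k\<in>I. group_ring_of (w k) - 1}"
    by (rule minors_ideal_of_monomial_row_space[OF M \<kappa>'_onto _ rows,
          where t' = "\<lambda>j. group_ring_of (- T (\<psi> (gen j)))"])
      (simp add: t_def)
  finally show ?thesis by (simp add: M_def)
qed

section \<open>Equality of group elements modulo a holonomy\<close>

text \<open>Equality up to multiples of \<open>w\<close>, as far as the group ring modulo \<open>w - 1\<close> can tell.\<close>

definition eq_modulo :: "'a::ab_group_add \<Rightarrow> 'a \<Rightarrow> 'a \<Rightarrow> bool" where
  "eq_modulo w a b \<longleftrightarrow> group_ring_of w - 1 dvd group_ring_of a - group_ring_of b"

lemma eq_modulo_refl [simp]: "eq_modulo w a a"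
  by (simp add: eq_modulo_def)

lemma eq_modulo_sym: "eq_modulo w a b \<Longrightarrow> eq_modulo w b a"
  unfolding eq_modulo_def by (subst dvd_minus_iff[symmetric]) simp

lemma eq_modulo_trans:
  assumes "eq_modulo w a b" "eq_modulo w b c"
  shows "eq_modulo w a c"
  using dvd_add[OF assms[unfolded eq_modulo_def]] by (simp add: eq_modulo_def)

lemma eq_modulo_add: "eq_modulo w a b \<Longrightarrow> eq_modulo w (x + a) (x + b)"
  unfolding eq_modulo_def
  by (simp add: group_ring_of_add flip: right_diff_distrib)

text \<open>Going once around a loop of holonomy \<open>w\<close> changes nothing modulo \<open>w\<close>.\<close>

lemma eq_modulo_period: "eq_modulo w (a - w) a"
proof -
  have "group_ring_of a = group_ring_of (a - w) * group_ring_of w"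
    by (simp flip: group_ring_of_add)
  then have "group_ring_of a - group_ring_of (a - w) = group_ring_of (a - w) * (group_ring_of w - 1)"
    by (simp add: right_diff_distrib)
  then have "eq_modulo w a (a - w)" by (simp add: eq_modulo_def)
  then show ?thesis by (rule eq_modulo_sym)
qed

section \<open>Summation along the cycles of a permutation\<close>

text \<open>The sum of \<open>\<omega>\<close> over the edges passed when walking with \<open>f\<close> from \<open>b\<close> until \<open>e\<close> is
  reached for the first time; the edge \<open>e\<close> itself does not count.\<close>

definition path_sum :: "('e \<Rightarrow> 'e) \<Rightarrow> ('e \<Rightarrow> 'a::ab_group_add) \<Rightarrow> 'e \<Rightarrow> 'e \<Rightarrow> 'a" where
  "path_sum f \<omega> b e = (\<Sum>i<funpow_dist f b e. \<omega> ((f ^^ i) b))"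

lemma funpow_dist_le: "(f ^^ n) x = y \<Longrightarrow> funpow_dist f x y \<le> n"
  unfolding funpow_dist_def by (rule Least_le)

lemma orbit_sum_conv:
  assumes "permutation f"
  shows "(\<Sum>i<funpow_dist1 f b b. \<omega> ((f ^^ i) b)) = (\<Sum>e\<in>orbit f b. \<omega> e)"
proof -
  have b: "b \<in> orbit f b" by (rule permutation_self_in_orbit[OF assms])
  have "(\<Sum>e\<in>orbit f b. \<omega> e) = (\<Sum>e\<in>(\<lambda>i. (f ^^ i) b) ` {0..<funpow_dist1 f b b}. \<omega> e)"
    by (rule arg_cong[OF orbit_conv_funpow_dist1[OF b]])
  also have "\<dots> = (\<Sum>i<funpow_dist1 f b b. \<omega> ((f ^^ i) b))"
    by (simp only: sum.reindex[OF inj_on_funpow_dist1[OF b]] o_def lessThan_atLeast0)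
  finally show ?thesis ..
qed

text \<open>One more step adds \<open>\<omega> e\<close>, except that the step back to \<open>b\<close> resets the sum from the total
  of the cycle to \<open>0\<close>.\<close>

lemma path_sum_step:
  assumes f: "permutation f" and e: "e \<in> orbit f b"
  shows "eq_modulo (\<Sum>x\<in>orbit f b. \<omega> x) (path_sum f \<omega> b (f e)) (path_sum f \<omega> b e + \<omega> e)"
proof -
  have b: "b \<in> orbit f b" by (rule permutation_self_in_orbit[OF f])
  define k where "k = funpow_dist f b e"
  have k: "(f ^^ k) b = e" using funpow_dist_prop[OF e] by (simp add: k_def)
  have sum: "path_sum f \<omega> b e + \<omega> e = (\<Sum>i<Suc k. \<omega> ((f ^^ i) b))"
    by (simp add: path_sum_def k k_def[symmetric])
  show ?thesis
  proof (cases "f e = b")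
    case True
    have "funpow_dist1 f b b = Suc k"
    proof (rule antisym)
      show "funpow_dist1 f b b \<le> Suc k"
        using funpow_dist1_le_self[where f = f and m = "Suc k" and x = b and y = b] k True b by simp
      have "f ((f ^^ funpow_dist f (f b) b) b) = f e"
        using funpow_dist1_prop[OF b] True by simp
      then have "(f ^^ funpow_dist f (f b) b) b = e"
        using f by (metis bij_is_inj injD permutation_bijective)
      then show "Suc k \<le> funpow_dist1 f b b"
        unfolding k_def Suc_le_mono by (rule funpow_dist_le)
    qed
    then have "path_sum f \<omega> b e + \<omega> e = (\<Sum>x\<in>orbit f b. \<omega> x)"
      using orbit_sum_conv[OF f, of \<omega> b] sum by simp
    moreover have "path_sum f \<omega> b (f e) = 0" by (simp add: path_sum_def True funpow_dist_0)
    ultimately show ?thesis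
      using eq_modulo_period[of "\<Sum>x\<in>orbit f b. \<omega> x" "\<Sum>x\<in>orbit f b. \<omega> x"] by simp
  next
    case False
    have fe: "f e \<in> orbit f b" by (rule orbit.step[OF e])
    have "funpow_dist f b (f e) = Suc k"
    proof (rule antisym)
      show "funpow_dist f b (f e) \<le> Suc k" by (rule funpow_dist_le) (simp add: k)
      obtain m where m: "funpow_dist f b (f e) = Suc m"
        using False funpow_dist_0_eq[OF fe] by (cases "funpow_dist f b (f e)") auto
      then have "f ((f ^^ m) b) = f e" using funpow_dist_prop[OF fe] by simp
      then have "(f ^^ m) b = e"
        using f by (metis bij_is_inj injD permutation_bijective)
      then have "k \<le> m" unfolding k_def by (rule funpow_dist_le)
      then show "Suc k \<le> funpow_dist f b (f e)" by (simp add: m)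
    qed
    then have "path_sum f \<omega> b (f e) = path_sum f \<omega> b e + \<omega> e"
      using sum by (simp add: path_sum_def)
    then show ?thesis by simp
  qed
qed

text \<open>Walking around the whole cycle brings \<open>d b\<close> back multiplied by the total of the cycle, which
  is why the total minus \<open>1\<close> kills it.\<close>

lemma transport_along_orbit:
  fixes d :: "'e \<Rightarrow> 'i \<Rightarrow> ('a::ab_group_add \<Rightarrow>\<^sub>0 int)"
  assumes N: "fmod.subspace N" and f: "permutation f"
    and step: "\<And>x. x \<in> orbit f b \<Longrightarrow> d (f x) - fscale (group_ring_of (\<omega> x)) (d x) \<in> N"
  shows "e \<in> orbit f b \<Longrightarrow> d e - fscale (group_ring_of (path_sum f \<omega> b e)) (d b) \<in> N"
    and "fscale (group_ring_of (\<Sum>x\<in>orbit f b. \<omega> x) - 1) (d b) \<in> N"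
proof -
  have b: "b \<in> orbit f b" by (rule permutation_self_in_orbit[OF f])
  define C where "C x a \<longleftrightarrow> d x - fscale (group_ring_of a) (d b) \<in> N" for x a
  have C: "C ((f ^^ k) b) (\<Sum>i<k. \<omega> ((f ^^ i) b))" for k
  proof (induction k)
    case 0
    then show ?case using fmod.subspace_0[OF N] by (simp add: C_def)
  next
    case (Suc k)
    let ?x = "(f ^^ k) b" and ?a = "\<Sum>i<k. \<omega> ((f ^^ i) b)"
    have "d (f ?x) - fscale (group_ring_of (\<omega> ?x)) (d ?x) \<in> N"
      by (rule step[OF funpow_in_orbit[OF b]])
    moreover have "fscale (group_ring_of (\<omega> ?x)) (d ?x) -
        fscale (group_ring_of (\<omega> ?x)) (fscale (group_ring_of ?a) (d b)) \<in> N"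
      using Suc.IH by (intro subspace_scale_diff[OF N]) (simp only: C_def)
    ultimately have "C (f ?x) (\<omega> ?x + ?a)"
      unfolding C_def group_ring_of_add fmod.scale_scale[symmetric] by (rule subspace_trans[OF N])
    then show ?case by (simp add: add.commute)
  qed
  show "d e - fscale (group_ring_of (path_sum f \<omega> b e)) (d b) \<in> N" if e: "e \<in> orbit f b"
    using C[of "funpow_dist f b e"] unfolding C_def funpow_dist_prop[OF e] path_sum_def .
  let ?w = "\<Sum>x\<in>orbit f b. \<omega> x"
  have "d b - fscale (group_ring_of ?w) (d b) \<in> N"
    using C[of "funpow_dist1 f b b"]
    unfolding C_def funpow_dist1_prop[OF b] orbit_sum_conv[OF f] .
  then have "fscale (group_ring_of ?w) (d b) - fscale 1 (d b) \<in> N"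
    using subspace_sym[OF N] by simp
  then show "fscale (group_ring_of ?w - 1) (d b) \<in> N"
    unfolding fmod.scale_left_diff_distrib .
qed

section \<open>Arcs and components of a link diagram\<close>

lemma classes_generated_image: "classes_generated B r = (\<lambda>e. {y \<in> B. equivclp r e y}) ` B"
proof -
  have "{(x, y). x \<in> B \<and> y \<in> B \<and> equivclp r x y} `` {e} = {y \<in> B. equivclp r e y}" if "e \<in> B" for e
    using that by auto
  then show ?thesis
    unfolding classes_generated_def quotient_def UNION_singleton_eq_range by (rule image_cong[OF HOL.refl])
qed

lemma equivclp_invariant:
  assumes "equivclp r x y" "\<And>a b. r a b \<Longrightarrow> f a = f b"
  shows "f x = f y"
  using assms(1)
proof (induction rule: equivclp_induct)
  case (step y z)
  then show ?case using assms(2) by metis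
qed (rule HOL.refl)

text \<open>Following the orientation through the crossing that an edge enters, on whichever strand. An edge
  that enters no crossing is a closed curve and is its own successor. The components of the diagram
  are the cycles of this permutation.\<close>

definition next_edge :: "('e, 'c) link_diagram \<Rightarrow> 'e \<Rightarrow> 'e" where
  "next_edge D e = (if e \<in> (\<lambda>(c, s). edge_at D c s In) ` (crossings D \<times> UNIV)
     then (\<lambda>(c, s). edge_at D c s Out)
       (inv_into (crossings D \<times> UNIV) (\<lambda>(c, s). edge_at D c s In) e)
     else e)"

definition arc_of :: "('e, 'c) link_diagram \<Rightarrow> 'e \<Rightarrow> 'e set" where
  "arc_of D e = {y \<in> edges D. equivclp
     (\<lambda>e e'. \<exists>c\<in>crossings D. e = edge_at D c Over In \<and> e' = edge_at D c Over Out) e y}"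

text \<open>An edge of a link diagram enters at most one crossing, so the sum has at most one term; the empty sum is the
  weight of an edge that ends on an over-strand or is a closed curve.\<close>

definition edge_weight ::
    "('x \<Rightarrow> 'x \<Rightarrow> 'a::ab_group_add) \<Rightarrow> ('e, 'c) link_diagram \<Rightarrow> ('e set \<Rightarrow> 'x) \<Rightarrow> 'e \<Rightarrow> 'a" where
  "edge_weight \<theta> D \<kappa> e = (\<Sum>\<chi> | \<chi> \<in> crossings D \<and> edge_at D \<chi> Under In = e. crossing_weight \<theta> D \<chi> \<kappa>)"

context
  fixes D :: "('e, 'c) link_diagram"
  assumes D: "oriented_link_diagram D"
begin

abbreviation (input) "in_edge \<equiv> \<lambda>(c, s). edge_at D c s In"
abbreviation (input) "out_edge \<equiv> \<lambda>(c, s). edge_at D c s Out"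
abbreviation (input) "strands \<equiv> crossings D \<times> (UNIV :: strand set)"

lemma finite_diagram: "finite (edges D)" "finite (crossings D)"
  using D by (simp_all add: oriented_link_diagram_def)

lemma in_out_edges: "inj_on in_edge strands" "inj_on out_edge strands" "in_edge ` strands = out_edge ` strands"
  using D unfolding oriented_link_diagram_def by blast+

lemma edge_at_in_edges:
  assumes "c \<in> crossings D"
  shows "edge_at D c s d \<in> edges D"
proof -
  have "edge_of D (c, s, d) \<in> edge_of D ` half_edges D"
    by (rule imageI) (simp add: half_edges_def assms)
  then show ?thesis using D unfolding oriented_link_diagram_def by (auto simp: edge_of_def)
qed

lemma edge_In_inject:
  assumes "c \<in> crossings D" "c' \<in> crossings D" "edge_at D c s In = edge_at D c' s' In"
  shows "c = c' \<and> s = s'"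
  using inj_onD[OF in_out_edges(1), of "(c, s)" "(c', s')"] assms by simp

lemma next_edge_In:
  assumes "c \<in> crossings D"
  shows "next_edge D (edge_at D c s In) = edge_at D c s Out"
proof -
  have "(c, s) \<in> strands" using assms by simp
  then show ?thesis
    using inv_into_f_f[OF in_out_edges(1), of "(c, s)"] imageI[of "(c, s)" strands in_edge]
    by (simp add: next_edge_def)
qed

lemma next_edge_free:
  assumes "\<And>c s. c \<in> crossings D \<Longrightarrow> e \<noteq> edge_at D c s In"
  shows "next_edge D e = e"
proof -
  have "e \<notin> in_edge ` strands" using assms by auto
  then show ?thesis by (simp only: next_edge_def if_False)
qed

lemma edge_cases [case_names enters free]:
  obtains c s where "c \<in> crossings D" "e = edge_at D c s In"
  | "\<And>c s. c \<in> crossings D \<Longrightarrow> e \<noteq> edge_at D c s In"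
  by blast

lemma next_edge_permutes: "next_edge D permutes edges D"
proof (rule bij_imp_permutes)
  have out_in: "edge_at D c s Out \<in> in_edge ` strands" if "c \<in> crossings D" for c s
    using that imageI[of "(c, s)" strands out_edge] in_out_edges(3) by simp
  have "inj_on (next_edge D) (edges D)"
  proof (rule inj_onI)
    fix e e' assume eq: "next_edge D e = next_edge D e'"
    show "e = e'"
    proof (cases e rule: edge_cases)
      case e: (enters c s)
      show ?thesis
      proof (cases e' rule: edge_cases)
        case e': (enters c' s')
        have "edge_at D c s Out = edge_at D c' s' Out" using eq e e' by (simp add: next_edge_In)
        then have "(c, s) = (c', s')" using inj_onD[OF in_out_edges(2), of "(c, s)" "(c', s')"] e e' by simp
        then show ?thesis using e e' by simp
      next
        case free
        then have "e' = edge_at D c s Out" using eq e by (simp add: next_edge_In next_edge_free)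
        then show ?thesis using out_in[OF e(1), of s] free by auto
      qed
    next
      case e: free
      show ?thesis
      proof (cases e' rule: edge_cases)
        case e': (enters c' s')
        then have "e = edge_at D c' s' Out" using eq e by (simp add: next_edge_In next_edge_free)
        then show ?thesis using out_in[OF e'(1), of s'] e by auto
      next
        case free
        then show ?thesis using eq e by (simp add: next_edge_free)
      qed
    qed
  qed
  moreover have "next_edge D e \<in> edges D" if "e \<in> edges D" for e
    using that by (cases e rule: edge_cases) (simp_all add: next_edge_In next_edge_free edge_at_in_edges)
  ultimately show "bij_betw (next_edge D) (edges D) (edges D)"
    using endo_inj_surj[OF finite_diagram(1)] by (simp add: bij_betw_def image_subsetI)
  show "next_edge D e = e" if "e \<notin> edges D" for e
    using that edge_at_in_edges by (intro next_edge_free) auto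
qed

lemma next_edge_permutation: "permutation (next_edge D)"
  using next_edge_permutes finite_diagram(1) by (auto simp: permutation_permutes)

lemmas orbit_self = permutation_self_in_orbit[OF next_edge_permutation]
lemmas orbit_next = permutation_orbit_step[OF next_edge_permutation]

lemma orbit_eq: "y \<in> orbit (next_edge D) x \<Longrightarrow> orbit (next_edge D) y = orbit (next_edge D) x"
  by (rule orbit_cyclic_eq3[OF cyclic_on_orbit'[OF next_edge_permutation]])

lemma components_eq_orbits: "components D = orbit (next_edge D) ` edges D"
proof -
  let ?r = "\<lambda>e e'. \<exists>c\<in>crossings D. \<exists>s. e = edge_at D c s In \<and> e' = edge_at D c s Out"
  have r_next: "equivclp ?r x (next_edge D x)" for x
  proof (cases x rule: edge_cases)
    case (enters c s)
    then have "?r x (next_edge D x)" by (auto simp: next_edge_In)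
    then show ?thesis by (rule r_into_equivclp)
  qed (simp add: next_edge_free)
  have "{y \<in> edges D. equivclp ?r e y} = orbit (next_edge D) e" if e: "e \<in> edges D" for e
  proof (intro equalityI subsetI)
    fix y assume "y \<in> {y \<in> edges D. equivclp ?r e y}"
    then have "equivclp ?r e y" by simp
    then have "orbit (next_edge D) e = orbit (next_edge D) y"
      by (rule equivclp_invariant) (auto simp: orbit_next simp flip: next_edge_In)
    then show "y \<in> orbit (next_edge D) e" using orbit_self by simp
  next
    fix y assume y: "y \<in> orbit (next_edge D) e"
    from y have "equivclp ?r e y"
    proof induction
      case (step y)
      show ?case by (rule equivclp_trans[OF step.IH r_next])
    qed (rule r_next)
    moreover have "y \<in> edges D" using permutes_orbit_subset[OF next_edge_permutes e] y by blast
    ultimately show "y \<in> {y \<in> edges D. equivclp ?r e y}" by simp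
  qed
  then show ?thesis unfolding components_def classes_generated_image by (intro image_cong) auto
qed

lemma arc_of_self: "e \<in> edges D \<Longrightarrow> e \<in> arc_of D e"
  by (simp add: arc_of_def)

lemma arcs_eq: "arcs D = arc_of D ` edges D"
  by (simp add: arcs_def classes_generated_image arc_of_def[abs_def])

lemma arc_of_eq:
  assumes "y \<in> arc_of D e"
  shows "arc_of D y = arc_of D e"
proof -
  have "equivclp (\<lambda>e e'. \<exists>c\<in>crossings D. e = edge_at D c Over In \<and> e' = edge_at D c Over Out) e y"
    using assms by (simp add: arc_of_def)
  then show ?thesis unfolding arc_of_def by (blast intro: equivclp_trans equivclp_sym)
qed

lemma arc_of_invariant:
  assumes "y \<in> arc_of D e" "\<And>c. c \<in> crossings D \<Longrightarrow> f (edge_at D c Over In) = f (edge_at D c Over Out)"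
  shows "f e = f y"
proof -
  have "equivclp (\<lambda>e e'. \<exists>c\<in>crossings D. e = edge_at D c Over In \<and> e' = edge_at D c Over Out) e y"
    using assms(1) by (simp add: arc_of_def)
  then show ?thesis by (rule equivclp_invariant) (auto simp: assms(2))
qed

lemma arc_of_Over: "c \<in> crossings D \<Longrightarrow> arc_of D (edge_at D c Over Out) = arc_of D (edge_at D c Over In)"
  by (intro arc_of_eq) (auto simp: arc_of_def edge_at_in_edges intro!: r_into_equivclp)

lemma arc_of_orbit: "y \<in> arc_of D e \<Longrightarrow> orbit (next_edge D) e = orbit (next_edge D) y"
  by (rule arc_of_invariant) (auto simp: orbit_next simp flip: next_edge_In)

lemma arc_at_eq:
  assumes "c \<in> crossings D"
  shows "arc_at D c s d = arc_of D (edge_at D c s d)"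
  unfolding arc_at_def
proof (rule the_equality)
  show "arc_of D (edge_at D c s d) \<in> arcs D \<and> edge_at D c s d \<in> arc_of D (edge_at D c s d)"
    using assms by (simp add: arcs_eq edge_at_in_edges arc_of_self)
next
  fix \<alpha> assume "\<alpha> \<in> arcs D \<and> edge_at D c s d \<in> \<alpha>"
  then show "\<alpha> = arc_of D (edge_at D c s d)" using arc_of_eq by (auto simp: arcs_eq)
qed

lemma arc_at_in_arcs: "c \<in> crossings D \<Longrightarrow> arc_at D c s d \<in> arcs D"
  by (simp add: arc_at_eq arcs_eq edge_at_in_edges)

lemma arc_subset_component:
  assumes "e \<in> edges D"
  shows "arc_of D e \<subseteq> orbit (next_edge D) x \<longleftrightarrow> e \<in> orbit (next_edge D) x"
proof
  assume "e \<in> orbit (next_edge D) x"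
  then have "orbit (next_edge D) e = orbit (next_edge D) x" by (rule orbit_eq)
  then show "arc_of D e \<subseteq> orbit (next_edge D) x" using arc_of_orbit orbit_self by blast
qed (use arc_of_self[OF assms] in blast)

lemma under_crossings_orbit:
  "under_crossings D (orbit (next_edge D) x) =
    {\<chi> \<in> crossings D. edge_at D \<chi> Under In \<in> orbit (next_edge D) x}"
proof -
  have "right_arc D \<chi> \<subseteq> orbit (next_edge D) x \<and> left_arc D \<chi> \<subseteq> orbit (next_edge D) x \<longleftrightarrow>
      edge_at D \<chi> Under In \<in> orbit (next_edge D) x" if \<chi>: "\<chi> \<in> crossings D" for \<chi>
  proof -
    have "edge_at D \<chi> Under Out \<in> orbit (next_edge D) x \<longleftrightarrow> edge_at D \<chi> Under In \<in> orbit (next_edge D) x"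
      unfolding next_edge_In[OF \<chi>, symmetric] by (metis orbit.step orbit_eq orbit_next orbit_self)
    then show ?thesis
      using \<chi> by (auto simp: right_arc_def left_arc_def arc_at_eq arc_subset_component edge_at_in_edges)
  qed
  then show ?thesis by (auto simp: under_crossings_def)
qed

lemma component_weight_orbit:
  assumes "x \<in> edges D"
  shows "component_weight \<theta> D (orbit (next_edge D) x) \<kappa> = (\<Sum>e\<in>orbit (next_edge D) x. edge_weight \<theta> D \<kappa> e)"
proof -
  let ?O = "orbit (next_edge D) x"
  have "(\<Sum>e\<in>?O. edge_weight \<theta> D \<kappa> e) =
      (\<Sum>e\<in>?O. \<Sum>\<chi> | \<chi> \<in> under_crossings D ?O \<and> edge_at D \<chi> Under In = e. crossing_weight \<theta> D \<chi> \<kappa>)"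
    unfolding edge_weight_def by (intro sum.cong) (auto simp: under_crossings_orbit)
  also have "\<dots> = component_weight \<theta> D ?O \<kappa>"
    unfolding component_weight_def
    by (intro sum.group) (use finite_diagram finite_orbit[OF orbit_self] in \<open>auto simp: under_crossings_orbit\<close>)
  finally show ?thesis ..
qed

lemma edge_weight_Under:
  assumes "c \<in> crossings D"
  shows "edge_weight \<theta> D \<kappa> (edge_at D c Under In) = crossing_weight \<theta> D c \<kappa>"
proof -
  have "{\<chi>. \<chi> \<in> crossings D \<and> edge_at D \<chi> Under In = edge_at D c Under In} = {c}"
    using assms edge_In_inject by blast
  then show ?thesis by (simp add: edge_weight_def)
qed

lemma edge_weight_not_Under:
  assumes "\<And>c. c \<in> crossings D \<Longrightarrow> e \<noteq> edge_at D c Under In"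
  shows "edge_weight \<theta> D \<kappa> e = 0"
proof -
  have "{\<chi>. \<chi> \<in> crossings D \<and> edge_at D \<chi> Under In = e} = {}" using assms by blast
  then show ?thesis by (simp only: edge_weight_def sum.empty)
qed

lemma edge_weight_Over: "c \<in> crossings D \<Longrightarrow> edge_weight \<theta> D \<kappa> (edge_at D c Over In) = 0"
  by (rule edge_weight_not_Under) (auto dest: edge_In_inject)

lemma wirtinger_relators_closed:
  "wirtinger_relator D ` crossings D \<subseteq>
    carrier (free_quandle (arcs D)) \<times> carrier (free_quandle (arcs D))"
  by (auto simp: wirtinger_relator_def right_arc_def left_arc_def over_arc_def arc_at_in_arcs
      fq_gen_closed quandle.qop_closed quandle_free_quandle)

lemma presents_link_quandle:
  "presents (arcs D) (wirtinger_relator D ` crossings D) (link_quandle D)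
    (presented_proj (arcs D) (wirtinger_relator D ` crossings D))"
  unfolding link_quandle_def by (rule presents_presented_quandle[OF wirtinger_relators_closed])

end

section \<open>The link quandle\<close>

context
  fixes D :: "('e, 'c) link_diagram"
  assumes D: "oriented_link_diagram D"
begin

text \<open>The orbits of the link quandle are the components of the diagram. Passing under a crossing moves
  from one under-arc to the other, which in the quandle is acting by the over-arc, so the potential
  changes by the crossing weight: at a positive crossing the walk goes from the right arc to the
  left one and picks up \<open>\<theta>\<close>, at a negative one it goes the other way and picks up \<open>-\<theta>\<close>.
  Passing over a crossing stays on the same arc with weight \<open>0\<close>. The holonomy of a component is
  therefore its weight.\<close>

theorem elementary_ideal_link_quandle:
  fixes X :: "('x, 'm) quandle_scheme"
    and \<theta> :: "'x \<Rightarrow> 'x \<Rightarrow> 'a::ab_group_add"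
  assumes X: "quandle X" and \<theta>: "quandle_2_cocycle X \<theta>"
    and \<rho>: "\<rho> \<in> quandle_hom (link_quandle D) X"
    and fp: "finite_presentation (link_quandle D) xs rs \<phi>"
  shows "elementary_ideal 0
      (alexander_matrix xs rs \<phi> \<rho> (\<lambda>x y. group_ring_of (\<theta> x y)) (\<lambda>x y. 0)) =
    generated_ideal {\<Prod>K\<in>components D. group_ring_of (component_weight \<theta> D K (hom_coloring D \<rho>)) - 1}"
proof -
  let ?f = "next_edge D" and ?F = "free_quandle (arcs D)"
  let ?R = "wirtinger_relator D ` crossings D"
  define c\<rho> where "c\<rho> = hom_coloring D \<rho>"
  define \<omega> where "\<omega> = edge_weight \<theta> D c\<rho>"
  define w where "w K = component_weight \<theta> D K c\<rho>" for K
  have w_orbit: "w (orbit ?f x) = (\<Sum>e\<in>orbit ?f x. \<omega> e)" if "x \<in> edges D" for x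
    using component_weight_orbit[OF D that] by (simp add: w_def \<omega>_def)
  \<comment> \<open>A base edge on every component, and the potential of an edge obtained by walking from the
    base edge to it.\<close>
  define b where "b K = (SOME e::'e. e \<in> K)" for K
  define \<tau> where "\<tau> x = path_sum ?f \<omega> (b (orbit ?f x)) x" for x
  have b_in: "b (orbit ?f x) \<in> orbit ?f x" for x
    unfolding b_def using orbit_self[OF D] by (rule someI)
  have orbit_b: "orbit ?f (b (orbit ?f x)) = orbit ?f x" for x
    by (rule orbit_eq[OF D b_in])
  have orbit_edges: "y \<in> edges D" if "x \<in> edges D" "y \<in> orbit ?f x" for x y
    using permutes_orbit_subset[OF next_edge_permutes[OF D] that(1)] that(2) by blast
  have \<tau>_step: "eq_modulo (w (orbit ?f x)) (\<tau> (?f x)) (\<tau> x + \<omega> x)" if x: "x \<in> edges D" for x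
  proof -
    have "x \<in> orbit ?f (b (orbit ?f x))" unfolding orbit_b by (rule orbit_self[OF D])
    from path_sum_step[OF next_edge_permutation[OF D] this, of \<omega>] show ?thesis
      by (simp only: \<tau>_def orbit_b orbit_next[OF D] w_orbit[OF x])
  qed
  have \<tau>_arc: "eq_modulo (w (orbit ?f e)) (\<tau> e) (\<tau> y)" if y: "y \<in> arc_of D e" for e y
  proof -
    have "{a. eq_modulo (w (orbit ?f e)) (\<tau> e) a} = {a. eq_modulo (w (orbit ?f y)) (\<tau> y) a}"
    proof (rule arc_of_invariant[OF D y])
      fix c assume c: "c \<in> crossings D"
      let ?i = "edge_at D c Over In" and ?o = "edge_at D c Over Out"
      have orb: "orbit ?f ?o = orbit ?f ?i" using orbit_next[OF D, of ?i] next_edge_In[OF D c] by simp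
      have "eq_modulo (w (orbit ?f ?i)) (\<tau> ?o) (\<tau> ?i)"
        using \<tau>_step[OF edge_at_in_edges[OF D c, of Over In]] edge_weight_Over[OF D c, of \<theta> c\<rho>]
        by (simp add: next_edge_In[OF D c] \<omega>_def)
      then show "{a. eq_modulo (w (orbit ?f ?i)) (\<tau> ?i) a} = {a. eq_modulo (w (orbit ?f ?o)) (\<tau> ?o) a}"
        unfolding orb by (meson eq_modulo_sym eq_modulo_trans)
    qed
    then show ?thesis using eq_modulo_refl by blast
  qed
  \<comment> \<open>Everything on edges descends to arcs through a representative edge.\<close>
  define \<epsilon> where "\<epsilon> \<alpha> = (SOME e::'e. e \<in> \<alpha>)" for \<alpha>
  define comp where "comp \<alpha> = orbit ?f (\<epsilon> \<alpha>)" for \<alpha>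
  have \<epsilon>_arc: "\<epsilon> (arc_of D e) \<in> arc_of D e" if "e \<in> edges D" for e
    unfolding \<epsilon>_def using arc_of_self[OF D that] by (rule someI)
  have comp_arc: "comp (arc_of D e) = orbit ?f e" if "e \<in> edges D" for e
    using arc_of_orbit[OF D \<epsilon>_arc[OF that]] by (simp add: comp_def)
  have \<tau>_\<epsilon>: "eq_modulo (w (orbit ?f e)) (\<tau> (\<epsilon> (arc_of D e))) (\<tau> e)" if "e \<in> edges D" for e
    by (rule eq_modulo_sym[OF \<tau>_arc[OF \<epsilon>_arc[OF that]]])
  have arc_\<epsilon>: "\<epsilon> \<alpha> \<in> edges D" "arc_of D (\<epsilon> \<alpha>) = \<alpha>" if "\<alpha> \<in> arcs D" for \<alpha>
  proof -
    obtain e where e: "e \<in> edges D" "\<alpha> = arc_of D e" using \<open>\<alpha> \<in> arcs D\<close> by (auto simp: arcs_eq[OF D])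
    show "\<epsilon> \<alpha> \<in> edges D" using \<epsilon>_arc[OF e(1)] e(2) by (simp add: arc_of_def)
    show "arc_of D (\<epsilon> \<alpha>) = \<alpha>" using arc_of_eq[OF D \<epsilon>_arc[OF e(1)]] e(2) by simp
  qed
  have crossing: "comp (right_arc D c) = comp (left_arc D c)"
    "eq_modulo (w (comp (right_arc D c)))
      (\<theta> (c\<rho> (right_arc D c)) (c\<rho> (over_arc D c)) + \<tau> (\<epsilon> (right_arc D c))) (\<tau> (\<epsilon> (left_arc D c)))"
    if c: "c \<in> crossings D" for c
  proof -
    let ?i = "edge_at D c Under In" and ?o = "edge_at D c Under Out"
    let ?t = "\<theta> (c\<rho> (right_arc D c)) (c\<rho> (over_arc D c))"
    note io = edge_at_in_edges[OF D c, of Under In] edge_at_in_edges[OF D c, of Under Out]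
    have orb: "orbit ?f ?o = orbit ?f ?i" using orbit_next[OF D, of ?i] next_edge_In[OF D c] by simp
    have \<omega>_i: "\<omega> ?i = (if positive D c then ?t else - ?t)"
      using edge_weight_Under[OF D c, of \<theta> c\<rho>] by (simp add: \<omega>_def crossing_weight_def Let_def)
    have step: "eq_modulo (w (orbit ?f ?i)) (\<tau> ?o) (\<tau> ?i + \<omega> ?i)"
      using \<tau>_step[OF io(1)] by (simp add: next_edge_In[OF D c])
    have i: "eq_modulo (w (orbit ?f ?i)) (\<tau> (\<epsilon> (arc_of D ?i))) (\<tau> ?i)" by (rule \<tau>_\<epsilon>[OF io(1)])
    have o: "eq_modulo (w (orbit ?f ?i)) (\<tau> (\<epsilon> (arc_of D ?o))) (\<tau> ?o)"
      using \<tau>_\<epsilon>[OF io(2)] by (simp only: orb)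
    show "comp (right_arc D c) = comp (left_arc D c)"
      by (simp add: right_arc_def left_arc_def arc_at_eq[OF D c] comp_arc io orb)
    show "eq_modulo (w (comp (right_arc D c))) (?t + \<tau> (\<epsilon> (right_arc D c))) (\<tau> (\<epsilon> (left_arc D c)))"
    proof (cases "positive D c")
      case True
      have "eq_modulo (w (orbit ?f ?i)) (?t + \<tau> (\<epsilon> (arc_of D ?i))) (?t + \<tau> ?i)"
        by (rule eq_modulo_add[OF i])
      moreover have "eq_modulo (w (orbit ?f ?i)) (?t + \<tau> ?i) (\<tau> ?o)"
        using eq_modulo_sym[OF step] True by (simp add: \<omega>_i add.commute)
      ultimately have "eq_modulo (w (orbit ?f ?i)) (?t + \<tau> (\<epsilon> (arc_of D ?i))) (\<tau> (\<epsilon> (arc_of D ?o)))"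
        by (meson eq_modulo_trans eq_modulo_sym o)
      then show ?thesis
        using True by (simp add: right_arc_def left_arc_def arc_at_eq[OF D c] comp_arc io)
    next
      case False
      have "eq_modulo (w (orbit ?f ?i)) (?t + \<tau> (\<epsilon> (arc_of D ?o))) (?t + \<tau> ?o)"
        by (rule eq_modulo_add[OF o])
      moreover have "eq_modulo (w (orbit ?f ?i)) (?t + \<tau> ?o) (\<tau> ?i)"
        using eq_modulo_add[OF step, of ?t] False by (simp add: \<omega>_i)
      ultimately have "eq_modulo (w (orbit ?f ?i)) (?t + \<tau> (\<epsilon> (arc_of D ?o))) (\<tau> (\<epsilon> (arc_of D ?i)))"
        by (meson eq_modulo_trans eq_modulo_sym i)
      then show ?thesis
        using False by (simp add: right_arc_def left_arc_def arc_at_eq[OF D c] comp_arc io orb)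
    qed
  qed
  have arcs_at: "right_arc D c \<in> arcs D" "left_arc D c \<in> arcs D" "over_arc D c \<in> arcs D"
    if "c \<in> crossings D" for c
    using that by (simp_all add: right_arc_def left_arc_def over_arc_def arc_at_in_arcs[OF D])
  define \<psi> where "\<psi> = presented_proj (arcs D) ?R"
  note P = presents_link_quandle[OF D, folded \<psi>_def]
  note R = presentsD(1)[OF P] and \<psi> = presentsD(2)[OF P] and onto = presentsD(3)[OF P]
    and \<psi>_eq = presentsD(4)[OF P]
  have c\<rho>_gen: "\<rho> (\<psi> (fq_gen (arcs D) \<alpha>)) = c\<rho> \<alpha>" for \<alpha>
    by (simp add: c\<rho>_def hom_coloring_def arc_elem_def \<psi>_def)
  obtain W where W: "cocycle_potential (arcs D) (\<lambda>u. \<rho> (\<psi> u)) \<theta> W"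
    using cocycle_potential_exists[OF X \<theta> quandle_hom_compose[OF \<psi> \<rho>]] .
  have W_gen: "W (fq_gen (arcs D) \<alpha>) = 0" if "\<alpha> \<in> arcs D" for \<alpha>
    using W that by (simp add: cocycle_potential_def)
  have W_op: "W (u \<rhd>\<^bsub>?F\<^esub> v) = W u + \<theta> (\<rho> (\<psi> u)) (\<rho> (\<psi> v))"
    if "u \<in> carrier ?F" "v \<in> carrier ?F" for u v
    using W that by (simp add: cocycle_potential_def)
  define lift where "lift = inv_into (carrier ?F) \<psi>"
  have lift: "lift q \<in> carrier ?F" "\<psi> (lift q) = q" if "q \<in> carrier (link_quandle D)" for q
    using that onto by (auto simp: lift_def inv_into_into f_inv_into_f)
  define \<kappa> where "\<kappa> q = comp (fq_base (lift q))" for q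
  define T where "T q = W (lift q) + \<tau> (\<epsilon> (fq_base (lift q)))" for q
  have \<kappa>_\<psi>: "\<kappa> (\<psi> u) = comp (fq_base u)" if u: "u \<in> carrier ?F" for u
    unfolding \<kappa>_def
  proof (rule orbit_invariant_congruence[OF R, of "\<lambda>u. comp (fq_base u)"])
    have "\<psi> u \<in> carrier (link_quandle D)" using quandle_hom_closed[OF \<psi> u] .
    from lift[OF this] show "(lift (\<psi> u), u) \<in> quandle_congruence ?F ?R" using \<psi>_eq u by blast
    fix x y assume "(x, y) \<in> ?R"
    then obtain c where c: "c \<in> crossings D" and xy: "(x, y) = wirtinger_relator D c" by auto
    then show "comp (fq_base x) = comp (fq_base y)"
      by (simp add: wirtinger_relator_def fq_base_op fq_base_gen fq_gen_closed arcs_at crossing)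
  qed (simp add: fq_base_op)
  have comp_in: "comp \<alpha> \<in> components D" if "\<alpha> \<in> arcs D" for \<alpha>
    using arc_\<epsilon>[OF that] by (simp add: comp_def components_eq_orbits[OF D])
  have \<kappa>_op: "\<kappa> (x \<rhd>\<^bsub>link_quandle D\<^esub> y) = \<kappa> x"
    if "x \<in> carrier (link_quandle D)" "y \<in> carrier (link_quandle D)" for x y
  proof -
    have "x \<rhd>\<^bsub>link_quandle D\<^esub> y = \<psi> (lift x \<rhd>\<^bsub>?F\<^esub> lift y)"
      using lift that by (simp add: quandle_hom_op[OF \<psi>])
    moreover have "lift x \<rhd>\<^bsub>?F\<^esub> lift y \<in> carrier ?F"
      using lift that by (simp add: quandle.qop_closed[OF quandle_free_quandle])
    ultimately show ?thesis
      using lift(1) that by (simp add: \<kappa>_\<psi> fq_base_op) (simp add: \<kappa>_def)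
  qed
  show ?thesis
    unfolding c\<rho>_def[symmetric] w_def[symmetric]
  proof (rule elementary_ideal_of_cyclic_orbits[OF X \<theta> \<rho> fp, where \<kappa> = \<kappa> and T = T])
    show "\<kappa> ` carrier (link_quandle D) = components D"
    proof (intro equalityI subsetI)
      fix K assume "K \<in> components D"
      then obtain e where e: "e \<in> edges D" "K = orbit ?f e" by (auto simp: components_eq_orbits[OF D])
      then have arc: "arc_of D e \<in> arcs D" by (simp add: arcs_eq[OF D])
      then have "\<kappa> (\<psi> (fq_gen (arcs D) (arc_of D e))) = K"
        using e by (simp add: \<kappa>_\<psi> fq_gen_closed fq_base_gen comp_arc)
      then show "K \<in> \<kappa> ` carrier (link_quandle D)"
        using quandle_hom_closed[OF \<psi> fq_gen_closed[OF arc]] by blast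
    next
      fix K assume "K \<in> \<kappa> ` carrier (link_quandle D)"
      then obtain q where q: "q \<in> carrier (link_quandle D)" and K: "K = \<kappa> q" by blast
      show "K \<in> components D" unfolding K \<kappa>_def by (rule comp_in[OF fq_base_in[OF lift(1)[OF q]]])
    qed
    show "\<kappa> (x \<rhd>\<^bsub>link_quandle D\<^esub> y) = \<kappa> x"
      if "x \<in> carrier (link_quandle D)" "y \<in> carrier (link_quandle D)" for x y
      by (rule \<kappa>_op[OF that])
    \<comment> \<open>\<open>T\<close> is well defined modulo the holonomy because walking along a component respects the
      relations at its crossings.\<close>
    define N where "N = {x. \<forall>K\<in>components D. group_ring_of (w K) - 1 dvd x K}"
    define d where "d u K = (if K = comp (fq_base u)
      then group_ring_of (W u + \<tau> (\<epsilon> (fq_base u))) else 0)" for u K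
    have N: "fmod.subspace N" by (rule fmod.subspaceI) (auto simp: N_def)
    have d_op: "d (u \<rhd>\<^bsub>?F\<^esub> v) = fscale (group_ring_of (\<theta> (\<rho> (\<psi> u)) (\<rho> (\<psi> v)))) (d u)"
      if "u \<in> carrier ?F" "v \<in> carrier ?F" for u v
      using that by (auto simp: fun_eq_iff d_def fq_base_op W_op ac_simps simp flip: group_ring_of_add)
    then have d: "derivation_mod ?F (\<lambda>u v. \<theta> (\<rho> (\<psi> u)) (\<rho> (\<psi> v))) N d"
      using fmod.subspace_0[OF N] by (auto simp: derivation_mod_def)
    have d_rel: "d u - d v \<in> N" if uv: "(u, v) \<in> ?R" for u v
    proof -
      obtain c where c: "c \<in> crossings D" and "(u, v) = wirtinger_relator D c" using uv by auto
      then have u: "u = fq_gen (arcs D) (right_arc D c) \<rhd>\<^bsub>?F\<^esub> fq_gen (arcs D) (over_arc D c)"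
        and v: "v = fq_gen (arcs D) (left_arc D c)"
        by (simp_all add: wirtinger_relator_def)
      have base: "fq_base u = right_arc D c" "fq_base v = left_arc D c"
        and W_uv: "W u = \<theta> (c\<rho> (right_arc D c)) (c\<rho> (over_arc D c))" "W v = 0"
        unfolding u v using arcs_at[OF c]
        by (simp_all add: fq_base_op fq_base_gen fq_gen_closed W_op W_gen c\<rho>_gen)
      show ?thesis
        using crossing[OF c] by (auto simp: N_def d_def base W_uv eq_modulo_def)
    qed
    have \<delta>: "derivation_mod (link_quandle D) (\<lambda>x y. \<theta> (\<rho> x) (\<rho> y)) N (\<lambda>q. d (lift q))"
      unfolding lift_def by (rule derivation_descends(2)[OF N P d d_rel])
    show "group_ring_of (w (\<kappa> x)) - 1 dvd
        group_ring_of (T (x \<rhd>\<^bsub>link_quandle D\<^esub> y)) - group_ring_of (\<theta> (\<rho> x) (\<rho> y) + T x)"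
      if xy: "x \<in> carrier (link_quandle D)" "y \<in> carrier (link_quandle D)" for x y
    proof -
      have "\<kappa> x \<in> components D" unfolding \<kappa>_def by (rule comp_in[OF fq_base_in[OF lift(1)[OF xy(1)]]])
      moreover have "d (lift (x \<rhd>\<^bsub>link_quandle D\<^esub> y)) - fscale (group_ring_of (\<theta> (\<rho> x) (\<rho> y))) (d (lift x)) \<in> N"
        using \<delta> xy by (simp add: derivation_mod_def)
      ultimately have "group_ring_of (w (\<kappa> x)) - 1 dvd (d (lift (x \<rhd>\<^bsub>link_quandle D\<^esub> y)) -
          fscale (group_ring_of (\<theta> (\<rho> x) (\<rho> y))) (d (lift x))) (\<kappa> x)"
        by (simp add: N_def)
      then show ?thesis
        using \<kappa>_op[OF xy] by (simp add: d_def T_def group_ring_of_add flip: \<kappa>_def)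
    qed
  next
    fix N and d :: "'e set fq set \<Rightarrow> nat \<Rightarrow> 'a \<Rightarrow>\<^sub>0 int"
    assume N: "fmod.subspace N"
      and d: "derivation_mod (link_quandle D) (\<lambda>x y. \<theta> (\<rho> x) (\<rho> y)) N d"
    define a where "a x = d (\<psi> (fq_gen (arcs D) (arc_of D x)))" for x
    have a_step: "a (?f x) - fscale (group_ring_of (\<omega> x)) (a x) \<in> N" if x: "x \<in> edges D" for x
    proof (cases x rule: edge_cases[OF D, case_names enters free])
      case (enters c s)
      note c = enters(1)
      show ?thesis
      proof (cases s)
        case Over
        then have "arc_of D (?f x) = arc_of D x" "\<omega> x = 0"
          using enters by (simp_all add: next_edge_In[OF D] arc_of_Over[OF D] edge_weight_Over[OF D] \<omega>_def)
        then show ?thesis using fmod.subspace_0[OF N] by (simp add: a_def zero_fun_def)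
      next
        case Under
        let ?t = "\<theta> (c\<rho> (right_arc D c)) (c\<rho> (over_arc D c))"
        let ?g = "\<lambda>\<alpha>. fq_gen (arcs D) \<alpha>"
        note gens = fq_gen_closed[OF arcs_at(1)[OF c]] fq_gen_closed[OF arcs_at(2)[OF c]]
          fq_gen_closed[OF arcs_at(3)[OF c]]
        have "(?g (right_arc D c) \<rhd>\<^bsub>?F\<^esub> ?g (over_arc D c), ?g (left_arc D c)) \<in> ?R"
          using c by (auto simp: wirtinger_relator_def)
        then have "\<psi> (?g (right_arc D c) \<rhd>\<^bsub>?F\<^esub> ?g (over_arc D c)) = \<psi> (?g (left_arc D c))"
          using gens by (subst \<psi>_eq) (auto intro: quandle_congruence.base
              quandle.qop_closed[OF quandle_free_quandle])
        then have "\<psi> (?g (left_arc D c)) = \<psi> (?g (right_arc D c)) \<rhd>\<^bsub>link_quandle D\<^esub> \<psi> (?g (over_arc D c))"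
          using gens by (simp add: quandle_hom_op[OF \<psi>])
        moreover have "d (\<psi> (?g (right_arc D c)) \<rhd>\<^bsub>link_quandle D\<^esub> \<psi> (?g (over_arc D c))) -
            fscale (group_ring_of ?t) (d (\<psi> (?g (right_arc D c)))) \<in> N"
          using d quandle_hom_closed[OF \<psi> gens(1)] quandle_hom_closed[OF \<psi> gens(3)]
          unfolding derivation_mod_def c\<rho>_gen[symmetric] by blast
        ultimately have rel: "d (\<psi> (?g (left_arc D c))) -
            fscale (group_ring_of ?t) (d (\<psi> (?g (right_arc D c)))) \<in> N"
          by (simp only:)
        have \<omega>: "\<omega> x = (if positive D c then ?t else - ?t)"
          using enters Under edge_weight_Under[OF D c, of \<theta> c\<rho>]
          by (simp add: \<omega>_def crossing_weight_def Let_def)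
        have fx: "?f x = edge_at D c Under Out" using enters Under by (simp add: next_edge_In[OF D])
        show ?thesis
        proof (cases "positive D c")
          case True
          then have "a (?f x) = d (\<psi> (?g (left_arc D c)))" "a x = d (\<psi> (?g (right_arc D c)))" "\<omega> x = ?t"
            unfolding fx a_def using enters Under \<omega>
            by (simp_all add: left_arc_def right_arc_def arc_at_eq[OF D c])
          then show ?thesis using rel by (simp only:)
        next
          case False
          then have "a (?f x) = d (\<psi> (?g (right_arc D c)))" "a x = d (\<psi> (?g (left_arc D c)))" "\<omega> x = - ?t"
            unfolding fx a_def using enters Under \<omega>
            by (simp_all add: left_arc_def right_arc_def arc_at_eq[OF D c])
          then show ?thesis using subspace_unscale[OF N rel] by (simp only:)
        qed
      qed
    next
      case free
      then have "?f x = x" "\<omega> x = 0"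
        by (simp_all add: next_edge_free[OF D] edge_weight_not_Under[OF D] \<omega>_def)
      then show ?thesis using fmod.subspace_0[OF N] by (simp add: zero_fun_def)
    qed
    have walk: "a x - fscale (group_ring_of (\<tau> x)) (a (b (orbit ?f x))) \<in> N"
      "fscale (group_ring_of (w (orbit ?f x)) - 1) (a (b (orbit ?f x))) \<in> N"
      if x: "x \<in> edges D" for x
    proof -
      have step: "a (?f y) - fscale (group_ring_of (\<omega> y)) (a y) \<in> N" if "y \<in> orbit ?f (b (orbit ?f x))" for y
        using that a_step orbit_edges[OF x] unfolding orbit_b by blast
      note transport = transport_along_orbit[where d = a and b = "b (orbit ?f x)" and \<omega> = \<omega>,
          OF N next_edge_permutation[OF D]]
      have "x \<in> orbit ?f (b (orbit ?f x))" unfolding orbit_b by (rule orbit_self[OF D])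
      then show "a x - fscale (group_ring_of (\<tau> x)) (a (b (orbit ?f x))) \<in> N"
        unfolding \<tau>_def by (rule transport(1)[rotated]) (rule step)
      have "fscale (group_ring_of (\<Sum>y\<in>orbit ?f (b (orbit ?f x)). \<omega> y) - 1) (a (b (orbit ?f x))) \<in> N"
        by (rule transport(2)) (rule step)
      then show "fscale (group_ring_of (w (orbit ?f x)) - 1) (a (b (orbit ?f x))) \<in> N"
        unfolding orbit_b w_orbit[OF x] .
    qed
    show "\<exists>e. (\<forall>q\<in>carrier (link_quandle D). d q - fscale (group_ring_of (T q)) (e (\<kappa> q)) \<in> N) \<and>
        (\<forall>K\<in>components D. fscale (group_ring_of (w K) - 1) (e K) \<in> N)"
    proof (intro exI[of _ "\<lambda>K. a (b K)"] conjI ballI)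
      fix K assume "K \<in> components D"
      then obtain x where "x \<in> edges D" "K = orbit ?f x" by (auto simp: components_eq_orbits[OF D])
      then show "fscale (group_ring_of (w K) - 1) (a (b K)) \<in> N" using walk(2) by (simp only:)
    next
      fix q assume q: "q \<in> carrier (link_quandle D)"
      define u where "u = lift q"
      have u: "u \<in> carrier ?F" "\<psi> u = q" using lift[OF q] by (simp_all add: u_def)
      define \<alpha> where "\<alpha> = fq_base u"
      have \<alpha>: "\<alpha> \<in> arcs D" using fq_base_in[OF u(1)] by (simp add: \<alpha>_def)
      have "d (\<psi> u) - fscale (group_ring_of (W u)) (d (\<psi> (fq_gen (arcs D) (fq_base u)))) \<in> N"
        by (rule derivation_of_word[OF N derivation_mod_compose[OF \<psi> d] W u(1)])
      then have 1: "d q - fscale (group_ring_of (W u)) (a (\<epsilon> \<alpha>)) \<in> N"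
        unfolding u(2) \<alpha>_def[symmetric] a_def arc_\<epsilon>(2)[OF \<alpha>] .
      have "fscale (group_ring_of (W u)) (a (\<epsilon> \<alpha>)) -
          fscale (group_ring_of (W u)) (fscale (group_ring_of (\<tau> (\<epsilon> \<alpha>))) (a (b (comp \<alpha>)))) \<in> N"
        unfolding comp_def by (intro subspace_scale_diff[OF N] walk(1) arc_\<epsilon>(1) \<alpha>)
      from subspace_trans[OF N 1 this]
      show "d q - fscale (group_ring_of (T q)) (a (b (\<kappa> q))) \<in> N"
        unfolding T_def \<kappa>_def u_def[symmetric] \<alpha>_def[symmetric] group_ring_of_add fmod.scale_scale .
    qed
  qed
qed

end

theorem theorem1:
  fixes D :: "('e, 'c) link_diagram"
    and K :: "nat \<Rightarrow> 'e set" and n :: nat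
    and X :: "('x, 'm) quandle_scheme"
    and \<theta> :: "'x \<Rightarrow> 'x \<Rightarrow> 'a::ab_group_add"
    and \<rho> :: "'e set fq set \<Rightarrow> 'x"
    and xs :: "'s list" and rs :: "('s fq \<times> 's fq) list"
    and \<phi> :: "'s fq set \<Rightarrow> 'e set fq set"
  assumes "oriented_link_diagram D"
    and "bij_betw K {1..n} (components D)"
    and "quandle X"
    and "\<rho> \<in> quandle_hom (link_quandle D) X"
    and "quandle_2_cocycle X \<theta>"
    and "finite_presentation (link_quandle D) xs rs \<phi>"
  shows "elementary_ideal 0
           (alexander_matrix xs rs \<phi> \<rho> (\<lambda>x y. group_ring_of (\<theta> x y)) (\<lambda>x y. 0))
         = generated_ideal
             {\<Prod>i = 1..n. (group_ring_of (component_weight \<theta> D (K i) (hom_coloring D \<rho>)) - 1)}"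
proof -
  have "(\<Prod>i = 1..n. (group_ring_of (component_weight \<theta> D (K i) (hom_coloring D \<rho>)) - 1)) =
      (\<Prod>C\<in>components D. (group_ring_of (component_weight \<theta> D C (hom_coloring D \<rho>)) - 1))"
    by (rule prod.reindex_bij_betw[OF assms(2)])
  then show ?thesis
    by (simp only: elementary_ideal_link_quandle[OF assms(1,3,5,4,6)])
qed

end
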